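(* Let $\mathcal{S}\subseteq \mathcal{M}_n(\mathbb{C})$ be an irreducible semigroup of matrices in which all ring commutators $ST-TS$, $S,T\in\mathcal{S}$, have real spectra. Then $\mathcal{S}$ is realizable, i.e., there is an invertible $X\in\mathcal{M}_n(\mathbb{C})$ such that $X^{-1}SX$ has real entries for every $S\in\mathcal{S}$.
   Context: $\mathcal{M}_n(\mathbb{C})$ is the algebra of all $n\times n$ complex matrices. A semigroup of matrices is a set of matrices closed under multiplication. A set of matrices is irreducible if its members have no common invariant subspace of $\mathbb{C}^n$ other than $\{0\}$ and $\mathbb{C}^n$. A matrix has real spectrum if all its eigenvalues are real.
   Formalization: The formal theorem assumes n ≥ 2; for n = 1 the statement is false, since the irreducible semigroup {1, i, −1, −i} of 1×1 matrices has zero commutators but no conjugate of (i) is real. *)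

theory Defs
  imports "Jordan_Normal_Form.Spectral_Radius" "Jordan_Normal_Form.VS_Connect"
begin

definition matrix_semigroup :: "nat \<Rightarrow> complex mat set \<Rightarrow> bool" where
  "matrix_semigroup n \<S> \<longleftrightarrow>
     \<S> \<subseteq> carrier_mat n n \<and> (\<forall>S\<in>\<S>. \<forall>T\<in>\<S>. S * T \<in> \<S>)"

definition invariant_subspace :: "nat \<Rightarrow> complex mat set \<Rightarrow> complex vec set \<Rightarrow> bool" where
  "invariant_subspace n \<S> W \<longleftrightarrow>
     VectorSpace.subspace class_ring W (module_vec TYPE(complex) n) \<and>
     (\<forall>S\<in>\<S>. \<forall>w\<in>W. S *\<^sub>v w \<in> W)"

definition irreducible_matrices :: "nat \<Rightarrow> complex mat set \<Rightarrow> bool" where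
  "irreducible_matrices n \<S> \<longleftrightarrow>
     (\<forall>W. invariant_subspace n \<S> W \<longrightarrow> W = {0\<^sub>v n} \<or> W = carrier_vec n)"

definition has_real_spectrum :: "complex mat \<Rightarrow> bool" where
  "has_real_spectrum A \<longleftrightarrow> spectrum A \<subseteq> \<real>"

text \<open>The matrix \<open>Y\<close> is the inverse of \<open>X\<close>, so that \<open>Y * S * X\<close> is the conjugate of \<open>S\<close> by \<open>X\<close>.\<close>

definition realizable :: "nat \<Rightarrow> complex mat set \<Rightarrow> bool" where
  "realizable n \<S> \<longleftrightarrow>
     (\<exists>X\<in>carrier_mat n n. \<exists>Y\<in>carrier_mat n n.
        inverts_mat X Y \<and> inverts_mat Y X \<and>
        (\<forall>S\<in>\<S>. elements_mat (Y * S * X) \<subseteq> \<real>))"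

end

theory Submission
  imports Defs "HOL-Algebra.Multiplicative_Group"
begin

text \<open>
  The semigroup is realizable as soon as it leaves invariant a real form of \<open>\<complex>\<^sup>n\<close>: a real
  subspace \<open>W\<close>, closed under the semigroup, with \<open>W \<inter> \<i>W = 0\<close> (\<open>real_form_realizable\<close>).
  Most of the work is to produce a real form.

  \<^bold>\<open>Reduction to minimal rank.\<close> Nonnegative real multiples and limits preserve the hypotheses, so the
  semigroup may be replaced by the closed cone \<open>T\<close> that it generates. Factor a nonzero member of least
  rank \<open>r\<close> as \<open>L * R\<close>, where \<open>L\<close> has \<open>r\<close> columns and \<open>R\<close> has \<open>r\<close> rows. The compressions
  \<open>R * B * L\<close>, \<open>B \<in> T\<close>, form an irreducible semigroup of \<open>r \<times> r\<close> matrices; their commutators have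
  the form \<open>R * D * L\<close> where \<open>D * L * R\<close> is a commutator of members of \<open>T\<close>, and these two products have
  the same nonzero eigenvalues. By minimality of \<open>r\<close> every nonzero matrix in the closure of the compressions is
  invertible. A real form \<open>V\<close> of \<open>\<complex>\<^sup>r\<close> invariant under the compressions pulls back to the real form
  \<open>{y. \<forall>B\<in>T. R * B * y \<in> V}\<close> of \<open>\<complex>\<^sup>n\<close> (\<open>minimal_factor.invariant_real_form\<close>).

  \<^bold>\<open>Rank one.\<close> If \<open>r = 1\<close>, the compressions are numbers, and they are real (\<open>real_rank_one_corner\<close>): for
  rank one matrices \<open>X\<close> and \<open>Y\<close>, half the trace of the squared commutator is \<open>p (p - q)\<close> with
  \<open>p = tr (X Y)\<close> and \<open>q = tr X tr Y\<close>, and it has to be nonnegative. A nonreal trace allows \<open>X\<close> to be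
  rescaled by a nonreal number, which forces \<open>p (p - q) = 0\<close> throughout and then a common invariant hyperplane.

  \<^bold>\<open>Higher rank.\<close> If \<open>r \<ge> 2\<close>, the members whose determinant has modulus one form a bounded closed
  group \<open>G\<close>. If nonscalar elements of \<open>G\<close> approached the identity, the normalized differences
  would have a traceless limit \<open>Y\<close>; the matrix \<open>Y - u * Y * u\<^sup>-\<^sup>1\<close> would have real spectrum and be tangent
  to a bounded group, hence vanish for every \<open>u\<close>, and Schur's lemma gives \<open>Y = 0\<close>, a contradiction
  (\<open>no_nonscalar_sequence_to_one\<close>). So \<open>G\<close> is finite modulo scalars.

  The commutators of a finite irreducible group in dimension at least two cannot all be nilpotent: otherwise
  an element commuting with one of its conjugates would equal it, a counting argument shows that such groups are abelian
  (\<open>abelian_if_commuting_conjugates\<close>), and an irreducible abelian group lives in dimension one. In particular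
  \<open>G\<close> contains no nonreal scalar \<open>c\<close>, since then each eigenvalue \<open>e\<close> of a commutator would be real
  together with \<open>c e\<close>. Hence \<open>G\<close> is finite.

  For finite \<open>G\<close> the argument is that of Frobenius and Schur. The numbers
  \<open>tr ((E - u * E * u\<^sup>-\<^sup>1)\<^sup>2)\<close> are nonnegative, being sums of squares of real eigenvalues. Their sum over
  \<open>E\<close> and \<open>u\<close> is computed from the invariant bilinear forms of \<open>G\<close>: it vanishes if there is no
  invariant form, which makes all commutators nilpotent, and it is negative if the form is skew. So \<open>G\<close> preserves
  a nonzero symmetric bilinear form, which together with an invariant inner product yields a conjugate linear map
  commuting with \<open>G\<close>, and an eigenspace of this map is an invariant real form (\<open>symmetric_form_real_form\<close>).
\<close>

section \<open>Finite groups whose elements commute with no conjugate but themselves\<close>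

lemma (in group) conj_commute_shift:
  assumes "w \<in> carrier G" "a \<in> carrier G" "b \<in> carrier G" "w \<otimes> a \<otimes> inv w = b"
  shows "w \<otimes> a = b \<otimes> w"
  using assms by (metis inv_solve_right m_closed)

lemma (in group) conj_mult:
  assumes "w \<in> carrier G" "a \<in> carrier G" "b \<in> carrier G"
  shows "(w \<otimes> a \<otimes> inv w) \<otimes> (w \<otimes> b \<otimes> inv w) = w \<otimes> (a \<otimes> b) \<otimes> inv w"
proof -
  have "inv w \<otimes> (w \<otimes> (b \<otimes> inv w)) = b \<otimes> inv w"
    using assms by (simp add: m_assoc[symmetric])
  thus ?thesis using assms by (simp add: m_assoc)
qed

lemma (in group) conj_cancel:
  assumes "w \<in> carrier G" "a \<in> carrier G" "b \<in> carrier G" "w \<otimes> a \<otimes> inv w = w \<otimes> b \<otimes> inv w"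
  shows "a = b"
  using assms by simp

text \<open>
  In a minimal counterexample the centralizers of noncentral elements are abelian, hence two of them either
  coincide or meet in the center \<open>Z\<close>. Elements of such a centralizer \<open>C a\<close> are not fused by the group, so
  the conjugates of \<open>C a - Z\<close> make up at least half of the group, but never all noncentral elements. Choosing
  a noncentral \<open>b\<close> outside them gives a second, disjoint half, which leaves no room for the identity. This
  is the counting in the theorem of Miller and Moreno on minimal nonabelian groups.
\<close>

lemma abelian_if_commuting_conjugates:
  fixes G :: "('a,'b) monoid_scheme"
  assumes "group G" "finite (carrier G)"
    and "\<And>a b. \<lbrakk>a \<in> carrier G; b \<in> carrier G;
           a \<otimes>\<^bsub>G\<^esub> (b \<otimes>\<^bsub>G\<^esub> a \<otimes>\<^bsub>G\<^esub> inv\<^bsub>G\<^esub> b) = (b \<otimes>\<^bsub>G\<^esub> a \<otimes>\<^bsub>G\<^esub> inv\<^bsub>G\<^esub> b) \<otimes>\<^bsub>G\<^esub> a\<rbrakk>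
           \<Longrightarrow> a \<otimes>\<^bsub>G\<^esub> b = b \<otimes>\<^bsub>G\<^esub> a"
  shows "\<forall>x\<in>carrier G. \<forall>y\<in>carrier G. x \<otimes>\<^bsub>G\<^esub> y = y \<otimes>\<^bsub>G\<^esub> x"
  using assms
proof (induction "card (carrier G)" arbitrary: G rule: less_induct)
  case (less G)
  interpret group G by fact
  note fin = less.prems(2) and star = less.prems(3)
  define C where "C a = {x \<in> carrier G. x \<otimes>\<^bsub>G\<^esub> a = a \<otimes>\<^bsub>G\<^esub> x}" for a
  define Z where "Z = {x \<in> carrier G. \<forall>y\<in>carrier G. x \<otimes>\<^bsub>G\<^esub> y = y \<otimes>\<^bsub>G\<^esub> x}"
  have finC: "finite (C a)" for a unfolding C_def using fin by simp
  have finZ: "finite Z" unfolding Z_def using fin by simp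
  have sub: "subgroup (C a) G" if a: "a \<in> carrier G" for a
  proof (rule subgroupI)
    show "C a \<subseteq> carrier G" unfolding C_def by auto
    show "C a \<noteq> {}" unfolding C_def using a by auto
    show "inv\<^bsub>G\<^esub> x \<in> C a" if "x \<in> C a" for x
    proof -
      have x: "x \<in> carrier G" and e: "x \<otimes>\<^bsub>G\<^esub> a = a \<otimes>\<^bsub>G\<^esub> x" using that unfolding C_def by auto
      have "inv\<^bsub>G\<^esub> x \<otimes>\<^bsub>G\<^esub> a = inv\<^bsub>G\<^esub> x \<otimes>\<^bsub>G\<^esub> (a \<otimes>\<^bsub>G\<^esub> x) \<otimes>\<^bsub>G\<^esub> inv\<^bsub>G\<^esub> x" using x a by (simp add: m_assoc)
      also have "\<dots> = a \<otimes>\<^bsub>G\<^esub> inv\<^bsub>G\<^esub> x" using x a unfolding e[symmetric] by (simp add: m_assoc[symmetric])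
      finally show ?thesis using x unfolding C_def by auto
    qed
    show "x \<otimes>\<^bsub>G\<^esub> y \<in> C a" if "x \<in> C a" "y \<in> C a" for x y
    proof -
      have x: "x \<in> carrier G" "y \<in> carrier G" and e: "x \<otimes>\<^bsub>G\<^esub> a = a \<otimes>\<^bsub>G\<^esub> x" "y \<otimes>\<^bsub>G\<^esub> a = a \<otimes>\<^bsub>G\<^esub> y"
        using that unfolding C_def by auto
      have "x \<otimes>\<^bsub>G\<^esub> y \<otimes>\<^bsub>G\<^esub> a = (x \<otimes>\<^bsub>G\<^esub> a) \<otimes>\<^bsub>G\<^esub> y" using x a e(2) by (simp add: m_assoc)
      also have "\<dots> = a \<otimes>\<^bsub>G\<^esub> (x \<otimes>\<^bsub>G\<^esub> y)" using x a unfolding e(1) by (simp add: m_assoc)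
      finally show ?thesis using x unfolding C_def by auto
    qed
  qed
  \<comment> \<open>The centralizer of a noncentral element is a proper subgroup that inherits the hypothesis, so it is
    abelian by induction.\<close>
  have Ccomm: "x \<otimes>\<^bsub>G\<^esub> y = y \<otimes>\<^bsub>G\<^esub> x" if a: "a \<in> carrier G" "a \<notin> Z" and xy: "x \<in> C a" "y \<in> C a" for a x y
  proof -
    let ?H = "G\<lparr>carrier := C a\<rparr>"
    obtain y where "y \<in> carrier G" "a \<otimes>\<^bsub>G\<^esub> y \<noteq> y \<otimes>\<^bsub>G\<^esub> a" using a unfolding Z_def by auto
    hence "y \<in> carrier G" "y \<notin> C a" unfolding C_def by auto
    hence "C a \<noteq> carrier G" by auto
    hence "C a \<subset> carrier G" unfolding C_def by auto
    hence lt: "card (carrier ?H) < card (carrier G)" using fin psubset_card_mono by auto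
    have gH: "group ?H" using sub[OF a(1)] by (rule subgroup.subgroup_is_group) (rule less.prems)
    have "\<forall>x\<in>carrier ?H. \<forall>y\<in>carrier ?H. x \<otimes>\<^bsub>?H\<^esub> y = y \<otimes>\<^bsub>?H\<^esub> x"
    proof (rule less.hyps[OF lt gH])
      show "finite (carrier ?H)" using finC by simp
      fix u v assume u: "u \<in> carrier ?H" and v: "v \<in> carrier ?H"
        and e: "u \<otimes>\<^bsub>?H\<^esub> (v \<otimes>\<^bsub>?H\<^esub> u \<otimes>\<^bsub>?H\<^esub> inv\<^bsub>?H\<^esub> v) = v \<otimes>\<^bsub>?H\<^esub> u \<otimes>\<^bsub>?H\<^esub> inv\<^bsub>?H\<^esub> v \<otimes>\<^bsub>?H\<^esub> u"
      have "inv\<^bsub>?H\<^esub> v = inv\<^bsub>G\<^esub> v" using v by (simp add: m_inv_consistent[OF sub[OF a(1)]])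
      thus "u \<otimes>\<^bsub>?H\<^esub> v = v \<otimes>\<^bsub>?H\<^esub> u" using star[of u v] e u v by (simp add: C_def)
    qed
    thus ?thesis using xy by simp
  qed
  have Csame: "C b = C a" if a: "a \<in> carrier G" "a \<notin> Z" and b: "b \<in> C a" "b \<notin> Z" for a b
  proof -
    have bG: "b \<in> carrier G" using b unfolding C_def by auto
    have "a \<in> C b" using a b unfolding C_def by auto
    have 1: "x \<in> C b" if "x \<in> C a" for x using Ccomm[OF a that b(1)] that unfolding C_def by simp
    have 2: "x \<in> C a" if "x \<in> C b" for x using Ccomm[OF bG b(2) that \<open>a \<in> C b\<close>] that unfolding C_def by simp
    show ?thesis using 1 2 by blast
  qed
  have ZC: "Z \<subseteq> C a" if "a \<in> carrier G" for a using that unfolding Z_def C_def by auto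
  \<comment> \<open>If \<open>w\<close> conjugates \<open>c\<close> to \<open>d\<close> inside the abelian group \<open>C a\<close>, then \<open>c\<close> commutes with its conjugate, hence with \<open>w\<close>.\<close>
  have fusion: "w \<in> C a" if a: "a \<in> carrier G" "a \<notin> Z" and c: "c \<in> C a" "c \<notin> Z"
      and d: "d \<in> C a" and w: "w \<in> carrier G" and e: "w \<otimes>\<^bsub>G\<^esub> c \<otimes>\<^bsub>G\<^esub> inv\<^bsub>G\<^esub> w = d" for a c d w
  proof -
    have cG: "c \<in> carrier G" using c unfolding C_def by auto
    have "c \<otimes>\<^bsub>G\<^esub> w = w \<otimes>\<^bsub>G\<^esub> c" using star[OF cG w] Ccomm[OF a c(1) d] unfolding e by simp
    hence "w \<in> C c" using w unfolding C_def by auto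
    thus ?thesis using Csame[OF a c] by simp
  qed
  \<comment> \<open>The conjugates of the noncentral elements of \<open>C a\<close> form \<open>U a\<close>.\<close>
  define f where "f = (\<lambda>(x,c). x \<otimes>\<^bsub>G\<^esub> c \<otimes>\<^bsub>G\<^esub> inv\<^bsub>G\<^esub> x)"
  define U where "U a = f ` (carrier G \<times> (C a - Z))" for a
  have U_carrier: "U a \<subseteq> carrier G - Z" if a: "a \<in> carrier G" for a
  proof
    fix u assume "u \<in> U a"
    then obtain x c where x: "x \<in> carrier G" and c: "c \<in> carrier G" "c \<notin> Z" and u: "u = x \<otimes>\<^bsub>G\<^esub> c \<otimes>\<^bsub>G\<^esub> inv\<^bsub>G\<^esub> x"
      unfolding U_def f_def C_def by auto
    have "u \<notin> Z"
    proof
      assume uZ: "u \<in> Z"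
      have "x \<otimes>\<^bsub>G\<^esub> c = u \<otimes>\<^bsub>G\<^esub> x" by (rule conj_commute_shift[OF x c(1) _ u[symmetric]]) (use uZ Z_def in simp)
      also have "\<dots> = x \<otimes>\<^bsub>G\<^esub> u" using uZ x unfolding Z_def by auto
      finally have "x \<otimes>\<^bsub>G\<^esub> c = x \<otimes>\<^bsub>G\<^esub> u" .
      moreover have "u \<in> carrier G" using uZ unfolding Z_def by simp
      ultimately have "c = u" using x c Units_l_cancel[of x c u] by simp
      thus False using uZ c by simp
    qed
    thus "u \<in> carrier G - Z" using u x c by auto
  qed
  \<comment> \<open>A fibre of \<open>f\<close> is a coset of \<open>C a\<close> by the fusion property, so double
    counting gives the size of \<open>U a\<close>.\<close>
  have cardU: "card (carrier G) * (card (C a) - card Z) = card (U a) * card (C a)" if a: "a \<in> carrier G" "a \<notin> Z" for a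
  proof -
    let ?S = "carrier G \<times> (C a - Z)"
    have finS: "finite ?S" using fin finC by auto
    have fib: "card {s \<in> ?S. f s = u} = card (C a)" if uS: "u \<in> f ` ?S" for u
    proof -
      obtain y d where y: "y \<in> carrier G" and d: "d \<in> C a" "d \<notin> Z" and u: "u = y \<otimes>\<^bsub>G\<^esub> d \<otimes>\<^bsub>G\<^esub> inv\<^bsub>G\<^esub> y"
      proof -
        from uS obtain s where s: "s \<in> ?S" "u = f s" by blast
        obtain y d where "s = (y, d)" by (cases s)
        thus thesis using s that[of y d] unfolding f_def by simp
      qed
      have dG: "d \<in> carrier G" using d unfolding C_def by auto
      let ?u = "y \<otimes>\<^bsub>G\<^esub> d \<otimes>\<^bsub>G\<^esub> inv\<^bsub>G\<^esub> y"
      have "{s \<in> ?S. f s = ?u} = (\<lambda>c. (y \<otimes>\<^bsub>G\<^esub> c, d)) ` C a"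
      proof safe
        fix x c assume x: "x \<in> carrier G" and c: "c \<in> C a" "c \<notin> Z" and e: "f (x,c) = ?u"
        have cG: "c \<in> carrier G" using c unfolding C_def by auto
        define w where "w = inv\<^bsub>G\<^esub> y \<otimes>\<^bsub>G\<^esub> x"
        have w: "w \<in> carrier G" and xw: "x = y \<otimes>\<^bsub>G\<^esub> w" unfolding w_def using x y by (auto simp: m_assoc[symmetric])
        have e': "y \<otimes>\<^bsub>G\<^esub> (w \<otimes>\<^bsub>G\<^esub> c \<otimes>\<^bsub>G\<^esub> inv\<^bsub>G\<^esub> w) \<otimes>\<^bsub>G\<^esub> inv\<^bsub>G\<^esub> y = y \<otimes>\<^bsub>G\<^esub> d \<otimes>\<^bsub>G\<^esub> inv\<^bsub>G\<^esub> y"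
          using e w y cG unfolding f_def xw by (simp add: inv_mult_group m_assoc)
        have we: "w \<otimes>\<^bsub>G\<^esub> c \<otimes>\<^bsub>G\<^esub> inv\<^bsub>G\<^esub> w = d"
          using conj_cancel[OF y _ dG e'] w cG by simp
        have wC: "w \<in> C a" by (rule fusion[OF a c d(1) w we])
        have "w \<otimes>\<^bsub>G\<^esub> c = c \<otimes>\<^bsub>G\<^esub> w" by (rule Ccomm[OF a wC c(1)])
        hence "d = c" using we w cG by (simp add: m_assoc)
        thus "(x,c) \<in> (\<lambda>c. (y \<otimes>\<^bsub>G\<^esub> c, d)) ` C a" using wC xw by auto
      next
        fix c assume c: "c \<in> C a"
        have cG: "c \<in> carrier G" using c unfolding C_def by auto
        show "y \<otimes>\<^bsub>G\<^esub> c \<in> carrier G" using y cG by simp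
        show "d \<in> C a" "d \<in> Z \<Longrightarrow> False" using d by auto
        have "c \<otimes>\<^bsub>G\<^esub> d = d \<otimes>\<^bsub>G\<^esub> c" by (rule Ccomm[OF a c d(1)])
        hence "c \<otimes>\<^bsub>G\<^esub> d \<otimes>\<^bsub>G\<^esub> inv\<^bsub>G\<^esub> c = d" using cG dG by (simp add: m_assoc)
        hence "y \<otimes>\<^bsub>G\<^esub> (c \<otimes>\<^bsub>G\<^esub> d \<otimes>\<^bsub>G\<^esub> inv\<^bsub>G\<^esub> c) \<otimes>\<^bsub>G\<^esub> inv\<^bsub>G\<^esub> y = ?u" by simp
        thus "f (y \<otimes>\<^bsub>G\<^esub> c, d) = ?u" using y cG dG unfolding f_def by (simp add: inv_mult_group m_assoc)
      qed
      moreover have "inj_on (\<lambda>c. (y \<otimes>\<^bsub>G\<^esub> c, d)) (C a)" using y unfolding C_def by (auto simp: inj_on_def)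
      ultimately show ?thesis unfolding u by (simp add: card_image)
    qed
    have "card ?S = (\<Sum>u\<in>f ` ?S. card {s \<in> ?S. f s = u})"
      using sum.image_gen[OF finS, of "\<lambda>_. 1::nat" f] by simp
    also have "\<dots> = card (U a) * card (C a)" using fib unfolding U_def by simp
    finally show ?thesis using ZC[OF a(1)] finZ by (simp add: card_cartesian_product card_Diff_subset)
  qed
  have ZG: "Z \<subseteq> carrier G" unfolding Z_def by auto
  have oneZ: "\<one>\<^bsub>G\<^esub> \<in> Z" unfolding Z_def by auto
  hence Zpos: "card Z > 0" using finZ card_gt_0_iff by blast
  \<comment> \<open>\<open>C a\<close> contains the two disjoint cosets \<open>Z\<close> and \<open>a Z\<close>, so at
    least half of it is noncentral.\<close>
  have half: "card (carrier G) \<le> 2 * card (U a)" if a: "a \<in> carrier G" "a \<notin> Z" for a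
  proof -
    have disj: "Z \<inter> (\<lambda>z. a \<otimes>\<^bsub>G\<^esub> z) ` Z = {}"
    proof safe
      fix z assume z: "z \<in> Z" and az: "a \<otimes>\<^bsub>G\<^esub> z \<in> Z"
      have zG: "z \<in> carrier G" using z ZG by auto
      have "a \<otimes>\<^bsub>G\<^esub> y = y \<otimes>\<^bsub>G\<^esub> a" if y: "y \<in> carrier G" for y
      proof -
        have "(a \<otimes>\<^bsub>G\<^esub> y) \<otimes>\<^bsub>G\<^esub> z = (a \<otimes>\<^bsub>G\<^esub> z) \<otimes>\<^bsub>G\<^esub> y" using z y zG a unfolding Z_def by (simp add: m_assoc)
        also have "\<dots> = y \<otimes>\<^bsub>G\<^esub> (a \<otimes>\<^bsub>G\<^esub> z)" using az y unfolding Z_def by auto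
        also have "\<dots> = (y \<otimes>\<^bsub>G\<^esub> a) \<otimes>\<^bsub>G\<^esub> z" using y a zG by (simp add: m_assoc)
        finally show ?thesis using y a zG by (metis m_closed right_cancel)
      qed
      hence "a \<in> Z" unfolding Z_def using a by auto
      thus "a \<otimes>\<^bsub>G\<^esub> z \<in> {}" using a by simp
    qed
    have aC: "a \<in> C a" using a unfolding C_def by auto
    have "(\<lambda>z. a \<otimes>\<^bsub>G\<^esub> z) ` Z \<subseteq> C a" using ZC[OF a(1)] subgroup.m_closed[OF sub[OF a(1)] aC] by auto
    hence "card (Z \<union> (\<lambda>z. a \<otimes>\<^bsub>G\<^esub> z) ` Z) \<le> card (C a)" using ZC[OF a(1)] finC by (intro card_mono) auto
    moreover have "card ((\<lambda>z. a \<otimes>\<^bsub>G\<^esub> z) ` Z) = card Z"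
      using a ZG by (intro card_image) (auto simp: inj_on_def subset_iff)
    ultimately have "2 * card Z \<le> card (C a)" using disj finZ by (simp add: card_Un_disjoint)
    hence h: "card (C a) \<le> 2 * (card (C a) - card Z)" and pos: "card (C a) > 0" using Zpos by auto
    have "card (carrier G) * card (C a) \<le> card (carrier G) * (2 * (card (C a) - card Z))" using h by (rule mult_le_mono2)
    also have "\<dots> = 2 * card (U a) * card (C a)" using cardU[OF a] by simp
    finally show ?thesis using pos by simp
  qed
  \<comment> \<open>The strict inequality comes from \<open>C a \<noteq> G\<close>.\<close>
  have proper: "card (U a) + card Z < card (carrier G)" if a: "a \<in> carrier G" "a \<notin> Z" for a
  proof -
    obtain y where "y \<in> carrier G" "a \<otimes>\<^bsub>G\<^esub> y \<noteq> y \<otimes>\<^bsub>G\<^esub> a" using a unfolding Z_def by auto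
    hence "y \<in> carrier G" "y \<notin> C a" unfolding C_def by auto
    hence "C a \<noteq> carrier G" by auto
    hence "C a \<subset> carrier G" unfolding C_def by auto
    hence lt: "card (C a) < card (carrier G)" using fin psubset_card_mono by auto
    have le: "card Z \<le> card (C a)" using ZC[OF a(1)] finC card_mono by auto
    have "card (U a) * card (C a) + card Z * card (C a) < card (U a) * card (C a) + card Z * card (carrier G)"
      using lt Zpos by simp
    also have "\<dots> = card (carrier G) * card (C a)"
      unfolding cardU[OF a, symmetric] using le by (simp add: diff_mult_distrib2 mult.commute)
    finally have "(card (U a) + card Z) * card (C a) < card (carrier G) * card (C a)" by (simp add: algebra_simps)
    thus ?thesis by simp
  qed
  show ?case
  proof (rule ccontr)
    assume "\<not> ?case"
    then obtain a where a: "a \<in> carrier G" "a \<notin> Z" unfolding Z_def by auto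
    have finU: "finite (U a)" for a using U_def fin finC by auto
    have "card (U a \<union> Z) < card (carrier G)" using proper[OF a] card_Un_le[of "U a" Z] by linarith
    then obtain b where b: "b \<in> carrier G" "b \<notin> U a" "b \<notin> Z"
    proof -
      have "\<not> carrier G \<subseteq> U a \<union> Z"
        using card_mono[of "U a \<union> Z" "carrier G"] finU[of a] finZ \<open>card (U a \<union> Z) < card (carrier G)\<close> by auto
      thus ?thesis using that by blast
    qed
    \<comment> \<open>A common conjugate would carry \<open>b\<close> into a centralizer conjugate to \<open>C a\<close>.\<close>
    have "U a \<inter> U b = {}"
    proof (rule ccontr)
      assume "U a \<inter> U b \<noteq> {}"
      then obtain u where "u \<in> U a" "u \<in> U b" by blast
      then obtain x c y d where x: "x \<in> carrier G" and c: "c \<in> C a" "c \<notin> Z" and y: "y \<in> carrier G"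
        and d: "d \<in> C b" "d \<notin> Z" and e: "x \<otimes>\<^bsub>G\<^esub> c \<otimes>\<^bsub>G\<^esub> inv\<^bsub>G\<^esub> x = y \<otimes>\<^bsub>G\<^esub> d \<otimes>\<^bsub>G\<^esub> inv\<^bsub>G\<^esub> y"
      proof -
        obtain s s' where "s \<in> carrier G \<times> (C a - Z)" "u = f s" "s' \<in> carrier G \<times> (C b - Z)" "u = f s'"
          using \<open>u \<in> U a\<close> \<open>u \<in> U b\<close> unfolding U_def by blast
        thus thesis using that[of "fst s" "snd s" "fst s'" "snd s'"] unfolding f_def by (auto simp: case_prod_beta)
      qed
      have cG: "c \<in> carrier G" and dG: "d \<in> carrier G" using c d unfolding C_def by auto
      define w where "w = inv\<^bsub>G\<^esub> y \<otimes>\<^bsub>G\<^esub> x"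
      have w: "w \<in> carrier G" and xw: "x = y \<otimes>\<^bsub>G\<^esub> w" unfolding w_def using x y by (auto simp: m_assoc[symmetric])
      have e': "y \<otimes>\<^bsub>G\<^esub> (w \<otimes>\<^bsub>G\<^esub> c \<otimes>\<^bsub>G\<^esub> inv\<^bsub>G\<^esub> w) \<otimes>\<^bsub>G\<^esub> inv\<^bsub>G\<^esub> y = y \<otimes>\<^bsub>G\<^esub> d \<otimes>\<^bsub>G\<^esub> inv\<^bsub>G\<^esub> y"
        using e w y cG unfolding xw by (simp add: inv_mult_group m_assoc)
      have we: "w \<otimes>\<^bsub>G\<^esub> c \<otimes>\<^bsub>G\<^esub> inv\<^bsub>G\<^esub> w = d"
        using conj_cancel[OF y _ dG e'] w cG by simp
      define b' where "b' = inv\<^bsub>G\<^esub> w \<otimes>\<^bsub>G\<^esub> b \<otimes>\<^bsub>G\<^esub> w"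
      have b'G: "b' \<in> carrier G" unfolding b'_def using w b by auto
      have bb': "b = w \<otimes>\<^bsub>G\<^esub> b' \<otimes>\<^bsub>G\<^esub> inv\<^bsub>G\<^esub> w"
      proof -
        have "w \<otimes>\<^bsub>G\<^esub> (inv\<^bsub>G\<^esub> w \<otimes>\<^bsub>G\<^esub> b) = b" using w b(1) by (metis inv_closed l_one m_assoc r_inv)
        thus ?thesis unfolding b'_def using w b(1) by (simp add: m_assoc)
      qed
      have "d \<otimes>\<^bsub>G\<^esub> b = b \<otimes>\<^bsub>G\<^esub> d" using d unfolding C_def by auto
      hence "w \<otimes>\<^bsub>G\<^esub> (c \<otimes>\<^bsub>G\<^esub> b') \<otimes>\<^bsub>G\<^esub> inv\<^bsub>G\<^esub> w = w \<otimes>\<^bsub>G\<^esub> (b' \<otimes>\<^bsub>G\<^esub> c) \<otimes>\<^bsub>G\<^esub> inv\<^bsub>G\<^esub> w"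
        unfolding we[symmetric] bb' using conj_mult[OF w cG b'G] conj_mult[OF w b'G cG] by simp
      hence "c \<otimes>\<^bsub>G\<^esub> b' = b' \<otimes>\<^bsub>G\<^esub> c" using conj_cancel[OF w] cG b'G by simp
      hence "b' \<in> C c" using b'G unfolding C_def by auto
      hence b'C: "b' \<in> C a" using Csame[OF a c] by simp
      have "b' \<notin> Z"
      proof
        assume "b' \<in> Z"
        hence "w \<otimes>\<^bsub>G\<^esub> b' = b' \<otimes>\<^bsub>G\<^esub> w" using w unfolding Z_def by auto
        hence "b = b' \<otimes>\<^bsub>G\<^esub> (w \<otimes>\<^bsub>G\<^esub> inv\<^bsub>G\<^esub> w)" using bb' w b'G by (simp add: m_assoc del: r_inv)
        hence "b = b'" using w b'G by simp
        thus False using b \<open>b' \<in> Z\<close> by simp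
      qed
      hence "f (w, b') \<in> U a" unfolding U_def using b'C w by blast
      hence "b \<in> U a" using bb' unfolding f_def by simp
      thus False using b by simp
    qed
    hence "card (U a \<union> U b \<union> Z) = card (U a) + card (U b) + card Z"
    proof -
      have "(U a \<union> U b) \<inter> Z = {}" using U_carrier[OF a(1)] U_carrier[OF b(1)] by blast
      thus ?thesis using finU finZ \<open>U a \<inter> U b = {}\<close> by (simp add: card_Un_disjoint)
    qed
    moreover have "card (U a \<union> U b \<union> Z) \<le> card (carrier G)"
      using U_carrier[OF a(1)] U_carrier[OF b(1)] ZG fin by (intro card_mono) auto
    ultimately show False using half[OF a] half[OF b(1,3)] Zpos by linarith
  qed
qed

section \<open>Invariant subspaces, limits and spectra of complex matrices\<close>

lemma invariant_subspace_iff: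
  "invariant_subspace n S W \<longleftrightarrow>
     W \<subseteq> carrier_vec n \<and> 0\<^sub>v n \<in> W \<and> (\<forall>x\<in>W. \<forall>y\<in>W. x + y \<in> W) \<and>
     (\<forall>c. \<forall>x\<in>W. c \<cdot>\<^sub>v x \<in> W) \<and> (\<forall>M\<in>S. \<forall>w\<in>W. M *\<^sub>v w \<in> W)"
proof -
  have "VectorSpace.subspace class_ring W (module_vec TYPE(complex) n) \<longleftrightarrow>
     W \<subseteq> carrier_vec n \<and> 0\<^sub>v n \<in> W \<and> (\<forall>x\<in>W. \<forall>y\<in>W. x + y \<in> W) \<and> (\<forall>c. \<forall>x\<in>W. c \<cdot>\<^sub>v x \<in> W)"
    unfolding VectorSpace.subspace_def submodule_def
    using vec_vs[of n, where 'a = complex] vec_module[of n, where 'a = complex]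
    by (auto simp: module_vec_simps class_ring_simps)
  thus ?thesis unfolding invariant_subspace_def by blast
qed

lemma irreducible_matricesD:
  assumes "irreducible_matrices n S" "W \<subseteq> carrier_vec n"
    and "\<And>x y. x \<in> W \<Longrightarrow> y \<in> W \<Longrightarrow> x + y \<in> W"
    and "\<And>c x. x \<in> W \<Longrightarrow> c \<cdot>\<^sub>v x \<in> W"
    and "\<And>M x. M \<in> S \<Longrightarrow> x \<in> W \<Longrightarrow> M *\<^sub>v x \<in> W"
    and "x \<in> W" "x \<noteq> 0\<^sub>v n"
  shows "W = carrier_vec n"
proof -
  have "x \<in> carrier_vec n" using assms(2,6) by blast
  hence "0\<^sub>v n = 0 \<cdot>\<^sub>v x" by auto
  hence "0\<^sub>v n \<in> W" using assms(4,6) by metis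
  hence "invariant_subspace n S W" using assms unfolding invariant_subspace_iff by blast
  thus ?thesis using assms(1,6,7) unfolding irreducible_matrices_def by blast
qed

lemma irreducible_matrices_mono:
  "irreducible_matrices n S \<Longrightarrow> S \<subseteq> T \<Longrightarrow> irreducible_matrices n T"
  unfolding irreducible_matrices_def invariant_subspace_def by blast

lemma mult_mat_vec_unit:
  fixes A :: "'a :: semiring_1 mat"
  assumes "A \<in> carrier_mat nr nc" "j < nc"
  shows "A *\<^sub>v unit_vec nc j = col A j"
  using assms by (intro eq_vecI) (auto simp: scalar_prod_right_unit)

lemma eq_mat_by_mult_vec:
  fixes A B :: "'a :: semiring_1 mat"
  assumes "A \<in> carrier_mat nr nc" "B \<in> carrier_mat nr nc"
    and "\<And>v. v \<in> carrier_vec nc \<Longrightarrow> A *\<^sub>v v = B *\<^sub>v v"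
  shows "A = B"
proof (rule eq_matI)
  show "A $$ (i,j) = B $$ (i,j)" if "i < dim_row B" "j < dim_col B" for i j
  proof -
    have "col A j = col B j"
      using assms(3)[of "unit_vec nc j"] mult_mat_vec_unit[OF assms(1)] mult_mat_vec_unit[OF assms(2)] that assms by auto
    hence "col A j $ i = col B j $ i" by simp
    thus ?thesis using that assms by simp
  qed
qed (use assms in auto)

lemma eq_zero_mat_by_mult_vec:
  fixes A :: "'a :: semiring_1 mat"
  assumes "A \<in> carrier_mat nr nc" "\<And>v. v \<in> carrier_vec nc \<Longrightarrow> A *\<^sub>v v = 0\<^sub>v nr"
  shows "A = 0\<^sub>m nr nc"
  by (rule eq_mat_by_mult_vec[OF assms(1)]) (use assms in auto)

lemma smult_one_mult_vec:
  fixes v :: "complex vec"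
  assumes "v \<in> carrier_vec n"
  shows "(c \<cdot>\<^sub>m 1\<^sub>m n) *\<^sub>v v = c \<cdot>\<^sub>v v"
  using assms by (intro eq_vecI) auto

lemma smult_mult_mat_vec:
  fixes v :: "complex vec"
  assumes "A \<in> carrier_mat nr nc" "v \<in> carrier_vec nc"
  shows "(c \<cdot>\<^sub>m A) *\<^sub>v v = c \<cdot>\<^sub>v (A *\<^sub>v v)"
  using assms by (intro eq_vecI) auto

text \<open>
  Schur's lemma: an eigenspace of the commuting matrix is invariant.
\<close>

lemma commuting_with_irreducible_scalar:
  assumes irr: "irreducible_matrices n S" and S: "S \<subseteq> carrier_mat n n" and n: "n > 0"
    and X: "X \<in> carrier_mat n n" and comm: "\<And>M. M \<in> S \<Longrightarrow> X * M = M * X"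
  obtains c where "X = c \<cdot>\<^sub>m 1\<^sub>m n"
proof -
  obtain c v where v: "v \<in> carrier_vec n" "v \<noteq> 0\<^sub>v n" "X *\<^sub>v v = c \<cdot>\<^sub>v v"
    using spectrum_non_empty[OF X n] X unfolding spectrum_def eigenvalue_def eigenvector_def by auto
  let ?W = "{v \<in> carrier_vec n. X *\<^sub>v v = c \<cdot>\<^sub>v v}"
  have "?W = carrier_vec n"
  proof (rule irreducible_matricesD[OF irr, of _ v])
    show "x + y \<in> ?W" if "x \<in> ?W" "y \<in> ?W" for x y
      using that X by (auto simp: mult_add_distrib_mat_vec smult_add_distrib_vec[of _ n])
    show "a \<cdot>\<^sub>v x \<in> ?W" if "x \<in> ?W" for a x
      using that X by (auto simp: mult_mat_vec smult_smult_assoc mult.commute)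
    show "M *\<^sub>v x \<in> ?W" if M: "M \<in> S" and x: "x \<in> ?W" for M x
    proof -
      have Mc: "M \<in> carrier_mat n n" using M S by auto
      have "X *\<^sub>v (M *\<^sub>v x) = (M * X) *\<^sub>v x" using x X Mc comm[OF M]
        by (metis (no_types, lifting) assoc_mult_mat_vec mem_Collect_eq)
      also have "\<dots> = c \<cdot>\<^sub>v (M *\<^sub>v x)" using x X Mc by (auto simp: mult_mat_vec)
      finally show ?thesis using x Mc by auto
    qed
  qed (use v in auto)
  hence "X = c \<cdot>\<^sub>m 1\<^sub>m n"
    by (intro eq_mat_by_mult_vec[OF X]) (auto simp: smult_one_mult_vec)
  thus thesis by (rule that)
qed

lemma zero_mat_mult_vec:
  fixes v :: "complex vec"
  assumes "v \<in> carrier_vec nc"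
  shows "0\<^sub>m nr nc *\<^sub>v v = 0\<^sub>v nr"
  using assms by (intro eq_vecI) auto

lemma mult_mat_zero_vec:
  fixes A :: "complex mat"
  assumes "A \<in> carrier_mat nr nc"
  shows "A *\<^sub>v 0\<^sub>v nc = 0\<^sub>v nr"
  using assms by (intro eq_vecI) auto

lemma smult_vec_eq_zeroD:
  fixes v :: "complex vec"
  assumes "e \<cdot>\<^sub>v v = 0\<^sub>v n" "v \<in> carrier_vec n" "v \<noteq> 0\<^sub>v n"
  shows "e = 0"
proof (rule ccontr)
  assume e: "e \<noteq> 0"
  have "v $ i = 0" if "i < n" for i
  proof -
    have "e * v $ i = (e \<cdot>\<^sub>v v) $ i" using assms(2) that by simp
    also have "\<dots> = 0" using assms(1) that by simp
    finally show ?thesis using e by simp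
  qed
  hence "v = 0\<^sub>v n" using assms(2) by (intro eq_vecI) auto
  thus False using assms(3) by simp
qed

text \<open>
  Entrywise convergence; carrying the dimensions inside the predicate makes the limit unique.
\<close>

definition mat_lim :: "nat \<Rightarrow> nat \<Rightarrow> (nat \<Rightarrow> complex mat) \<Rightarrow> complex mat \<Rightarrow> bool" where
  "mat_lim nr nc X M \<longleftrightarrow>
     (\<forall>k. X k \<in> carrier_mat nr nc) \<and> M \<in> carrier_mat nr nc \<and>
     (\<forall>i<nr. \<forall>j<nc. (\<lambda>k. X k $$ (i,j)) \<longlonglongrightarrow> M $$ (i,j))"

lemma mat_lim_carrier: "mat_lim nr nc X M \<Longrightarrow> X k \<in> carrier_mat nr nc" "mat_lim nr nc X M \<Longrightarrow> M \<in> carrier_mat nr nc"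
  unfolding mat_lim_def by auto

lemma mat_lim_const: "M \<in> carrier_mat nr nc \<Longrightarrow> mat_lim nr nc (\<lambda>_. M) M"
  unfolding mat_lim_def by auto

lemma mat_lim_subseq: "mat_lim nr nc X M \<Longrightarrow> strict_mono s \<Longrightarrow> mat_lim nr nc (\<lambda>k. X (s k)) M"
  unfolding mat_lim_def using LIMSEQ_subseq_LIMSEQ[unfolded o_def] by blast

lemma mat_lim_unique: "mat_lim nr nc X M \<Longrightarrow> mat_lim nr nc X N \<Longrightarrow> M = N"
proof (rule eq_matI)
  fix i j assume "mat_lim nr nc X M" "mat_lim nr nc X N" "i < dim_row N" "j < dim_col N"
  hence "(\<lambda>k. X k $$ (i,j)) \<longlonglongrightarrow> M $$ (i,j)" "(\<lambda>k. X k $$ (i,j)) \<longlonglongrightarrow> N $$ (i,j)"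
    unfolding mat_lim_def by auto
  thus "M $$ (i,j) = N $$ (i,j)" by (rule LIMSEQ_unique)
qed (auto simp: mat_lim_def)

lemma mat_lim_mult:
  assumes "mat_lim nr m X M" "mat_lim m nc Y N"
  shows "mat_lim nr nc (\<lambda>k. X k * Y k) (M * N)"
proof -
  have [simp]: "dim_row (X k) = nr" "dim_col (X k) = m" "dim_row (Y k) = m" "dim_col (Y k) = nc"
    "dim_row M = nr" "dim_col M = m" "dim_row N = m" "dim_col N = nc" for k
    using assms unfolding mat_lim_def by (auto dest: carrier_matD)
  show ?thesis
    using assms unfolding mat_lim_def
    by (auto simp: scalar_prod_def intro!: tendsto_sum tendsto_mult carrier_matI)
qed

lemma mat_lim_smult:
  assumes "c \<longlonglongrightarrow> d" "mat_lim nr nc X M"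
  shows "mat_lim nr nc (\<lambda>k. c k \<cdot>\<^sub>m X k) (d \<cdot>\<^sub>m M)"
proof -
  have [simp]: "dim_row (X k) = nr" "dim_col (X k) = nc" "dim_row M = nr" "dim_col M = nc" for k
    using assms unfolding mat_lim_def by (auto dest: carrier_matD)
  show ?thesis using assms unfolding mat_lim_def by (auto intro!: tendsto_mult carrier_matI)
qed

lemma mat_lim_add:
  assumes "mat_lim nr nc X M" "mat_lim nr nc Y N"
  shows "mat_lim nr nc (\<lambda>k. X k + Y k) (M + N)"
proof -
  have [simp]: "dim_row (X k) = nr" "dim_col (X k) = nc" "dim_row M = nr" "dim_col M = nc"
    "dim_row (Y k) = nr" "dim_col (Y k) = nc" "dim_row N = nr" "dim_col N = nc" for k
    using assms unfolding mat_lim_def by (auto dest: carrier_matD)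
  show ?thesis using assms unfolding mat_lim_def by (auto intro!: tendsto_add carrier_matI)
qed

lemma mat_lim_diff:
  assumes "mat_lim nr nc X M" "mat_lim nr nc Y N"
  shows "mat_lim nr nc (\<lambda>k. X k - Y k) (M - N)"
proof -
  have [simp]: "dim_row (X k) = nr" "dim_col (X k) = nc" "dim_row M = nr" "dim_col M = nc"
    "dim_row (Y k) = nr" "dim_col (Y k) = nc" "dim_row N = nr" "dim_col N = nc" for k
    using assms unfolding mat_lim_def by (auto dest: carrier_matD)
  show ?thesis using assms unfolding mat_lim_def by (auto intro!: tendsto_diff carrier_matI)
qed

lemma mat_lim_det:
  assumes "mat_lim n n X M"
  shows "(\<lambda>k. det (X k)) \<longlonglongrightarrow> det M"
proof -
  have "(\<lambda>k. \<Sum>p\<in>{p. p permutes {0..<n}}. signof p * (\<Prod>i = 0..<n. X k $$ (i, p i)))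
     \<longlonglongrightarrow> (\<Sum>p\<in>{p. p permutes {0..<n}}. signof p * (\<Prod>i = 0..<n. M $$ (i, p i)))"
    using assms unfolding mat_lim_def
    by (intro tendsto_sum tendsto_mult tendsto_prod tendsto_const) (auto simp: permutes_in_image)
  moreover have "(\<lambda>k. det (X k)) = (\<lambda>k. \<Sum>p\<in>{p. p permutes {0..<n}}. signof p * (\<Prod>i = 0..<n. X k $$ (i, p i)))"
    using det_def'[OF mat_lim_carrier(1)[OF assms]] by blast
  ultimately show ?thesis using det_def'[OF mat_lim_carrier(2)[OF assms]] by simp
qed

lemma bounded_complex_convergent_subseq:
  fixes f :: "nat \<Rightarrow> complex"
  assumes "\<And>k. cmod (f k) \<le> C"
  shows "\<exists>s l. strict_mono s \<and> (\<lambda>k. f (s k)) \<longlonglongrightarrow> l"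
proof -
  have real: "\<exists>s l. strict_mono s \<and> (\<lambda>k. g (s k)) \<longlonglongrightarrow> l" if g: "\<And>k. \<bar>g k\<bar> \<le> C" for g :: "nat \<Rightarrow> real"
  proof -
    obtain s :: "nat \<Rightarrow> nat" where s: "strict_mono s" "monoseq (\<lambda>k. g (s k))" using seq_monosub[of g] by auto
    have "Bseq (\<lambda>k. g (s k))" using g by (intro BseqI'[of _ C]) auto
    hence "convergent (\<lambda>k. g (s k))" using s by (intro Bseq_monoseq_convergent)
    thus ?thesis using s unfolding convergent_def by blast
  qed
  obtain s a where s: "strict_mono s" "(\<lambda>k. Re (f (s k))) \<longlonglongrightarrow> a"
    using real[of "\<lambda>k. Re (f k)"] assms abs_Re_le_cmod order_trans by blast
  obtain t b where t: "strict_mono t" "(\<lambda>k. Im (f (s (t k)))) \<longlonglongrightarrow> b"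
    using real[of "\<lambda>k. Im (f (s k))"] assms abs_Im_le_cmod order_trans by blast
  have "(\<lambda>k. Re (f (s (t k)))) \<longlonglongrightarrow> a" using LIMSEQ_subseq_LIMSEQ[OF s(2) t(1)] by (simp add: o_def)
  hence "(\<lambda>k. f (s (t k))) \<longlonglongrightarrow> Complex a b" using t(2) by (simp add: tendsto_complex_iff)
  moreover have "strict_mono (\<lambda>k. s (t k))" using s(1) t(1) by (simp add: strict_mono_def)
  ultimately show ?thesis by (intro exI[of _ "\<lambda>k. s (t k)"]) auto
qed

lemma bounded_family_convergent_subseq:
  fixes f :: "'i \<Rightarrow> nat \<Rightarrow> complex"
  assumes "finite I" "\<And>i k. i \<in> I \<Longrightarrow> cmod (f i k) \<le> C"
  shows "\<exists>s. strict_mono s \<and> (\<forall>i\<in>I. \<exists>l. (\<lambda>k. f i (s k)) \<longlonglongrightarrow> l)"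
  using assms
proof (induction I)
  case empty
  show ?case by (intro exI[of _ "\<lambda>k. k"]) (auto simp: strict_mono_def)
next
  case (insert a I)
  then obtain s where s: "strict_mono s" "\<forall>i\<in>I. \<exists>l. (\<lambda>k. f i (s k)) \<longlonglongrightarrow> l" by auto
  obtain t l where t: "strict_mono t" "(\<lambda>k. f a (s (t k))) \<longlonglongrightarrow> l"
    using bounded_complex_convergent_subseq[of "\<lambda>k. f a (s k)" C] insert.prems by auto
  have "\<exists>l. (\<lambda>k. f i (s (t k))) \<longlonglongrightarrow> l" if "i \<in> I" for i
    using s(2) that LIMSEQ_subseq_LIMSEQ[OF _ t(1)] unfolding o_def by blast
  moreover have "strict_mono (\<lambda>k. s (t k))" using s(1) t(1) by (simp add: strict_mono_def)
  ultimately show ?case using t(2) by (intro exI[of _ "\<lambda>k. s (t k)"]) auto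
qed

lemma bounded_mat_convergent_subseq:
  fixes X :: "nat \<Rightarrow> complex mat"
  assumes X: "\<And>k. X k \<in> carrier_mat nr nc"
    and bd: "\<And>k i j. i < nr \<Longrightarrow> j < nc \<Longrightarrow> cmod (X k $$ (i,j)) \<le> C"
  obtains s M where "strict_mono s" "mat_lim nr nc (\<lambda>k. X (s k)) M"
proof -
  obtain s where s: "strict_mono s"
    and l: "\<forall>p\<in>{..<nr} \<times> {..<nc}. \<exists>l. (\<lambda>k. X (s k) $$ p) \<longlonglongrightarrow> l"
    using bounded_family_convergent_subseq[of "{..<nr} \<times> {..<nc}" "\<lambda>p k. X k $$ p" C] bd by blast
  then obtain L where L: "\<forall>p\<in>{..<nr} \<times> {..<nc}. (\<lambda>k. X (s k) $$ p) \<longlonglongrightarrow> L p" by metis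
  have "mat_lim nr nc (\<lambda>k. X (s k)) (mat nr nc L)" unfolding mat_lim_def using X L by auto
  thus thesis using that s by blast
qed

definition mat_trace :: "complex mat \<Rightarrow> complex" where
  "mat_trace A = (\<Sum>i<dim_row A. A $$ (i,i))"

lemma mat_trace_comm:
  assumes "A \<in> carrier_mat n m" "B \<in> carrier_mat m n"
  shows "mat_trace (A * B) = mat_trace (B * A)"
proof -
  have "mat_trace (A * B) = (\<Sum>i<n. \<Sum>k<m. A $$ (i,k) * B $$ (k,i))"
    using assms unfolding mat_trace_def by (auto simp: scalar_prod_def atLeast0LessThan intro!: sum.cong)
  also have "\<dots> = (\<Sum>k<m. \<Sum>i<n. B $$ (k,i) * A $$ (i,k))" by (subst sum.swap) (simp add: mult.commute)
  also have "\<dots> = mat_trace (B * A)"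
    using assms unfolding mat_trace_def by (auto simp: scalar_prod_def atLeast0LessThan intro!: sum.cong)
  finally show ?thesis .
qed

lemma mat_trace_diff: "A \<in> carrier_mat n n \<Longrightarrow> B \<in> carrier_mat n n \<Longrightarrow> mat_trace (A - B) = mat_trace A - mat_trace B"
  unfolding mat_trace_def by (auto simp: sum_subtractf)

lemma mat_trace_smult: "A \<in> carrier_mat n n \<Longrightarrow> mat_trace (c \<cdot>\<^sub>m A) = c * mat_trace A"
  unfolding mat_trace_def by (auto simp: sum_distrib_left)

lemma mat_lim_trace:
  assumes "mat_lim n n X M"
  shows "(\<lambda>k. mat_trace (X k)) \<longlonglongrightarrow> mat_trace M"
proof -
  have "dim_row (X k) = n" "dim_row M = n" for k using assms unfolding mat_lim_def by auto
  thus ?thesis using assms unfolding mat_trace_def mat_lim_def by (auto intro!: tendsto_sum)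
qed

text \<open>
  Schur triangularization, recorded together with the spectrum on the diagonal: traces of powers and
  nilpotency are read off from the triangular form.
\<close>

lemma similar_triangular:
  fixes A :: "complex mat"
  assumes A: "A \<in> carrier_mat n n"
  obtains B P Q where "similar_mat_wit A B P Q" "B \<in> carrier_mat n n" "upper_triangular B"
    "spectrum A = (\<lambda>i. B $$ (i,i)) ` {..<n}"
proof -
  obtain es where es: "char_poly A = (\<Prod>a\<leftarrow>es. [:- a, 1:])" "length es = n" using char_poly_factorized[OF A] by blast
  obtain B P Q where "schur_decomposition A es = (B, P, Q)" by (cases "schur_decomposition A es") auto
  from schur_decomposition[OF A es(1) this]
  have wit: "similar_mat_wit A B P Q" and ut: "upper_triangular B" and d: "diag_mat B = es" by auto
  have B: "B \<in> carrier_mat n n" using similar_mat_witD2[OF A wit] by auto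
  have "poly (\<Prod>a\<leftarrow>es. [:- a, 1:]) x = 0 \<longleftrightarrow> x \<in> set es" for x by (induction es) (auto simp: algebra_simps)
  hence "spectrum A = set (diag_mat B)" unfolding spectrum_root_char_poly[OF A] es(1) d by auto
  also have "\<dots> = (\<lambda>i. B $$ (i,i)) ` {..<n}" unfolding diag_mat_def using B by auto
  finally show thesis using that wit B ut by blast
qed

text \<open>
  The trace of the square is the sum of the squared eigenvalues. This is the only way in which the size of a real
  spectrum enters: it turns real spectra into inequalities between traces.
\<close>

lemma real_spectrum_trace_square:
  assumes A: "A \<in> carrier_mat n n" and real: "has_real_spectrum A"
  obtains t :: real where "t \<ge> 0" "mat_trace (A * A) = of_real t" "t = 0 \<Longrightarrow> spectrum A \<subseteq> {0}"
proof -
  obtain B P Q where wit: "similar_mat_wit A B P Q" and B: "B \<in> carrier_mat n n" and ut: "upper_triangular B"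
    and sp: "spectrum A = (\<lambda>i. B $$ (i,i)) ` {..<n}" using similar_triangular[OF A] by metis
  note w = similar_mat_witD2[OF A wit]
  have "A * A = P * (B * B) * Q"
  proof -
    have "A ^\<^sub>m 2 = P * B ^\<^sub>m 2 * Q" using similar_mat_wit_pow_id[OF wit] .
    thus ?thesis using A B by (simp add: numeral_2_eq_2)
  qed
  hence "mat_trace (A * A) = mat_trace (Q * (P * (B * B)))"
    using w by (simp add: mat_trace_comm[of "P * (B * B)" n n Q])
  also have "Q * (P * (B * B)) = B * B" using w B by (metis assoc_mult_mat left_mult_one_mat mult_carrier_mat)
  also have "mat_trace (B * B) = (\<Sum>i<n. B $$ (i,i) * B $$ (i,i))"
  proof -
    have "(\<Sum>k<n. B $$ (i,k) * B $$ (k,i)) = B $$ (i,i) * B $$ (i,i)" if "i < n" for i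
    proof -
      have "B $$ (i,k) * B $$ (k,i) = 0" if "k < n" "k \<noteq> i" for k
        using upper_triangularD[OF ut, of k i] upper_triangularD[OF ut, of i k] that \<open>i < n\<close> B
        by (cases "k < i") auto
      hence "(\<Sum>k\<in>{..<n} - {i}. B $$ (i,k) * B $$ (k,i)) = 0" by (intro sum.neutral) blast
      thus ?thesis using that by (subst sum.remove[of _ i]) auto
    qed
    thus ?thesis using B unfolding mat_trace_def by (auto simp: scalar_prod_def atLeast0LessThan intro!: sum.cong)
  qed
  finally have tr: "mat_trace (A * A) = (\<Sum>i<n. B $$ (i,i) * B $$ (i,i))" .
  have re: "B $$ (i,i) = of_real (Re (B $$ (i,i)))" if "i < n" for i
    using real sp that unfolding has_real_spectrum_def by (auto simp: image_subset_iff complex_is_Real_iff complex_eq_iff)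
  define t where "t = (\<Sum>i<n. (Re (B $$ (i,i)))\<^sup>2)"
  have "mat_trace (A * A) = of_real t" unfolding tr t_def of_real_sum
    by (intro sum.cong refl) (subst (1 2) re; simp add: power2_eq_square)
  moreover have "t \<ge> 0" unfolding t_def by (simp add: sum_nonneg)
  moreover have "spectrum A \<subseteq> {0}" if "t = 0"
  proof -
    have "\<forall>i<n. Re (B $$ (i,i)) = 0" using that unfolding t_def by (subst (asm) sum_nonneg_eq_0_iff) auto
    thus ?thesis using sp re by auto
  qed
  ultimately show thesis using that by blast
qed

lemma nilpotent_of_zero_spectrum:
  fixes A :: "complex mat"
  assumes A: "A \<in> carrier_mat n n" and sp: "spectrum A \<subseteq> {0}"
  shows "A ^\<^sub>m n = 0\<^sub>m n n"
proof -
  obtain B P Q where wit: "similar_mat_wit A B P Q" and B: "B \<in> carrier_mat n n" and ut: "upper_triangular B"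
    and spB: "spectrum A = (\<lambda>i. B $$ (i,i)) ` {..<n}" using similar_triangular[OF A] by metis
  have strict: "B $$ (i,j) = 0" if "i < n" "j \<le> i" for i j
    using that sp spB upper_triangularD[OF ut, of j i] B by (cases "j = i") auto
  have pow: "i < n \<Longrightarrow> j < n \<Longrightarrow> j < i + k \<Longrightarrow> (B ^\<^sub>m k) $$ (i,j) = 0" for i j k
  proof (induction k arbitrary: j)
    case 0
    thus ?case using B by simp
  next
    case (Suc k)
    have Bk: "B ^\<^sub>m k \<in> carrier_mat n n" using B by simp
    have "(B ^\<^sub>m k) $$ (i,l) * B $$ (l,j) = 0" if "l < n" for l
      using Suc.IH[OF Suc.prems(1) that] strict[OF that, of j] Suc.prems by (cases "l < i + k") auto
    hence "(\<Sum>l = 0..<n. (B ^\<^sub>m k) $$ (i,l) * B $$ (l,j)) = 0" by (intro sum.neutral) auto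
    thus ?case using Bk B Suc.prems by (auto simp: scalar_prod_def)
  qed
  have "B ^\<^sub>m n = 0\<^sub>m n n" using pow[where k = n] B by (intro eq_matI) auto
  thus ?thesis using similar_mat_wit_pow_id[OF wit, of n] similar_mat_witD2[OF A wit] by simp
qed

text \<open>
  The image of the vector is taken from the range of the last nonzero power of \<open>N\<close>. The two vectors span a Jordan block of size
  two, which is what makes powers of \<open>1 + N\<close> grow.
\<close>

lemma nilpotent_square_zero_vector:
  fixes N :: "complex mat"
  assumes N: "N \<in> carrier_mat n n" and nil: "N ^\<^sub>m m = 0\<^sub>m n n" and nz: "N \<noteq> 0\<^sub>m n n"
  obtains v where "v \<in> carrier_vec n" "N *\<^sub>v v \<noteq> 0\<^sub>v n" "N *\<^sub>v (N *\<^sub>v v) = 0\<^sub>v n"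
proof -
  let ?f = "\<lambda>x. N *\<^sub>v x"
  have car: "x \<in> carrier_vec n \<Longrightarrow> (?f ^^ k) x \<in> carrier_vec n" for k x by (induction k) (use N in auto)
  have pow: "x \<in> carrier_vec n \<Longrightarrow> N ^\<^sub>m k *\<^sub>v x = (?f ^^ k) x" for k x
  proof (induction k arbitrary: x)
    case (Suc k)
    have "N ^\<^sub>m Suc k *\<^sub>v x = N ^\<^sub>m k *\<^sub>v (N *\<^sub>v x)" using N Suc.prems by (simp add: assoc_mult_mat_vec[of _ n n _ n])
    thus ?case using Suc N by (simp add: funpow_swap1)
  qed (use N in simp)
  obtain v where v: "v \<in> carrier_vec n" "N *\<^sub>v v \<noteq> 0\<^sub>v n" using eq_zero_mat_by_mult_vec[OF N] nz by blast
  have "(?f ^^ m) v = 0\<^sub>v n" using pow[OF v(1), of m] zero_mat_mult_vec[OF v(1)] unfolding nil by simp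
  define k where "k = (LEAST k. (?f ^^ k) v = 0\<^sub>v n)"
  have k: "(?f ^^ k) v = 0\<^sub>v n" unfolding k_def by (rule LeastI) fact
  have min: "(?f ^^ j) v \<noteq> 0\<^sub>v n" if "j < k" for j using not_less_Least that unfolding k_def by blast
  have "k \<noteq> 0"
  proof
    assume "k = 0"
    hence "v = 0\<^sub>v n" using k by simp
    thus False using v mult_mat_zero_vec[OF N] by simp
  qed
  moreover have "k \<noteq> 1" using k v by auto
  ultimately obtain j where j: "k = Suc (Suc j)" by (metis One_nat_def not0_implies_Suc)
  show thesis
  proof (rule that[of "(?f ^^ j) v"])
    show "N *\<^sub>v (?f ^^ j) v \<noteq> 0\<^sub>v n" using min[of "Suc j"] j by simp
    show "N *\<^sub>v (N *\<^sub>v (?f ^^ j) v) = 0\<^sub>v n" using k j by simp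
  qed (use car v in auto)
qed

text \<open>
  If \<open>z\<close> is a nonreal eigenvalue of the limit, then \<open>\<bar>det (z - X k)\<bar>\<close> is a product of distances from
  \<open>z\<close> to real numbers, hence at least \<open>\<bar>Im z\<bar>\<^sup>n\<close>, and it cannot tend to zero.
\<close>

lemma real_spectrum_limit:
  assumes lim: "mat_lim n n X M" and real: "\<And>k. has_real_spectrum (X k)"
  shows "has_real_spectrum M"
  unfolding has_real_spectrum_def
proof
  fix e assume "e \<in> spectrum M"
  hence e: "det (- char_matrix M e) = 0"
    using spectrum_root_char_poly[OF mat_lim_carrier(2)[OF lim]] char_poly_matrix[OF mat_lim_carrier(2)[OF lim]] by simp
  have lb: "(\<bar>Im e\<bar>) ^ n \<le> cmod (det (- char_matrix (X k) e))" for k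
  proof -
    note X = mat_lim_carrier(1)[OF lim, of k]
    obtain as where as: "char_poly (X k) = (\<Prod>a\<leftarrow>as. [:- a, 1:])" "length as = n" using char_poly_factorized[OF X] by blast
    have 1: "poly (\<Prod>a\<leftarrow>as. [:- a, 1:]) x = 0 \<longleftrightarrow> x \<in> set as" for x by (induction as) (auto simp: algebra_simps)
    have "set as \<subseteq> \<real>" using real[of k] unfolding has_real_spectrum_def spectrum_root_char_poly[OF X] as(1) 1 by auto
    hence "\<bar>Im e\<bar> ^ length as \<le> cmod (poly (\<Prod>a\<leftarrow>as. [:- a, 1:]) e)"
    proof (induction as)
      case (Cons a as)
      have "\<bar>Im e\<bar> \<le> cmod (e - a)" using abs_Im_le_cmod[of "e - a"] Cons.prems by (auto simp: complex_is_Real_iff)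
      hence "\<bar>Im e\<bar> * \<bar>Im e\<bar> ^ length as \<le> cmod (e - a) * cmod (poly (\<Prod>a\<leftarrow>as. [:- a, 1:]) e)"
        using Cons by (intro mult_mono) auto
      also have "\<dots> = cmod (poly (\<Prod>a\<leftarrow>a # as. [:- a, 1:]) e)" by (simp add: norm_mult[symmetric] algebra_simps)
      finally show ?case by simp
    qed simp
    thus ?thesis using as by (simp add: char_poly_matrix[OF X, symmetric])
  qed
  have "mat_lim n n (\<lambda>k. - char_matrix (X k) e) (- char_matrix M e)"
  proof -
    have "- char_matrix A e = e \<cdot>\<^sub>m 1\<^sub>m n - A" if "A \<in> carrier_mat n n" for A
      using that unfolding char_matrix_def by (intro eq_matI) auto
    thus ?thesis
      using mat_lim_diff[OF mat_lim_const[of "e \<cdot>\<^sub>m 1\<^sub>m n" n n] lim] mat_lim_carrier[OF lim] by simp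
  qed
  from tendsto_norm[OF mat_lim_det[OF this]] have "(\<lambda>k. cmod (det (- char_matrix (X k) e))) \<longlonglongrightarrow> 0" using e by simp
  hence "\<bar>Im e\<bar> ^ n \<le> 0" using lb by (intro LIMSEQ_le_const) auto
  hence "Im e = 0" by (metis abs_ge_zero abs_eq_0 antisym power_eq_0_iff zero_le_power)
  thus "e \<in> \<real>" by (simp add: complex_is_Real_iff)
qed

text \<open>
  The map \<open>v \<mapsto> Y v\<close> carries eigenvectors of \<open>X * Y\<close> to eigenvectors of \<open>Y * X\<close>.
\<close>

lemma eigenvalue_swap:
  fixes X Y :: "complex mat"
  assumes X: "X \<in> carrier_mat r n" and Y: "Y \<in> carrier_mat n r" and e: "e \<in> spectrum (X * Y)" "e \<noteq> 0"
  shows "e \<in> spectrum (Y * X)"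
proof -
  obtain v where v: "v \<in> carrier_vec r" "v \<noteq> 0\<^sub>v r" "(X * Y) *\<^sub>v v = e \<cdot>\<^sub>v v"
    using e X unfolding spectrum_def eigenvalue_def eigenvector_def by auto
  let ?w = "Y *\<^sub>v v"
  have w: "?w \<in> carrier_vec n" using Y v by simp
  have Xw: "X *\<^sub>v ?w = e \<cdot>\<^sub>v v" using v(3) assoc_mult_mat_vec[OF X Y v(1)] by simp
  have "?w \<noteq> 0\<^sub>v n"
  proof
    assume "?w = 0\<^sub>v n"
    hence "e \<cdot>\<^sub>v v = 0\<^sub>v r" using Xw mult_mat_zero_vec[OF X] by simp
    thus False using smult_vec_eq_zeroD v e by blast
  qed
  moreover have "(Y * X) *\<^sub>v ?w = e \<cdot>\<^sub>v ?w"
    unfolding assoc_mult_mat_vec[OF Y X w] Xw by (rule mult_mat_vec[OF Y v(1)])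
  ultimately show ?thesis using w X Y unfolding spectrum_def eigenvalue_def eigenvector_def by auto
qed

lemma real_spectrum_swap:
  assumes "X \<in> carrier_mat r n" "Y \<in> carrier_mat n r" "has_real_spectrum (Y * X)"
  shows "has_real_spectrum (X * Y)"
  unfolding has_real_spectrum_def
proof
  fix e assume "e \<in> spectrum (X * Y)"
  thus "e \<in> \<real>" using eigenvalue_swap[OF assms(1,2)] assms(3) unfolding has_real_spectrum_def by (cases "e = 0") auto
qed

lemma spectrum_smult:
  fixes A :: "complex mat"
  assumes A: "A \<in> carrier_mat n n" and e: "e \<in> spectrum A"
  shows "c * e \<in> spectrum (c \<cdot>\<^sub>m A)"
proof -
  obtain v where v: "v \<in> carrier_vec n" "v \<noteq> 0\<^sub>v n" "A *\<^sub>v v = e \<cdot>\<^sub>v v"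
    using e A unfolding spectrum_def eigenvalue_def eigenvector_def by auto
  have "(c \<cdot>\<^sub>m A) *\<^sub>v v = (c * e) \<cdot>\<^sub>v v" using smult_mult_mat_vec[OF A v(1)] v by (simp add: smult_smult_assoc)
  thus ?thesis using v A unfolding spectrum_def eigenvalue_def eigenvector_def by auto
qed

lemma spectrum_smultD:
  fixes A :: "complex mat"
  assumes A: "A \<in> carrier_mat n n" and c: "c \<noteq> 0" and e: "e \<in> spectrum (c \<cdot>\<^sub>m A)"
  shows "e / c \<in> spectrum A"
proof -
  have "inverse c * e \<in> spectrum (inverse c \<cdot>\<^sub>m (c \<cdot>\<^sub>m A))" using A by (intro spectrum_smult[OF _ e]) auto
  moreover have "inverse c \<cdot>\<^sub>m (c \<cdot>\<^sub>m A) = A" using A c by (intro eq_matI) auto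
  ultimately show ?thesis by (simp add: field_simps)
qed

lemma has_real_spectrum_smult:
  assumes A: "A \<in> carrier_mat n n" and "has_real_spectrum A"
  shows "has_real_spectrum (complex_of_real c \<cdot>\<^sub>m A)"
proof (cases "c = 0")
  case True
  have z: "complex_of_real c \<cdot>\<^sub>m A = 0\<^sub>m n n" using True A by (intro eq_matI) auto
  have "e = 0" if "e \<in> spectrum (0\<^sub>m n n)" for e :: complex
  proof -
    obtain v where v: "v \<in> carrier_vec n" "v \<noteq> 0\<^sub>v n" "0\<^sub>m n n *\<^sub>v v = e \<cdot>\<^sub>v v"
      using \<open>e \<in> _\<close> unfolding spectrum_def eigenvalue_def eigenvector_def by auto
    hence "e \<cdot>\<^sub>v v = 0\<^sub>v n" using zero_mat_mult_vec[OF v(1), of n] by simp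
    thus ?thesis using smult_vec_eq_zeroD v by blast
  qed
  thus ?thesis unfolding z has_real_spectrum_def by (metis Reals_0 subsetI)
next
  case False
  show ?thesis unfolding has_real_spectrum_def
  proof
    fix e assume "e \<in> spectrum (complex_of_real c \<cdot>\<^sub>m A)"
    hence "e / complex_of_real c \<in> \<real>" using spectrum_smultD[OF A] False assms(2) unfolding has_real_spectrum_def by auto
    hence "complex_of_real c * (e / complex_of_real c) \<in> \<real>" by (intro Reals_mult) auto
    thus "e \<in> \<real>" using False by simp
  qed
qed

section \<open>Bounded irreducible groups with real commutators are discrete modulo scalars\<close>

lemma mult_diff_cancel_left:
  fixes A B C :: "complex mat"
  assumes "A \<in> carrier_mat n n" "B \<in> carrier_mat n n" "C \<in> carrier_mat n n"
  shows "A * (B - C) = A * B - A * C" "(B - C) * A = B * A - C * A"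
  using assms by (auto simp: mult_minus_distrib_mat minus_mult_distrib_mat)

lemma tendsto_null_comparison:
  fixes f :: "nat \<Rightarrow> 'a :: real_normed_vector" and g :: "nat \<Rightarrow> real"
  assumes "g \<longlonglongrightarrow> 0" "\<And>k. norm (f k) \<le> g k"
  shows "f \<longlonglongrightarrow> 0"
  using assms(1) by (rule tendsto_0_le[where K = 1]) (use assms(2) in \<open>auto intro!: always_eventually intro: order_trans[OF _ abs_ge_self]\<close>)

lemma square_mult_one:
  fixes A :: "complex mat"
  assumes "A \<in> carrier_mat n n"
  shows "A * 1\<^sub>m n = A" "1\<^sub>m n * A = A"
  using assms by auto

lemma mat_regroup:
  fixes A B C :: "complex mat"
  assumes "A \<in> carrier_mat n n" "B \<in> carrier_mat n n" "C \<in> carrier_mat n n"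
  shows "(A - C) - (B - C) = A - B" "B + (A - B) = A" "A - B = 0\<^sub>m n n \<Longrightarrow> A = B"
    "c \<cdot>\<^sub>m A - c \<cdot>\<^sub>m B = c \<cdot>\<^sub>m (A - B)"
proof -
  assume z: "A - B = 0\<^sub>m n n"
  show "A = B"
  proof (rule eq_matI)
    fix i j assume ij: "i < dim_row B" "j < dim_col B"
    hence "(A - B) $$ (i,j) = A $$ (i,j) - B $$ (i,j)" by (rule index_minus_mat)
    thus "A $$ (i,j) = B $$ (i,j)" unfolding z using ij assms by simp
  qed (use assms in auto)
qed (use assms in \<open>auto simp: algebra_simps\<close>)

lemma mat_lim_bounded_mult_null:
  assumes B: "\<And>k. B k \<in> carrier_mat n n" and bd: "\<And>k i j. i < n \<Longrightarrow> j < n \<Longrightarrow> cmod (B k $$ (i,j)) \<le> C"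
    and X: "mat_lim n n X (0\<^sub>m n n)"
  shows "mat_lim n n (\<lambda>k. B k * X k) (0\<^sub>m n n)"
proof -
  have [simp]: "dim_row (B k) = n" "dim_col (B k) = n" "dim_row (X k) = n" "dim_col (X k) = n" for k
    using B[of k] mat_lim_carrier(1)[OF X, of k] by auto
  have "(\<lambda>k. B k $$ (i,l) * X k $$ (l,j)) \<longlonglongrightarrow> 0" if "i < n" "l < n" "j < n" for i l j
  proof (rule tendsto_null_comparison)
    have "(\<lambda>k. X k $$ (l,j)) \<longlonglongrightarrow> 0" using X that unfolding mat_lim_def by auto
    thus "(\<lambda>k. C * cmod (X k $$ (l,j))) \<longlonglongrightarrow> 0" by (intro tendsto_mult_right_zero tendsto_norm_zero)
    show "norm (B k $$ (i,l) * X k $$ (l,j)) \<le> C * cmod (X k $$ (l,j))" for k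
      using bd[OF that(1,2)] by (auto simp: norm_mult intro!: mult_right_mono)
  qed
  hence "(\<lambda>k. \<Sum>l = 0..<n. B k $$ (i,l) * X k $$ (l,j)) \<longlonglongrightarrow> (\<Sum>l = 0..<n. 0)" if "i < n" "j < n" for i j
    using that by (intro tendsto_sum) auto
  thus ?thesis unfolding mat_lim_def using B by (auto simp: scalar_prod_def intro!: carrier_matI)
qed

locale matrix_group =
  fixes n :: nat and G :: "complex mat set"
  assumes G_carrier: "G \<subseteq> carrier_mat n n"
    and one_in_G: "1\<^sub>m n \<in> G"
    and mult_in_G: "\<And>A B. A \<in> G \<Longrightarrow> B \<in> G \<Longrightarrow> A * B \<in> G"
    and inverse_in_G: "\<And>A. A \<in> G \<Longrightarrow> \<exists>B\<in>G. A * B = 1\<^sub>m n \<and> B * A = 1\<^sub>m n"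
begin

definition ginv :: "complex mat \<Rightarrow> complex mat" where
  "ginv A = (SOME B. B \<in> G \<and> A * B = 1\<^sub>m n \<and> B * A = 1\<^sub>m n)"

lemma ginv:
  assumes "A \<in> G"
  shows "ginv A \<in> G" "A * ginv A = 1\<^sub>m n" "ginv A * A = 1\<^sub>m n"
  using someI_ex[of "\<lambda>B. B \<in> G \<and> A * B = 1\<^sub>m n \<and> B * A = 1\<^sub>m n"] inverse_in_G[OF assms]
  unfolding ginv_def[symmetric] by blast+

lemma carrier [simp]: "A \<in> G \<Longrightarrow> A \<in> carrier_mat n n" using G_carrier by auto

lemma ginv_carrier [simp]: "A \<in> G \<Longrightarrow> ginv A \<in> carrier_mat n n" using ginv by simp

lemma ginv_mult_cancel:
  assumes "A \<in> G" "M \<in> carrier_mat n n"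
  shows "ginv A * (A * M) = M" "A * (ginv A * M) = M" "M * ginv A * A = M" "M * A * ginv A = M"
proof -
  show "ginv A * (A * M) = M" using assms ginv[OF assms(1)] by (simp add: assoc_mult_mat[of _ n n _ n _ n, symmetric])
  show "A * (ginv A * M) = M" using assms ginv[OF assms(1)] by (simp add: assoc_mult_mat[of _ n n _ n _ n, symmetric])
  show "M * ginv A * A = M" using assms ginv[OF assms(1)] by (simp add: assoc_mult_mat[of _ n n _ n _ n])
  show "M * A * ginv A = M" using assms ginv[OF assms(1)] by (simp add: assoc_mult_mat[of _ n n _ n _ n])
qed

lemma conj_carrier: "u \<in> G \<Longrightarrow> M \<in> carrier_mat n n \<Longrightarrow> u * M * ginv u \<in> carrier_mat n n"
  by (auto intro!: mult_carrier_mat[of _ n n])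

lemma ginv_mult_vec:
  assumes "A \<in> G" "v \<in> carrier_vec n"
  shows "ginv A *\<^sub>v (A *\<^sub>v v) = v"
  using assms ginv[OF assms(1)] by (simp add: assoc_mult_mat_vec[of _ n n _ n, symmetric])

lemma pow_in_G: "A \<in> G \<Longrightarrow> A ^\<^sub>m k \<in> G"
proof (induction k)
  case 0
  have "dim_row A = n" using carrier[OF \<open>A \<in> G\<close>] by auto
  thus ?case using one_in_G by simp
qed (simp add: mult_in_G)

end

locale real_commutator_group = matrix_group +
  assumes dim_pos: "n > 0"
    and irreducible: "irreducible_matrices n G"
    and bounded: "\<exists>C. \<forall>A\<in>G. \<forall>i<n. \<forall>j<n. cmod (A $$ (i,j)) \<le> C"
    and real_commutator: "\<And>A B. A \<in> G \<Longrightarrow> B \<in> G \<Longrightarrow> has_real_spectrum (A * B - B * A)"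
begin

text \<open>
  A difference of conjugates inside a group is itself a ring commutator, so the hypothesis on commutators applies
  to it.
\<close>

lemma conjugate_difference:
  assumes "A \<in> G" "u \<in> G"
  shows "A - u * A * ginv u = (A * ginv u) * u - u * (A * ginv u)"
  using assms ginv_mult_cancel(3)[of u A] assoc_mult_mat[of u n n A n "ginv u" n] by simp

lemma real_conjugate_difference:
  assumes "A \<in> G" "u \<in> G"
  shows "has_real_spectrum (A - u * A * ginv u)"
  unfolding conjugate_difference[OF assms] using assms by (intro real_commutator mult_in_G ginv)

text \<open>
  The least norm above the sum norm for which every member of \<open>G\<close> is an isometry.
\<close>

definition gnorm :: "complex vec \<Rightarrow> real" where
  "gnorm v = (SUP A\<in>G. \<Sum>i<n. cmod ((A *\<^sub>v v) $ i))"

lemma gnorm_bound: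
  obtains C where "C \<ge> 0" "\<And>v A. v \<in> carrier_vec n \<Longrightarrow> A \<in> G \<Longrightarrow> (\<Sum>i<n. cmod ((A *\<^sub>v v) $ i)) \<le> C * (\<Sum>i<n. cmod (v $ i))"
proof -
  obtain C where C: "\<forall>A\<in>G. \<forall>i<n. \<forall>j<n. cmod (A $$ (i,j)) \<le> C" using bounded by blast
  have C0: "C \<ge> 0" using C one_in_G dim_pos order_trans[OF norm_ge_zero] by blast
  show thesis
  proof (rule that[of "of_nat n * C"])
    fix v :: "complex vec" and A assume v: "v \<in> carrier_vec n" and A: "A \<in> G"
    have "cmod ((A *\<^sub>v v) $ i) \<le> C * (\<Sum>j<n. cmod (v $ j))" if i: "i < n" for i
    proof -
      have "(A *\<^sub>v v) $ i = (\<Sum>j<n. A $$ (i,j) * v $ j)"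
        using carrier[OF A] v i by (simp add: scalar_prod_def atLeast0LessThan)
      also have "cmod \<dots> \<le> (\<Sum>j<n. cmod (A $$ (i,j) * v $ j))" by (rule norm_sum)
      also have "\<dots> \<le> (\<Sum>j<n. C * cmod (v $ j))" using C A i by (intro sum_mono) (auto simp: norm_mult intro!: mult_right_mono)
      finally show ?thesis by (simp add: sum_distrib_left)
    qed
    hence "(\<Sum>i<n. cmod ((A *\<^sub>v v) $ i)) \<le> (\<Sum>i<n. C * (\<Sum>j<n. cmod (v $ j)))" by (intro sum_mono) auto
    thus "(\<Sum>i<n. cmod ((A *\<^sub>v v) $ i)) \<le> of_nat n * C * (\<Sum>i<n. cmod (v $ i))" by simp
  qed (use C0 in simp)
qed

lemma gnorm_bdd: "v \<in> carrier_vec n \<Longrightarrow> bdd_above ((\<lambda>A. \<Sum>i<n. cmod ((A *\<^sub>v v) $ i)) ` G)"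
  using gnorm_bound unfolding bdd_above_def by (metis (no_types, lifting) imageE)

lemma gnorm_upper: "v \<in> carrier_vec n \<Longrightarrow> A \<in> G \<Longrightarrow> (\<Sum>i<n. cmod ((A *\<^sub>v v) $ i)) \<le> gnorm v"
  unfolding gnorm_def by (rule cSUP_upper[OF _ gnorm_bdd])

lemma gnorm_least: "(\<And>A. A \<in> G \<Longrightarrow> (\<Sum>i<n. cmod ((A *\<^sub>v v) $ i)) \<le> b) \<Longrightarrow> gnorm v \<le> b"
  unfolding gnorm_def using one_in_G by (intro cSUP_least) auto

lemma gnorm_ge: "v \<in> carrier_vec n \<Longrightarrow> (\<Sum>i<n. cmod (v $ i)) \<le> gnorm v"
  using gnorm_upper[OF _ one_in_G, of v] by simp

lemma gnorm_nonneg: "v \<in> carrier_vec n \<Longrightarrow> 0 \<le> gnorm v"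
  using gnorm_ge[of v] sum_nonneg[of "{..<n}" "\<lambda>i. cmod (v $ i)"] by simp

lemma gnorm_pos:
  assumes "v \<in> carrier_vec n" "v \<noteq> 0\<^sub>v n"
  shows "0 < gnorm v"
proof -
  obtain i where i: "i < n" "v $ i \<noteq> 0" using assms by (metis carrier_vecD eq_vecI index_zero_vec)
  have "0 < (\<Sum>i<n. cmod (v $ i))" using i by (intro sum_pos2[of _ i]) auto
  thus ?thesis using gnorm_ge[OF assms(1)] by simp
qed

lemma gnorm_isometry_le:
  assumes "v \<in> carrier_vec n" "B \<in> G"
  shows "gnorm (B *\<^sub>v v) \<le> gnorm v"
proof (rule gnorm_least)
  fix A assume A: "A \<in> G"
  have "A *\<^sub>v (B *\<^sub>v v) = (A * B) *\<^sub>v v" using A assms by (simp add: assoc_mult_mat_vec[of _ n n _ n])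
  thus "(\<Sum>i<n. cmod ((A *\<^sub>v (B *\<^sub>v v)) $ i)) \<le> gnorm v" using gnorm_upper[OF assms(1) mult_in_G[OF A assms(2)]] by simp
qed

lemma gnorm_isometry:
  assumes "v \<in> carrier_vec n" "B \<in> G"
  shows "gnorm (B *\<^sub>v v) = gnorm v"
proof (rule antisym)
  have "gnorm (ginv B *\<^sub>v (B *\<^sub>v v)) \<le> gnorm (B *\<^sub>v v)"
    using assms by (intro gnorm_isometry_le ginv mult_mat_vec_carrier[OF carrier])
  thus "gnorm v \<le> gnorm (B *\<^sub>v v)" using ginv_mult_vec[OF assms(2,1)] by simp
qed (rule gnorm_isometry_le[OF assms])

lemma gnorm_triangle:
  assumes "v \<in> carrier_vec n" "w \<in> carrier_vec n"
  shows "gnorm (v + w) \<le> gnorm v + gnorm w"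
proof (rule gnorm_least)
  fix A assume A: "A \<in> G"
  have "(\<Sum>i<n. cmod ((A *\<^sub>v (v + w)) $ i)) = (\<Sum>i<n. cmod ((A *\<^sub>v v) $ i + (A *\<^sub>v w) $ i))"
    using carrier[OF A] assms by (intro sum.cong) (auto simp: mult_add_distrib_mat_vec[of _ n n] simp del: index_mult_mat_vec)
  also have "\<dots> \<le> (\<Sum>i<n. cmod ((A *\<^sub>v v) $ i) + cmod ((A *\<^sub>v w) $ i))" by (intro sum_mono norm_triangle_ineq)
  also have "\<dots> \<le> gnorm v + gnorm w" using gnorm_upper[OF assms(1) A] gnorm_upper[OF assms(2) A] by (simp add: sum.distrib)
  finally show "(\<Sum>i<n. cmod ((A *\<^sub>v (v + w)) $ i)) \<le> gnorm v + gnorm w" .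
qed

lemma gnorm_smult_le:
  assumes "v \<in> carrier_vec n"
  shows "gnorm (c \<cdot>\<^sub>v v) \<le> cmod c * gnorm v"
proof (rule gnorm_least)
  fix A assume A: "A \<in> G"
  have "(\<Sum>i<n. cmod ((A *\<^sub>v (c \<cdot>\<^sub>v v)) $ i)) = (\<Sum>i<n. cmod c * cmod ((A *\<^sub>v v) $ i))"
    using carrier[OF A] assms by (intro sum.cong) (auto simp: mult_mat_vec[of _ n n] norm_mult simp del: index_mult_mat_vec)
  also have "\<dots> \<le> cmod c * gnorm v" using gnorm_upper[OF assms A] by (simp add: sum_distrib_left[symmetric] mult_left_mono)
  finally show "(\<Sum>i<n. cmod ((A *\<^sub>v (c \<cdot>\<^sub>v v)) $ i)) \<le> cmod c * gnorm v" .
qed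

lemma gnorm_smult:
  assumes "v \<in> carrier_vec n"
  shows "gnorm (c \<cdot>\<^sub>v v) = cmod c * gnorm v"
proof (rule antisym[OF gnorm_smult_le[OF assms]])
  show "cmod c * gnorm v \<le> gnorm (c \<cdot>\<^sub>v v)"
  proof (cases "c = 0")
    case True
    thus ?thesis using gnorm_nonneg[of "c \<cdot>\<^sub>v v"] assms by simp
  next
    case False
    have "v = inverse c \<cdot>\<^sub>v (c \<cdot>\<^sub>v v)" using False assms by (simp add: smult_smult_assoc)
    hence "gnorm v \<le> cmod (inverse c) * gnorm (c \<cdot>\<^sub>v v)" using gnorm_smult_le[of "c \<cdot>\<^sub>v v" "inverse c"] assms by simp
    hence "cmod c * gnorm v \<le> cmod c * (cmod (inverse c) * gnorm (c \<cdot>\<^sub>v v))" by (intro mult_left_mono) auto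
    also have "\<dots> = gnorm (c \<cdot>\<^sub>v v)" using False by (simp add: norm_inverse mult.assoc[symmetric])
    finally show ?thesis .
  qed
qed

lemma gnorm_null_seq:
  assumes D: "mat_lim n n D Z" and v: "v \<in> carrier_vec n"
  shows "(\<lambda>k. gnorm (D k *\<^sub>v v - Z *\<^sub>v v)) \<longlonglongrightarrow> 0"
proof -
  obtain C where C: "C \<ge> 0" "\<And>v A. v \<in> carrier_vec n \<Longrightarrow> A \<in> G \<Longrightarrow> (\<Sum>i<n. cmod ((A *\<^sub>v v) $ i)) \<le> C * (\<Sum>i<n. cmod (v $ i))"
    using gnorm_bound by blast
  have car: "D k \<in> carrier_mat n n" "Z \<in> carrier_mat n n" for k using mat_lim_carrier[OF D] by auto
  have w: "D k *\<^sub>v v - Z *\<^sub>v v \<in> carrier_vec n" for k using car v by (intro minus_carrier_vec mult_mat_vec_carrier)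
  have "(\<lambda>k. (D k *\<^sub>v v - Z *\<^sub>v v) $ i) \<longlonglongrightarrow> 0" if i: "i < n" for i
  proof -
    have "(\<lambda>k. (\<Sum>j<n. D k $$ (i,j) * v $ j) - (\<Sum>j<n. Z $$ (i,j) * v $ j)) \<longlonglongrightarrow>
        (\<Sum>j<n. Z $$ (i,j) * v $ j) - (\<Sum>j<n. Z $$ (i,j) * v $ j)"
      using D i unfolding mat_lim_def by (intro tendsto_intros) auto
    moreover have "(D k *\<^sub>v v - Z *\<^sub>v v) $ i = (\<Sum>j<n. D k $$ (i,j) * v $ j) - (\<Sum>j<n. Z $$ (i,j) * v $ j)" for k
    proof -
      have d: "dim_row (D k) = n" "dim_col (D k) = n" "dim_row Z = n" "dim_col Z = n" "dim_vec v = n"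
        using car(1)[of k] car(2) v by auto
      show ?thesis using i by (simp add: d scalar_prod_def atLeast0LessThan)
    qed
    ultimately show ?thesis by simp
  qed
  hence "(\<lambda>k. C * (\<Sum>i<n. cmod ((D k *\<^sub>v v - Z *\<^sub>v v) $ i))) \<longlonglongrightarrow> C * (\<Sum>i<n. 0)"
    by (intro tendsto_mult tendsto_const tendsto_sum tendsto_norm_zero) auto
  hence "(\<lambda>k. C * (\<Sum>i<n. cmod ((D k *\<^sub>v v - Z *\<^sub>v v) $ i))) \<longlonglongrightarrow> 0" by simp
  thus ?thesis
    by (rule tendsto_null_comparison) (use gnorm_nonneg[OF w] C(2)[OF w] in \<open>auto intro!: gnorm_least\<close>)
qed

text \<open>
  The rearrangements of sums that the estimates for powers of almost unipotent isometries need.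
\<close>

lemma vec_regroup:
  fixes a b c v w :: "complex vec"
  assumes "a \<in> carrier_vec m" "b \<in> carrier_vec m" "c \<in> carrier_vec m" "v \<in> carrier_vec m" "w \<in> carrier_vec m"
  shows "(a + e \<cdot>\<^sub>v b) - w = (a - w) + e \<cdot>\<^sub>v b"
    and "(a + e \<cdot>\<^sub>v b) - (v + (s + e) \<cdot>\<^sub>v w) = (a - (v + s \<cdot>\<^sub>v w)) + (e \<cdot>\<^sub>v (b - c) + e \<cdot>\<^sub>v (c - w))"
    and "v + e \<cdot>\<^sub>v b = (1 + e * r) \<cdot>\<^sub>v v + e \<cdot>\<^sub>v (b - r \<cdot>\<^sub>v v)"
    and "(1 + e * r) \<cdot>\<^sub>v v = (v + e \<cdot>\<^sub>v b) + (- e) \<cdot>\<^sub>v (b - r \<cdot>\<^sub>v v)"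
    and "s \<cdot>\<^sub>v w = (a + (- 1) \<cdot>\<^sub>v v) + (- 1) \<cdot>\<^sub>v (a - (v + s \<cdot>\<^sub>v w))"
  using assms by (auto simp: algebra_simps)

text \<open>
  The group consists of isometries for \<open>gnorm\<close>, so a tangent vector \<open>Z\<close> to it cannot have a real nonzero
  eigenvalue, which would stretch an eigenvector to first order. A nilpotent nonzero \<open>Z\<close> is excluded as well:
  many steps of size \<open>\<epsilon> k\<close> would displace a vector linearly in the number of steps, beyond any bound.
\<close>

lemma tangent_zero:
  assumes h: "\<And>k. h k \<in> G" and eps: "\<And>k. \<epsilon> k > 0" "\<epsilon> \<longlonglongrightarrow> 0"
    and lim: "mat_lim n n (\<lambda>k. complex_of_real (1 / \<epsilon> k) \<cdot>\<^sub>m (h k - 1\<^sub>m n)) Z"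
    and real: "has_real_spectrum Z"
  shows "Z = 0\<^sub>m n n"
proof -
  define D where "D k = complex_of_real (1 / \<epsilon> k) \<cdot>\<^sub>m (h k - 1\<^sub>m n)" for k
  have lim: "mat_lim n n D Z" using lim unfolding D_def .
  have Z: "Z \<in> carrier_mat n n" and D: "D k \<in> carrier_mat n n" for k using mat_lim_carrier[OF lim] by auto
  have hv: "h k *\<^sub>v v = v + complex_of_real (\<epsilon> k) \<cdot>\<^sub>v (D k *\<^sub>v v)" if v: "v \<in> carrier_vec n" for k v
  proof -
    have "D k *\<^sub>v v = complex_of_real (1 / \<epsilon> k) \<cdot>\<^sub>v (h k *\<^sub>v v - v)"
      unfolding D_def using carrier[OF h[of k]] v by (simp add: smult_mult_mat_vec[of _ n n] minus_mult_distrib_mat_vec[of _ n n] minus_carrier_mat)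
    hence "complex_of_real (\<epsilon> k) \<cdot>\<^sub>v (D k *\<^sub>v v) = h k *\<^sub>v v - v" using eps(1)[of k] by (simp add: smult_smult_assoc)
    thus ?thesis using carrier[OF h[of k]] v by auto
  qed
  \<comment> \<open>On an eigenvector \<open>v\<close> for \<open>r\<close> the isometry \<open>h k\<close> acts like
    \<open>1 + \<epsilon> k r\<close> up to \<open>\<epsilon> k * gnorm (D k v - Z v)\<close>.\<close>
  have spec: "spectrum Z \<subseteq> {0}"
  proof
    fix z assume z: "z \<in> spectrum Z"
    define r where "r = Re z"
    have zr: "z = complex_of_real r" using z real unfolding has_real_spectrum_def r_def by (auto simp: complex_is_Real_iff complex_eq_iff)
    obtain v where v: "v \<in> carrier_vec n" "v \<noteq> 0\<^sub>v n" "Z *\<^sub>v v = z \<cdot>\<^sub>v v"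
      using z Z unfolding spectrum_def eigenvalue_def eigenvector_def by auto
    have "(\<lambda>k. \<epsilon> k * \<bar>r\<bar>) \<longlonglongrightarrow> 0" using eps(2) by (rule tendsto_mult_left_zero)
    hence small: "\<forall>\<^sub>F k in sequentially. \<epsilon> k * \<bar>r\<bar> < 1" by (rule order_tendstoD) simp
    have key: "\<bar>r\<bar> * gnorm v \<le> gnorm (D k *\<^sub>v v - Z *\<^sub>v v)" if sm: "\<epsilon> k * \<bar>r\<bar> < 1" for k
    proof -
      let ?d = "D k *\<^sub>v v - Z *\<^sub>v v"
      have d: "?d \<in> carrier_vec n" using D Z v by (intro minus_carrier_vec mult_mat_vec_carrier)
      have Dv: "D k *\<^sub>v v \<in> carrier_vec n" using D v by (intro mult_mat_vec_carrier)
      have e: "h k *\<^sub>v v = complex_of_real (1 + \<epsilon> k * r) \<cdot>\<^sub>v v + complex_of_real (\<epsilon> k) \<cdot>\<^sub>v ?d"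
        unfolding hv[OF v(1)] v(3) zr using vec_regroup(3)[OF v(1) Dv v(1) v(1) v(1)] by simp
      have e': "complex_of_real (1 + \<epsilon> k * r) \<cdot>\<^sub>v v = h k *\<^sub>v v + complex_of_real (- \<epsilon> k) \<cdot>\<^sub>v ?d"
        unfolding hv[OF v(1)] v(3) zr using vec_regroup(4)[OF v(1) Dv v(1) v(1) v(1)] by simp
      have 1: "gnorm v \<le> cmod (complex_of_real (1 + \<epsilon> k * r)) * gnorm v + \<epsilon> k * gnorm ?d"
        using gnorm_triangle[of "complex_of_real (1 + \<epsilon> k * r) \<cdot>\<^sub>v v" "complex_of_real (\<epsilon> k) \<cdot>\<^sub>v ?d", folded e] v(1) d
          gnorm_isometry[OF v(1) h[of k]] eps(1)[of k] by (simp add: gnorm_smult del: of_real_add of_real_mult)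
      have "gnorm (complex_of_real (1 + \<epsilon> k * r) \<cdot>\<^sub>v v) \<le> gnorm (h k *\<^sub>v v) + gnorm (complex_of_real (- \<epsilon> k) \<cdot>\<^sub>v ?d)"
        unfolding e' using v(1) d carrier[OF h[of k]] by (intro gnorm_triangle) auto
      hence 2: "cmod (complex_of_real (1 + \<epsilon> k * r)) * gnorm v \<le> gnorm v + \<epsilon> k * gnorm ?d"
        using gnorm_isometry[OF v(1) h[of k]] eps(1)[of k] v(1) d by (simp add: gnorm_smult del: of_real_add of_real_mult)
      have ab: "\<bar>\<epsilon> k * r\<bar> < 1" using sm eps(1)[of k] by (simp add: abs_mult)
      have c: "cmod (complex_of_real (1 + \<epsilon> k * r)) = 1 + \<epsilon> k * r" using ab unfolding norm_of_real by linarith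
      have "\<epsilon> k * (r * gnorm v) \<le> \<epsilon> k * gnorm ?d" "\<epsilon> k * (- r * gnorm v) \<le> \<epsilon> k * gnorm ?d"
        using 1 2 unfolding c by (simp_all add: algebra_simps)
      hence "r * gnorm v \<le> gnorm ?d" "- r * gnorm v \<le> gnorm ?d"
        using mult_le_cancel_left_pos[OF eps(1)[of k]] by blast+
      thus ?thesis by (cases "r \<ge> 0") auto
    qed
    have "\<bar>r\<bar> * gnorm v \<le> 0"
      by (rule tendsto_lowerbound[OF gnorm_null_seq[OF lim v(1)]]) (use small key in \<open>auto elim: eventually_mono\<close>)
    hence "r = 0" using gnorm_pos[OF v(1,2)] by (simp add: mult_le_0_iff)
    thus "z \<in> {0}" using zr by simp
  qed
  show ?thesis
  proof (rule ccontr)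
    assume "Z \<noteq> 0\<^sub>m n n"
    then obtain v where v: "v \<in> carrier_vec n" "Z *\<^sub>v v \<noteq> 0\<^sub>v n" "Z *\<^sub>v (Z *\<^sub>v v) = 0\<^sub>v n"
      using nilpotent_square_zero_vector[OF Z nilpotent_of_zero_spectrum[OF Z spec]] by blast
    \<comment> \<open>To first order \<open>h k\<close> fixes \<open>w\<close> and adds \<open>\<epsilon> k w\<close> to
      \<open>v\<close>; \<open>\<alpha>\<close> and \<open>\<beta>\<close> measure the errors.\<close>
    define w where "w = Z *\<^sub>v v"
    have w: "w \<in> carrier_vec n" "w \<noteq> 0\<^sub>v n" "Z *\<^sub>v w = 0\<^sub>v n" using v Z unfolding w_def by auto
    define \<alpha> where "\<alpha> k = gnorm (D k *\<^sub>v v - Z *\<^sub>v v)" for k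
    define \<beta> where "\<beta> k = gnorm (D k *\<^sub>v w)" for k
    have \<alpha>0: "\<alpha> \<longlonglongrightarrow> 0" unfolding \<alpha>_def by (rule gnorm_null_seq[OF lim v(1)])
    have "D k *\<^sub>v w - Z *\<^sub>v w = D k *\<^sub>v w" for k using D[of k] w by auto
    hence \<beta>0: "\<beta> \<longlonglongrightarrow> 0" using gnorm_null_seq[OF lim w(1)] unfolding \<beta>_def by simp
    have Dv: "D k *\<^sub>v x \<in> carrier_vec n" if "x \<in> carrier_vec n" for k x using D that by (intro mult_mat_vec_carrier)
    have hm: "h k ^\<^sub>m m \<in> carrier_mat n n" for k m using pow_in_G[OF h] by simp
    have step: "h k ^\<^sub>m Suc m *\<^sub>v x = h k ^\<^sub>m m *\<^sub>v x + complex_of_real (\<epsilon> k) \<cdot>\<^sub>v (h k ^\<^sub>m m *\<^sub>v (D k *\<^sub>v x))" if x: "x \<in> carrier_vec n" for k m x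
    proof -
      have "h k ^\<^sub>m Suc m *\<^sub>v x = h k ^\<^sub>m m *\<^sub>v (h k *\<^sub>v x)" using hm carrier[OF h] x by (simp add: assoc_mult_mat_vec[of _ n n _ n])
      also have "\<dots> = h k ^\<^sub>m m *\<^sub>v x + h k ^\<^sub>m m *\<^sub>v (complex_of_real (\<epsilon> k) \<cdot>\<^sub>v (D k *\<^sub>v x))"
        unfolding hv[OF x] using x Dv[OF x] by (intro mult_add_distrib_mat_vec[OF hm]) auto
      also have "h k ^\<^sub>m m *\<^sub>v (complex_of_real (\<epsilon> k) \<cdot>\<^sub>v (D k *\<^sub>v x)) = complex_of_real (\<epsilon> k) \<cdot>\<^sub>v (h k ^\<^sub>m m *\<^sub>v (D k *\<^sub>v x))"
        by (rule mult_mat_vec[OF hm Dv[OF x]])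
      finally show ?thesis .
    qed
    have wm: "gnorm (h k ^\<^sub>m m *\<^sub>v w - w) \<le> real m * \<epsilon> k * \<beta> k" for k m
    proof (induction m)
      case 0
      have "h k ^\<^sub>m 0 *\<^sub>v w - w = 0 \<cdot>\<^sub>v w" using w carrier[OF h[of k]] by (auto simp: carrier_matD)
      thus ?case using gnorm_smult[OF w(1), of 0] by simp
    next
      case (Suc m)
      have a: "h k ^\<^sub>m m *\<^sub>v (D k *\<^sub>v w) \<in> carrier_vec n" "h k ^\<^sub>m m *\<^sub>v w \<in> carrier_vec n"
        by (rule mult_mat_vec_carrier[OF hm Dv[OF w(1)]], rule mult_mat_vec_carrier[OF hm w(1)])
      have "h k ^\<^sub>m Suc m *\<^sub>v w - w = (h k ^\<^sub>m m *\<^sub>v w - w) + complex_of_real (\<epsilon> k) \<cdot>\<^sub>v (h k ^\<^sub>m m *\<^sub>v (D k *\<^sub>v w))"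
        unfolding step[OF w(1)] by (rule vec_regroup(1)[OF a(2,1) w(1) w(1) w(1)])
      hence "gnorm (h k ^\<^sub>m Suc m *\<^sub>v w - w) \<le> gnorm (h k ^\<^sub>m m *\<^sub>v w - w) + \<epsilon> k * \<beta> k"
        using gnorm_triangle[of "h k ^\<^sub>m m *\<^sub>v w - w" "complex_of_real (\<epsilon> k) \<cdot>\<^sub>v (h k ^\<^sub>m m *\<^sub>v (D k *\<^sub>v w))"] a w(1) eps(1)[of k]
          gnorm_isometry[OF Dv[OF w(1)] pow_in_G[OF h[of k]]] by (simp add: gnorm_smult \<beta>_def)
      thus ?case using Suc by (simp add: algebra_simps)
    qed
    have vm: "gnorm (h k ^\<^sub>m m *\<^sub>v v - (v + complex_of_real (real m * \<epsilon> k) \<cdot>\<^sub>v w)) \<le> real m * \<epsilon> k * \<alpha> k + (real m * \<epsilon> k)\<^sup>2 * \<beta> k" for k m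
    proof (induction m)
      case 0
      have "h k ^\<^sub>m 0 *\<^sub>v v - (v + complex_of_real (real 0 * \<epsilon> k) \<cdot>\<^sub>v w) = 0 \<cdot>\<^sub>v v" using v(1) w(1) carrier[OF h[of k]] by (auto simp: carrier_matD)
      thus ?case using gnorm_smult[OF v(1), of 0] by simp
    next
      case (Suc m)
      let ?H = "h k ^\<^sub>m m" and ?e = "complex_of_real (\<epsilon> k)"
      let ?p = "?H *\<^sub>v v - (v + complex_of_real (real m * \<epsilon> k) \<cdot>\<^sub>v w)"
      let ?q = "?H *\<^sub>v (D k *\<^sub>v v - w)"
      let ?s = "?H *\<^sub>v w - w"
      have a: "?H *\<^sub>v (D k *\<^sub>v v) \<in> carrier_vec n" "?H *\<^sub>v w \<in> carrier_vec n" "?H *\<^sub>v v \<in> carrier_vec n"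
        by (rule mult_mat_vec_carrier[OF hm Dv[OF v(1)]], rule mult_mat_vec_carrier[OF hm w(1)], rule mult_mat_vec_carrier[OF hm v(1)])
      have q: "?q = ?H *\<^sub>v (D k *\<^sub>v v) - ?H *\<^sub>v w" using hm Dv[OF v(1)] w by (intro mult_minus_distrib_mat_vec) auto
      have qc: "?q \<in> carrier_vec n" and pc: "?p \<in> carrier_vec n" and sc: "?s \<in> carrier_vec n"
        unfolding q using a w v(1) by auto
      have "h k ^\<^sub>m Suc m *\<^sub>v v - (v + complex_of_real (real (Suc m) * \<epsilon> k) \<cdot>\<^sub>v w) = ?p + (?e \<cdot>\<^sub>v ?q + ?e \<cdot>\<^sub>v ?s)"
        unfolding step[OF v(1)] q using vec_regroup(2)[OF a(3,1,2) v(1) w(1), of ?e "complex_of_real (real m * \<epsilon> k)"]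
        by (simp add: algebra_simps)
      also have "gnorm \<dots> \<le> gnorm ?p + (gnorm (?e \<cdot>\<^sub>v ?q) + gnorm (?e \<cdot>\<^sub>v ?s))"
        using gnorm_triangle[of ?p "?e \<cdot>\<^sub>v ?q + ?e \<cdot>\<^sub>v ?s"] gnorm_triangle[of "?e \<cdot>\<^sub>v ?q" "?e \<cdot>\<^sub>v ?s"] pc qc sc by simp
      also have "\<dots> = gnorm ?p + (\<epsilon> k * \<alpha> k + \<epsilon> k * gnorm ?s)"
        using gnorm_isometry[OF _ pow_in_G[OF h[of k]], of "D k *\<^sub>v v - w" m] Dv[OF v(1)] w(1) qc sc eps(1)[of k]
        by (simp add: gnorm_smult \<alpha>_def w_def[symmetric])
      also have "\<dots> \<le> (real m * \<epsilon> k * \<alpha> k + (real m * \<epsilon> k)\<^sup>2 * \<beta> k) + (\<epsilon> k * \<alpha> k + \<epsilon> k * (real m * \<epsilon> k * \<beta> k))"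
        using Suc wm[of k m] eps(1)[of k] by (intro add_mono mult_left_mono) auto
      also have "\<dots> \<le> real (Suc m) * \<epsilon> k * \<alpha> k + (real (Suc m) * \<epsilon> k)\<^sup>2 * \<beta> k"
      proof -
        have "0 \<le> (real m + 1) * ((\<epsilon> k)\<^sup>2 * \<beta> k)" using gnorm_nonneg[OF Dv[OF w(1)]] unfolding \<beta>_def by simp
        thus ?thesis by (simp add: algebra_simps power2_eq_square)
      qed
      finally show ?case .
    qed
    have gv: "gnorm v > 0"
    proof (rule gnorm_pos[OF v(1)])
      show "v \<noteq> 0\<^sub>v n" using w(2) mult_mat_zero_vec[OF Z] unfolding w_def by metis
    qed
    have gw: "gnorm w > 0" by (rule gnorm_pos[OF w(1,2)])
    \<comment> \<open>The vector \<open>x w\<close> with \<open>x \<ge> t\<close> is too long for the bound \<open>3 gnorm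
      v + x gnorm w / 4\<close> proved below: three quarters of \<open>5 gnorm v\<close> exceed \<open>3
      gnorm v\<close>.\<close>
    define t where "t = 5 * gnorm v / gnorm w"
    have t: "t > 0" "t * gnorm w = 5 * gnorm v" using gv gw unfolding t_def by auto
    have "\<forall>\<^sub>F k in sequentially. \<epsilon> k < 1 \<and> \<alpha> k < gnorm w / 4 \<and> \<beta> k < gnorm v / (t + 1)\<^sup>2"
      using order_tendstoD(2)[OF eps(2), of 1] order_tendstoD(2)[OF \<alpha>0, of "gnorm w / 4"]
        order_tendstoD(2)[OF \<beta>0, of "gnorm v / (t + 1)\<^sup>2"] gv gw t(1) by (auto intro!: eventually_conj)
    then obtain k where k: "\<epsilon> k < 1" "\<alpha> k < gnorm w / 4" "\<beta> k < gnorm v / (t + 1)\<^sup>2"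
      using eventually_happens'[OF sequentially_bot] by blast
    define m where "m = nat \<lceil>t / \<epsilon> k\<rceil>"
    define x where "x = real m * \<epsilon> k"
    have m: "t / \<epsilon> k \<le> real m" "real m < t / \<epsilon> k + 1" unfolding m_def using t(1) eps(1)[of k] by (auto simp: le_nat_iff) linarith+
    have x: "t \<le> x" "x \<le> t + 1"
      using m eps(1)[of k] k(1) unfolding x_def by (auto simp: field_simps)
    have x0: "x > 0" using x t by simp
    have "x * gnorm w = gnorm (complex_of_real x \<cdot>\<^sub>v w)" using gnorm_smult[OF w(1)] x0 by simp
    also have "complex_of_real x \<cdot>\<^sub>v w = (h k ^\<^sub>m m *\<^sub>v v + (- 1) \<cdot>\<^sub>v v) + (- 1) \<cdot>\<^sub>v (h k ^\<^sub>m m *\<^sub>v v - (v + complex_of_real x \<cdot>\<^sub>v w))"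
      by (rule vec_regroup(5)[OF mult_mat_vec_carrier[OF hm v(1)] v(1) v(1) v(1) w(1)])
    also have "gnorm \<dots> \<le> (gnorm v + gnorm v) + (x * \<alpha> k + x\<^sup>2 * \<beta> k)"
    proof -
      have c: "h k ^\<^sub>m m *\<^sub>v v \<in> carrier_vec n" "h k ^\<^sub>m m *\<^sub>v v - (v + complex_of_real x \<cdot>\<^sub>v w) \<in> carrier_vec n" using hm[of k m] v(1) w(1) by auto
      show ?thesis
        using gnorm_triangle[of "h k ^\<^sub>m m *\<^sub>v v + (- 1) \<cdot>\<^sub>v v" "(- 1) \<cdot>\<^sub>v (h k ^\<^sub>m m *\<^sub>v v - (v + complex_of_real x \<cdot>\<^sub>v w))"]
          gnorm_triangle[of "h k ^\<^sub>m m *\<^sub>v v" "(- 1) \<cdot>\<^sub>v v"] vm[of k m, folded x_def] gnorm_isometry[OF v(1) pow_in_G[OF h[of k]], of m]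
          gnorm_smult[OF v(1), of "-1"] gnorm_smult[OF c(2), of "-1"] v(1) c by simp
    qed
    also have "\<dots> \<le> (gnorm v + gnorm v) + (x * (gnorm w / 4) + (t + 1)\<^sup>2 * (gnorm v / (t + 1)\<^sup>2))"
    proof -
      have "x * \<alpha> k \<le> x * (gnorm w / 4)" using k(2) x0 by (intro mult_left_mono) auto
      moreover have "x\<^sup>2 * \<beta> k \<le> (t + 1)\<^sup>2 * (gnorm v / (t + 1)\<^sup>2)"
        using k(3) x x0 gnorm_nonneg[OF Dv[OF w(1)]] by (intro mult_mono power_mono) (auto simp: \<beta>_def)
      ultimately show ?thesis by linarith
    qed
    also have "\<dots> = 3 * gnorm v + x * gnorm w / 4" using t(1) by simp
    finally have "3 / 4 * (x * gnorm w) \<le> 3 * gnorm v" by simp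
    moreover have "t * gnorm w \<le> x * gnorm w" using x(1) gw by simp
    ultimately show False using t(2) gv by linarith
  qed
qed

text \<open>
  Inverses stay bounded, and \<open>F\<^sup>-\<^sup>1 = 1 + F\<^sup>-\<^sup>1 (1 - F)\<close>.
\<close>

lemma ginv_limit_one:
  assumes F: "\<And>k. F k \<in> G" and lim: "mat_lim n n F (1\<^sub>m n)"
  shows "mat_lim n n (\<lambda>k. ginv (F k)) (1\<^sub>m n)"
proof -
  obtain C where C: "\<forall>A\<in>G. \<forall>i<n. \<forall>j<n. cmod (A $$ (i,j)) \<le> C" using bounded by blast
  have z: "1\<^sub>m n - 1\<^sub>m n = (0\<^sub>m n n :: complex mat)" by auto
  have "mat_lim n n (\<lambda>k. 1\<^sub>m n - F k) (0\<^sub>m n n)"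
    using mat_lim_diff[OF mat_lim_const[OF one_carrier_mat] lim] unfolding z .
  hence "mat_lim n n (\<lambda>k. ginv (F k) * (1\<^sub>m n - F k)) (0\<^sub>m n n)"
    by (rule mat_lim_bounded_mult_null[where C = C, rotated 2]) (use C ginv F in auto)
  hence "mat_lim n n (\<lambda>k. 1\<^sub>m n + ginv (F k) * (1\<^sub>m n - F k)) (1\<^sub>m n + 0\<^sub>m n n)"
    by (rule mat_lim_add[OF mat_lim_const[OF one_carrier_mat]])
  moreover have "1\<^sub>m n + ginv (F k) * (1\<^sub>m n - F k) = ginv (F k)" for k
    using F[of k] ginv(3)[OF F[of k]] mat_regroup(2)[of "ginv (F k)" n "1\<^sub>m n" "1\<^sub>m n"]
    by (simp add: mult_diff_cancel_left[of _ n] square_mult_one[of _ n])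
  ultimately show ?thesis by simp
qed

text \<open>
  The direction in which the sequence approaches the scalars is a traceless limit \<open>Y0\<close> of size one. Each
  difference \<open>Y0 - u * Y0 * u\<^sup>-\<^sup>1\<close> is the tangent direction of a sequence of group commutators and has real
  spectrum, so it vanishes by \<open>tangent_zero\<close>; then \<open>Y0\<close> is scalar and traceless, hence zero.
\<close>

lemma no_nonscalar_sequence_to_one:
  assumes F: "\<And>k. F k \<in> G" and lim: "mat_lim n n F (1\<^sub>m n)" and ns: "\<And>k c. F k \<noteq> c \<cdot>\<^sub>m 1\<^sub>m n"
  shows False
proof -
  \<comment> \<open>The traceless parts \<open>X k\<close> are rescaled to size one; dividing by \<open>\<epsilon> k >
    0\<close> is possible because \<open>F k\<close> is not scalar.\<close>
  define c where "c k = mat_trace (F k) / of_nat n" for k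
  define X where "X k = F k - c k \<cdot>\<^sub>m 1\<^sub>m n" for k
  define \<epsilon> where "\<epsilon> k = (\<Sum>i<n. \<Sum>j<n. cmod (X k $$ (i,j)))" for k
  have Xc: "X k \<in> carrier_mat n n" for k unfolding X_def using F by (auto intro: minus_carrier_mat)
  have tr1: "mat_trace (1\<^sub>m n) = of_nat n" unfolding mat_trace_def by simp
  have trX: "mat_trace (X k) = 0" for k
    unfolding X_def using F dim_pos by (simp add: mat_trace_diff[of _ n] mat_trace_smult[of _ n] tr1 c_def)
  have "(\<lambda>k. mat_trace (F k) / of_nat n) \<longlonglongrightarrow> mat_trace (1\<^sub>m n) / of_nat n"
    by (intro tendsto_divide mat_lim_trace[OF lim] tendsto_const) (use dim_pos in auto)
  hence c1: "c \<longlonglongrightarrow> 1" unfolding c_def tr1 using dim_pos by simp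
  have "mat_lim n n X (1\<^sub>m n - 1 \<cdot>\<^sub>m 1\<^sub>m n)"
    unfolding X_def by (intro mat_lim_diff[OF lim] mat_lim_smult[OF c1] mat_lim_const) auto
  moreover have "1\<^sub>m n - 1 \<cdot>\<^sub>m 1\<^sub>m n = (0\<^sub>m n n :: complex mat)" by auto
  ultimately have X0: "mat_lim n n X (0\<^sub>m n n)" by simp
  have "\<epsilon> \<longlonglongrightarrow> (\<Sum>i<n. \<Sum>j<n. 0)"
    unfolding \<epsilon>_def using X0 unfolding mat_lim_def by (intro tendsto_sum tendsto_norm_zero) auto
  hence eps0: "\<epsilon> \<longlonglongrightarrow> 0" by simp
  have entry_le: "cmod (X k $$ (i,j)) \<le> \<epsilon> k" if "i < n" "j < n" for i j k
  proof -
    have "cmod (X k $$ (i,j)) \<le> (\<Sum>j<n. cmod (X k $$ (i,j)))" using that by (intro member_le_sum) auto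
    also have "\<dots> \<le> \<epsilon> k" unfolding \<epsilon>_def using that by (intro member_le_sum[of i "{..<n}" "\<lambda>i. \<Sum>j<n. cmod (X k $$ (i,j))"]) (auto intro: sum_nonneg)
    finally show ?thesis .
  qed
  have eps: "\<epsilon> k > 0" for k
  proof (rule ccontr)
    assume "\<not> \<epsilon> k > 0"
    hence "cmod (X k $$ (i,j)) \<le> 0" if "i < n" "j < n" for i j using entry_le[OF that, of k] by linarith
    hence "X k $$ (i,j) = 0" if "i < n" "j < n" for i j using that by simp
    hence "F k $$ (i,j) = (c k \<cdot>\<^sub>m 1\<^sub>m n) $$ (i,j)" if "i < n" "j < n" for i j
      using that carrier[OF F[of k]] unfolding X_def by auto
    hence "F k = c k \<cdot>\<^sub>m 1\<^sub>m n" using carrier[OF F[of k]] by (intro eq_matI) auto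
    thus False using ns by blast
  qed
  define Y where "Y k = complex_of_real (1 / \<epsilon> k) \<cdot>\<^sub>m X k" for k
  have Yc: "Y k \<in> carrier_mat n n" for k unfolding Y_def using Xc by simp
  have Ye: "cmod (Y k $$ (i,j)) = cmod (X k $$ (i,j)) / \<epsilon> k" if "i < n" "j < n" for i j k
    unfolding Y_def using Xc[of k] that eps[of k] by (simp add: norm_divide)
  have "cmod (Y k $$ (i,j)) \<le> 1" if "i < n" "j < n" for i j k
    using entry_le[OF that, of k] eps[of k] unfolding Ye[OF that] by simp
  then obtain s Y0 where s: "strict_mono s" and Y0: "mat_lim n n (\<lambda>k. Y (s k)) Y0"
    using bounded_mat_convergent_subseq[of Y n n 1] Yc by blast
  have Y0c: "Y0 \<in> carrier_mat n n" using mat_lim_carrier[OF Y0] by simp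
  have "(\<Sum>i<n. \<Sum>j<n. cmod (Y k $$ (i,j))) = 1" for k
    using eps[of k] by (simp add: Ye sum_divide_distrib[symmetric] \<epsilon>_def[symmetric])
  moreover have "(\<lambda>k. \<Sum>i<n. \<Sum>j<n. cmod (Y (s k) $$ (i,j))) \<longlonglongrightarrow> (\<Sum>i<n. \<Sum>j<n. cmod (Y0 $$ (i,j)))"
    using Y0 unfolding mat_lim_def by (intro tendsto_sum tendsto_norm) auto
  ultimately have Y0norm: "(\<Sum>i<n. \<Sum>j<n. cmod (Y0 $$ (i,j))) = 1" by (simp add: LIMSEQ_const_iff)
  have "mat_trace (Y k) = 0" for k unfolding Y_def using mat_trace_smult[OF Xc] trX by simp
  hence trY0: "mat_trace Y0 = 0" using mat_lim_trace[OF Y0] by (simp add: LIMSEQ_const_iff)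
  have s_eps: "(\<lambda>k. \<epsilon> (s k)) \<longlonglongrightarrow> 0" using LIMSEQ_subseq_LIMSEQ[OF eps0 s] by (simp add: o_def)
  have comm: "Y0 * u = u * Y0" if u: "u \<in> G" for u
  proof -
    define Z where "Z = Y0 - u * Y0 * ginv u"
    let ?W = "\<lambda>k. Y (s k) - u * Y (s k) * ginv u"
    have W: "mat_lim n n ?W Z" unfolding Z_def
      by (rule mat_lim_diff[OF Y0 mat_lim_mult[OF mat_lim_mult[OF mat_lim_const[OF carrier[OF u]] Y0] mat_lim_const[OF ginv_carrier[OF u]]]])
    have Wk: "Y k - u * Y k * ginv u = complex_of_real (1 / \<epsilon> k) \<cdot>\<^sub>m (F k - u * F k * ginv u)" for k
    proof -
      have "u * X k * ginv u = u * F k * ginv u - c k \<cdot>\<^sub>m 1\<^sub>m n"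
      proof -
        have "u * X k = u * F k - c k \<cdot>\<^sub>m u"
          unfolding X_def using u F by (simp add: mult_diff_cancel_left[of _ n] mult_smult_distrib[of _ n n _ n] square_mult_one[of _ n])
        hence "u * X k * ginv u = u * F k * ginv u - (c k \<cdot>\<^sub>m u) * ginv u"
          using u F by (simp add: mult_diff_cancel_left[of _ n] mult_carrier_mat[of _ n n])
        thus ?thesis using u ginv(2)[OF u] by (simp add: mult_smult_assoc_mat[of _ n n _ n])
      qed
      hence "X k - u * X k * ginv u = F k - u * F k * ginv u"
        using mat_regroup(1)[of "F k" n "u * F k * ginv u" "c k \<cdot>\<^sub>m 1\<^sub>m n"] conj_carrier[OF u carrier[OF F[of k]]] carrier[OF F[of k]]
        unfolding X_def by simp
      moreover have "Y k - u * Y k * ginv u = complex_of_real (1 / \<epsilon> k) \<cdot>\<^sub>m (X k - u * X k * ginv u)"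
      proof -
        have "u * Y k * ginv u = complex_of_real (1 / \<epsilon> k) \<cdot>\<^sub>m (u * X k * ginv u)"
          unfolding Y_def using Xc[of k] carrier[OF u] ginv_carrier[OF u]
          by (simp add: mult_smult_distrib[of _ n n _ n] mult_smult_assoc_mat[of _ n n _ n] mult_carrier_mat[of _ n n])
        thus ?thesis
          using mat_regroup(4)[OF Xc[of k] conj_carrier[OF u Xc[of k]] Xc[of k]] unfolding Y_def by simp
      qed
      ultimately show ?thesis by simp
    qed
    have real: "has_real_spectrum Z"
      by (rule real_spectrum_limit[OF W]) (unfold Wk, intro has_real_spectrum_smult[of _ n] real_conjugate_difference F u,
        use conj_carrier[OF u carrier[OF F]] in \<open>auto intro!: minus_carrier_mat\<close>)
    \<comment> \<open>Multiplying \<open>F - u * F * u\<^sup>-\<^sup>1\<close> on the right by the inverse of \<open>u * F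
      * u\<^sup>-\<^sup>1\<close>, which tends to \<open>1\<close>, turns it into \<open>h k - 1\<close>.\<close>
    define h where "h k = F (s k) * u * ginv (F (s k)) * ginv u" for k
    have hG: "h k \<in> G" for k unfolding h_def using F u by (intro mult_in_G ginv) auto
    have lim': "mat_lim n n (\<lambda>k. F (s k)) (1\<^sub>m n)" by (rule mat_lim_subseq[OF lim s])
    have R: "mat_lim n n (\<lambda>k. u * ginv (F (s k)) * ginv u) (u * 1\<^sub>m n * ginv u)"
      by (rule mat_lim_mult[OF mat_lim_mult[OF mat_lim_const[OF carrier[OF u]] ginv_limit_one[OF F lim']] mat_lim_const[OF ginv_carrier[OF u]]])
    have "mat_lim n n (\<lambda>k. ?W k * (u * ginv (F (s k)) * ginv u)) (Z * (u * 1\<^sub>m n * ginv u))"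
      by (rule mat_lim_mult[OF W R])
    moreover have "Z * (u * 1\<^sub>m n * ginv u) = Z" using u ginv(2)[OF u] mat_lim_carrier(2)[OF W] by (simp add: square_mult_one[of _ n])
    moreover have "?W k * (u * ginv (F (s k)) * ginv u) = complex_of_real (1 / \<epsilon> (s k)) \<cdot>\<^sub>m (h k - 1\<^sub>m n)" for k
    proof -
      let ?f = "F (s k)"
      note cs = carrier[OF F[of "s k"]] carrier[OF u] ginv_carrier[OF u] ginv_carrier[OF F[of "s k"]]
      have cc: "u * ginv ?f * ginv u \<in> carrier_mat n n" "u * ?f * ginv u \<in> carrier_mat n n" using cs by (auto intro!: mult_carrier_mat)
      have "(u * ?f * ginv u) * (u * ginv ?f * ginv u) = 1\<^sub>m n"
      proof -
        have "(u * ?f * ginv u) * (u * ginv ?f * ginv u) = u * (?f * (ginv u * (u * (ginv ?f * ginv u))))"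
          using cs by (simp add: assoc_mult_mat[of _ n n _ n _ n] mult_carrier_mat[of _ n n])
        also have "ginv u * (u * (ginv ?f * ginv u)) = ginv ?f * ginv u"
          using cs u by (intro ginv_mult_cancel) (auto intro!: mult_carrier_mat)
        also have "?f * (ginv ?f * ginv u) = ginv u" using cs u F by (intro ginv_mult_cancel) auto
        finally show ?thesis using ginv(2)[OF u] by simp
      qed
      moreover have "?f * (u * ginv ?f * ginv u) = h k"
        unfolding h_def using cs by (simp add: assoc_mult_mat[of _ n n _ n _ n] mult_carrier_mat[of _ n n])
      ultimately have "(?f - u * ?f * ginv u) * (u * ginv ?f * ginv u) = h k - 1\<^sub>m n"
        using mult_diff_cancel_left(2)[OF cc(1) cs(1) cc(2)] by simp
      thus ?thesis unfolding Wk using cs cc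
        by (simp add: mult_smult_assoc_mat[of _ n n _ n] minus_carrier_mat)
    qed
    ultimately have "mat_lim n n (\<lambda>k. complex_of_real (1 / \<epsilon> (s k)) \<cdot>\<^sub>m (h k - 1\<^sub>m n)) Z" by simp
    hence "Z = 0\<^sub>m n n" using tangent_zero[where \<epsilon> = "\<lambda>k. \<epsilon> (s k)", OF hG eps s_eps _ real] by simp
    hence "Y0 = u * Y0 * ginv u" unfolding Z_def using mat_regroup(3)[OF Y0c conj_carrier[OF u Y0c] Y0c] by simp
    hence "Y0 * u = u * Y0 * ginv u * u" by simp
    also have "\<dots> = u * Y0" using u Y0c carrier[OF u] by (intro ginv_mult_cancel) (auto intro!: mult_carrier_mat)
    finally show ?thesis .
  qed
  obtain d where d: "Y0 = d \<cdot>\<^sub>m 1\<^sub>m n"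
    using commuting_with_irreducible_scalar[OF irreducible G_carrier dim_pos Y0c comm] by blast
  have "d = 0" using trY0 dim_pos unfolding d by (simp add: mat_trace_smult[of _ n] tr1)
  thus False using Y0norm unfolding d by simp
qed

text \<open>
  In an infinite bounded group the quotients of neighbouring terms of a convergent injective sequence tend to the
  identity without reaching it. They are eventually nonscalar if the scalars are finite in number.
\<close>

lemma finite_if_finitely_many_scalars:
  assumes scal: "finite {c. c \<cdot>\<^sub>m 1\<^sub>m n \<in> G}"
  shows "finite G"
proof (rule ccontr)
  assume "infinite G"
  then obtain f :: "nat \<Rightarrow> complex mat" where f: "inj f" "range f \<subseteq> G" using infinite_countable_subset by blast
  obtain C where C: "\<forall>A\<in>G. \<forall>i<n. \<forall>j<n. cmod (A $$ (i,j)) \<le> C" using bounded by blast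
  have fG: "f k \<in> G" for k using f by auto
  obtain s E where s: "strict_mono s" and E: "mat_lim n n (\<lambda>k. f (s k)) E"
    using bounded_mat_convergent_subseq[of f n n C] fG C by (metis carrier)
  define F where "F k = ginv (f (s k)) * f (s (Suc k))" for k
  have FG: "F k \<in> G" for k unfolding F_def using fG by (intro mult_in_G ginv)
  have Fne: "F k \<noteq> 1\<^sub>m n" for k
  proof
    assume "F k = 1\<^sub>m n"
    hence "f (s k) * F k = f (s k)" using carrier[OF fG] by (simp add: square_mult_one[of _ n])
    moreover have "f (s k) * F k = f (s (Suc k))" unfolding F_def using fG by (intro ginv_mult_cancel) auto
    ultimately have "s (Suc k) = s k" using f(1) by (simp add: inj_def)
    thus False using s by (metis less_irrefl lessI strict_monoD)
  qed
  have z: "E - E = 0\<^sub>m n n" using mat_lim_carrier[OF E] by auto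
  have "mat_lim n n (\<lambda>k. f (s (Suc k)) - f (s k)) (E - E)"
    using mat_lim_diff[OF mat_lim_subseq[OF E, of Suc] E] by (simp add: strict_mono_Suc_iff)
  hence "mat_lim n n (\<lambda>k. ginv (f (s k)) * (f (s (Suc k)) - f (s k))) (0\<^sub>m n n)"
    unfolding z by (rule mat_lim_bounded_mult_null[where C = C, rotated 2]) (use C ginv fG in auto)
  hence "mat_lim n n (\<lambda>k. 1\<^sub>m n + ginv (f (s k)) * (f (s (Suc k)) - f (s k))) (1\<^sub>m n + 0\<^sub>m n n)"
    by (rule mat_lim_add[OF mat_lim_const[OF one_carrier_mat]])
  moreover have "1\<^sub>m n + ginv (f (s k)) * (f (s (Suc k)) - f (s k)) = F k" for k
  proof -
    have "ginv (f (s k)) * (f (s (Suc k)) - f (s k)) = F k - 1\<^sub>m n"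
      unfolding F_def using fG ginv(3)[OF fG] by (simp add: mult_diff_cancel_left[of _ n])
    thus ?thesis using carrier[OF FG[of k]] by auto
  qed
  ultimately have F1: "mat_lim n n F (1\<^sub>m n)" by simp
  let ?K = "{c. c \<cdot>\<^sub>m 1\<^sub>m n \<in> G} - {1}"
  \<comment> \<open>\<open>\<delta>\<close> separates \<open>1\<close> from the other scalars of \<open>G\<close>; the
    inserted \<open>1\<close> keeps the minimum defined if there are none.\<close>
  define \<delta> where "\<delta> = Min (insert 1 (dist 1 ` ?K))"
  have \<delta>: "\<delta> > 0" "\<And>c. c \<in> ?K \<Longrightarrow> \<delta> \<le> dist 1 c" unfolding \<delta>_def using scal by auto
  have "(\<lambda>k. F k $$ (0,0)) \<longlonglongrightarrow> 1" using F1 dim_pos unfolding mat_lim_def by (auto simp: dest!: spec[of _ 0])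
  hence "\<forall>\<^sub>F k in sequentially. dist (F k $$ (0,0)) 1 < \<delta>" using \<delta>(1) by (rule tendstoD)
  then obtain N where N: "\<And>k. k \<ge> N \<Longrightarrow> dist (F k $$ (0,0)) 1 < \<delta>" unfolding eventually_sequentially by blast
  have "F (k + N) \<noteq> c \<cdot>\<^sub>m 1\<^sub>m n" for k c
  proof
    assume e: "F (k + N) = c \<cdot>\<^sub>m 1\<^sub>m n"
    have "c \<noteq> 1" using Fne[of "k + N"] e by auto
    hence "c \<in> ?K" using FG[of "k + N"] e by auto
    moreover have "F (k + N) $$ (0,0) = c" unfolding e using dim_pos by simp
    ultimately show False using N[of "k + N"] \<delta>(2)[of c] by (simp add: dist_commute)
  qed
  thus False using no_nonscalar_sequence_to_one[of "\<lambda>k. F (k + N)"] FG mat_lim_subseq[OF F1, of "\<lambda>k. k + N"]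
    by (auto simp: strict_mono_def)
qed

end

section \<open>Nilpotent commutators in finite irreducible groups\<close>

text \<open>
  For scalar matrices every line is invariant.
\<close>

lemma irreducible_scalars_dim_one:
  assumes irr: "irreducible_matrices n S" and n: "n > 0" and sc: "\<And>M. M \<in> S \<Longrightarrow> \<exists>c. M = c \<cdot>\<^sub>m 1\<^sub>m n"
  shows "n = 1"
proof (rule ccontr)
  assume "n \<noteq> 1"
  hence n2: "1 < n" using n by simp
  let ?e = "unit_vec n 0 :: complex vec"
  let ?W = "{v. \<exists>c. v = c \<cdot>\<^sub>v ?e}"
  have "?W = carrier_vec n"
  proof (rule irreducible_matricesD[OF irr, of _ "1 \<cdot>\<^sub>v ?e"])
    show "x + y \<in> ?W" if xy: "x \<in> ?W" "y \<in> ?W" for x y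
    proof -
      from xy obtain c d where "x = c \<cdot>\<^sub>v ?e" "y = d \<cdot>\<^sub>v ?e" by blast
      hence "x + y = (c + d) \<cdot>\<^sub>v ?e" by (simp add: add_smult_distrib_vec)
      thus ?thesis by blast
    qed
    show "c \<cdot>\<^sub>v x \<in> ?W" if "x \<in> ?W" for c x using that by (auto simp: smult_smult_assoc)
    show "M *\<^sub>v x \<in> ?W" if M: "M \<in> S" and x: "x \<in> ?W" for M x
    proof -
      obtain c where c: "M = c \<cdot>\<^sub>m 1\<^sub>m n" using sc[OF M] by blast
      obtain d where d: "x = d \<cdot>\<^sub>v ?e" using x by blast
      have "M *\<^sub>v x = (c * d) \<cdot>\<^sub>v ?e" unfolding c d by (subst smult_one_mult_vec) (auto simp: smult_smult_assoc)
      thus ?thesis by blast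
    qed
    have "(1 \<cdot>\<^sub>v ?e) $ 0 = 1" using n by simp
    moreover have "0\<^sub>v n $ 0 = (0 :: complex)" using n by simp
    ultimately show "1 \<cdot>\<^sub>v ?e \<noteq> 0\<^sub>v n" by (metis zero_neq_one)
    show "?W \<subseteq> carrier_vec n" by auto
    show "1 \<cdot>\<^sub>v ?e \<in> ?W" by blast
  qed
  hence "unit_vec n 1 \<in> ?W" using unit_vec_carrier[of n 1] by blast
  then obtain c where c: "unit_vec n 1 = c \<cdot>\<^sub>v ?e" by blast
  have "(unit_vec n 1 :: complex vec) $ 1 = 1" "(c \<cdot>\<^sub>v ?e) $ 1 = 0" using n2 by auto
  thus False unfolding c by simp
qed

context matrix_group
begin

definition as_group :: "complex mat monoid" where
  "as_group = \<lparr>carrier = G, mult = (*), one = 1\<^sub>m n\<rparr>"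

lemma as_group_simps [simp]:
  "carrier as_group = G" "x \<otimes>\<^bsub>as_group\<^esub> y = x * y" "\<one>\<^bsub>as_group\<^esub> = 1\<^sub>m n"
  unfolding as_group_def by auto

lemma group_as_group: "group as_group"
proof (rule groupI)
  show "x \<otimes>\<^bsub>as_group\<^esub> y \<otimes>\<^bsub>as_group\<^esub> z = x \<otimes>\<^bsub>as_group\<^esub> (y \<otimes>\<^bsub>as_group\<^esub> z)"
    if "x \<in> carrier as_group" "y \<in> carrier as_group" "z \<in> carrier as_group" for x y z
    using that by (simp add: assoc_mult_mat[of _ n n _ n _ n])
  show "\<exists>y\<in>carrier as_group. y \<otimes>\<^bsub>as_group\<^esub> x = \<one>\<^bsub>as_group\<^esub>" if "x \<in> carrier as_group" for x
    using that ginv[of x] by auto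
qed (auto simp: one_in_G mult_in_G square_mult_one[of _ n])

lemma inv_as_group: "x \<in> G \<Longrightarrow> inv\<^bsub>as_group\<^esub> x = ginv x"
  using group.inv_equality[OF group_as_group, of "ginv x" x] ginv[of x] by simp

lemma pow_as_group: "x \<in> G \<Longrightarrow> x [^]\<^bsub>as_group\<^esub> (k::nat) = x ^\<^sub>m k"
proof (induction k)
  case 0
  have "dim_row x = n" using carrier[OF 0] by auto
  thus ?case by (simp add: nat_pow_def)
next
  case (Suc k)
  thus ?case by (simp add: nat_pow_def)
qed

lemma finite_exponent:
  assumes "finite G"
  obtains m where "m > 0" "\<And>x. x \<in> G \<Longrightarrow> x ^\<^sub>m m = 1\<^sub>m n"
proof (rule that[of "card G"])
  show "card G > 0" using assms one_in_G card_gt_0_iff by blast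
  show "x ^\<^sub>m card G = 1\<^sub>m n" if "x \<in> G" for x
    using group.pow_order_eq_1[OF group_as_group, of x] that pow_as_group[OF that] by (simp add: order_def)
qed

text \<open>
  For commuting \<open>A\<close> and \<open>C\<close> with nilpotent difference the quotient \<open>C\<^sup>-\<^sup>1 A\<close> is unipotent, and a unipotent
  matrix of finite order is the identity.
\<close>

lemma commuting_conjugate_unique:
  assumes fin: "finite G" and A: "A \<in> G" and C: "C \<in> G" and comm: "A * C = C * A"
    and spec: "spectrum (A - C) \<subseteq> {0}"
  shows "A = C"
proof (rule ccontr)
  assume ne: "A \<noteq> C"
  note cs = carrier[OF A] carrier[OF C] ginv_carrier[OF C]
  let ?N = "A - C"
  have N: "?N \<in> carrier_mat n n" using cs by (auto intro: minus_carrier_mat)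
  have "?N \<noteq> 0\<^sub>m n n" using mat_regroup(3)[OF cs(1,2) cs(1)] ne by blast
  then obtain v where v: "v \<in> carrier_vec n" "?N *\<^sub>v v \<noteq> 0\<^sub>v n" "?N *\<^sub>v (?N *\<^sub>v v) = 0\<^sub>v n"
    using nilpotent_square_zero_vector[OF N nilpotent_of_zero_spectrum[OF N spec]] by blast
  define w where "w = ?N *\<^sub>v v"
  have w: "w \<in> carrier_vec n" "w \<noteq> 0\<^sub>v n" "?N *\<^sub>v w = 0\<^sub>v n" using v N unfolding w_def by auto
  have Nx: "?N *\<^sub>v x = A *\<^sub>v x - C *\<^sub>v x" if "x \<in> carrier_vec n" for x
    using cs that by (simp add: minus_mult_distrib_mat_vec[of _ n n])
  have Av: "A *\<^sub>v v = C *\<^sub>v v + w" unfolding w_def Nx[OF v(1)] using cs v(1) by auto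
  have Aw: "A *\<^sub>v w = C *\<^sub>v w"
  proof (rule eq_vecI)
    fix i assume i: "i < dim_vec (C *\<^sub>v w)"
    hence i: "i < n" using cs by simp
    have "(A *\<^sub>v w - C *\<^sub>v w) $ i = 0" using w(3) i unfolding Nx[OF w(1)] by simp
    moreover have "(A *\<^sub>v w - C *\<^sub>v w) $ i = (A *\<^sub>v w) $ i - (C *\<^sub>v w) $ i" by (rule index_minus_vec) (use i cs in simp)
    ultimately show "(A *\<^sub>v w) $ i = (C *\<^sub>v w) $ i" by simp
  qed (use cs in auto)
  \<comment> \<open>\<open>Q\<close> fixes \<open>w'\<close> and adds \<open>w'\<close> to \<open>v\<close>, so
    \<open>Q\<^sup>k\<close> adds \<open>k w'\<close> and never returns to the identity.\<close>
  define Q where "Q = ginv C * A"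
  define w' where "w' = ginv C *\<^sub>v w"
  have Q: "Q \<in> G" unfolding Q_def using A C by (intro mult_in_G ginv)
  have w'c: "w' \<in> carrier_vec n" unfolding w'_def using cs w by auto
  have Cw': "C *\<^sub>v w' = w" unfolding w'_def using assoc_mult_mat_vec[OF cs(2,3) w(1)] w(1) unfolding ginv(2)[OF C] by simp
  have w'0: "w' \<noteq> 0\<^sub>v n" using Cw' w(2) mult_mat_zero_vec[OF cs(2)] by metis
  have Qv: "Q *\<^sub>v v = v + w'"
  proof -
    have "Q *\<^sub>v v = ginv C *\<^sub>v (C *\<^sub>v v + w)" unfolding Q_def Av[symmetric] using cs v(1) by (simp add: assoc_mult_mat_vec[of _ n n _ n])
    also have "\<dots> = ginv C *\<^sub>v (C *\<^sub>v v) + w'" unfolding w'_def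
      by (rule mult_add_distrib_mat_vec[OF cs(3) mult_mat_vec_carrier[OF cs(2) v(1)] w(1)])
    finally show ?thesis using ginv_mult_vec[OF C v(1)] by simp
  qed
  have comm': "ginv C * A = A * ginv C"
  proof -
    have "ginv C * A = ginv C * (A * C) * ginv C" using cs C by (simp add: assoc_mult_mat[of _ n n _ n _ n] ginv(2) mult_carrier_mat[of _ n n] square_mult_one[of _ n])
    also have "\<dots> = A * ginv C" unfolding comm using cs C by (simp add: ginv_mult_cancel)
    finally show ?thesis .
  qed
  have Qw': "Q *\<^sub>v w' = w'"
  proof -
    have "Q *\<^sub>v w' = ginv C *\<^sub>v (A *\<^sub>v (ginv C *\<^sub>v w))" unfolding Q_def w'_def using cs w by (simp add: assoc_mult_mat_vec[of _ n n _ n])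
    also have "A *\<^sub>v (ginv C *\<^sub>v w) = ginv C *\<^sub>v (A *\<^sub>v w)"
      using assoc_mult_mat_vec[OF cs(1,3) w(1)] assoc_mult_mat_vec[OF cs(3,1) w(1)] unfolding comm' by metis
    also have "\<dots> = w" unfolding Aw by (rule ginv_mult_vec[OF C w(1)])
    finally show ?thesis unfolding w'_def .
  qed
  have Qk: "Q ^\<^sub>m k *\<^sub>v w' = w' \<and> Q ^\<^sub>m k *\<^sub>v v = v + of_nat k \<cdot>\<^sub>v w'" for k
  proof (induction k)
    case 0
    thus ?case using carrier[OF Q] v(1) w'c by auto
  next
    case (Suc k)
    have Qkc: "Q ^\<^sub>m k \<in> carrier_mat n n" using carrier[OF Q] by simp
    have 1: "Q ^\<^sub>m Suc k *\<^sub>v x = Q ^\<^sub>m k *\<^sub>v (Q *\<^sub>v x)" if "x \<in> carrier_vec n" for x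
      using Qkc carrier[OF Q] that by (simp add: assoc_mult_mat_vec[of _ n n _ n])
    have "Q ^\<^sub>m Suc k *\<^sub>v v = Q ^\<^sub>m k *\<^sub>v v + Q ^\<^sub>m k *\<^sub>v w'"
      unfolding 1[OF v(1)] Qv by (rule mult_add_distrib_mat_vec[OF Qkc v(1) w'c])
    also have "\<dots> = (v + of_nat k \<cdot>\<^sub>v w') + w'" using Suc by simp
    also have "\<dots> = v + of_nat (Suc k) \<cdot>\<^sub>v w'" using v(1) w'c by (intro eq_vecI) (auto simp: algebra_simps)
    finally show ?case using Suc unfolding 1[OF w'c] Qw' by simp
  qed
  obtain m where m: "m > 0" "Q ^\<^sub>m m = 1\<^sub>m n" using finite_exponent[OF fin] Q by metis
  have e: "v + of_nat m \<cdot>\<^sub>v w' = v" using Qk[of m, THEN conjunct2] one_mult_mat_vec[OF v(1)] unfolding m(2) by metis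
  have "of_nat m \<cdot>\<^sub>v w' = 0\<^sub>v n"
  proof (rule eq_vecI)
    fix i assume "i < dim_vec (0\<^sub>v n :: complex vec)"
    hence i: "i < n" by simp
    have "(v + of_nat m \<cdot>\<^sub>v w') $ i = v $ i + (of_nat m \<cdot>\<^sub>v w') $ i" by (rule index_add_vec(1)) (use i w'c in simp)
    thus "(of_nat m \<cdot>\<^sub>v w') $ i = 0\<^sub>v n $ i" using i unfolding e by simp
  qed (use w'c in simp)
  hence "(of_nat m :: complex) = 0" by (rule smult_vec_eq_zeroD[OF _ w'c w'0])
  thus False using m(1) by simp
qed

text \<open>
  The difference \<open>a - b * a * b\<^sup>-\<^sup>1\<close> is a commutator, hence nilpotent; if its two terms commute, they are equal
  by \<open>commuting_conjugate_unique\<close>. So the group is abelian, and by Schur's lemma it consists of scalars.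
\<close>

lemma nilpotent_commutators_dim_one:
  assumes fin: "finite G" and n: "n > 0" and irr: "irreducible_matrices n G"
    and nil: "\<And>A B. A \<in> G \<Longrightarrow> B \<in> G \<Longrightarrow> spectrum (A * B - B * A) \<subseteq> {0}"
  shows "n = 1"
proof -
  have "\<forall>x\<in>carrier as_group. \<forall>y\<in>carrier as_group. x \<otimes>\<^bsub>as_group\<^esub> y = y \<otimes>\<^bsub>as_group\<^esub> x"
  proof (rule abelian_if_commuting_conjugates[OF group_as_group])
    show "finite (carrier as_group)" using fin by simp
    fix a b assume "a \<in> carrier as_group" "b \<in> carrier as_group"
      and "a \<otimes>\<^bsub>as_group\<^esub> (b \<otimes>\<^bsub>as_group\<^esub> a \<otimes>\<^bsub>as_group\<^esub> inv\<^bsub>as_group\<^esub> b) = b \<otimes>\<^bsub>as_group\<^esub> a \<otimes>\<^bsub>as_group\<^esub> inv\<^bsub>as_group\<^esub> b \<otimes>\<^bsub>as_group\<^esub> a"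
    hence a: "a \<in> G" and b: "b \<in> G" and e: "a * (b * a * ginv b) = (b * a * ginv b) * a" by (auto simp: inv_as_group)
    have "a - b * a * ginv b = (a * ginv b) * b - b * (a * ginv b)"
      using a b ginv_mult_cancel(3)[of b a] assoc_mult_mat[of b n n a n "ginv b" n] by simp
    hence "spectrum (a - b * a * ginv b) \<subseteq> {0}" using nil[of "a * ginv b" b] a b by (simp add: mult_in_G ginv)
    hence "a = b * a * ginv b"
      using commuting_conjugate_unique[OF fin a mult_in_G[OF mult_in_G[OF b a] ginv(1)[OF b]] e] by blast
    hence "a * b = b * a * ginv b * b" by (rule arg_cong)
    also have "\<dots> = b * a" using a b mult_in_G[OF b a] by (intro ginv_mult_cancel) auto
    finally show "a \<otimes>\<^bsub>as_group\<^esub> b = b \<otimes>\<^bsub>as_group\<^esub> a" by simp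
  qed
  hence comm: "A * B = B * A" if "A \<in> G" "B \<in> G" for A B using that by simp
  show ?thesis
  proof (rule irreducible_scalars_dim_one[OF irr n])
    fix M assume M: "M \<in> G"
    show "\<exists>c. M = c \<cdot>\<^sub>m 1\<^sub>m n"
      using commuting_with_irreducible_scalar[OF irr G_carrier n carrier[OF M] comm[OF M]] by metis
  qed
qed

end

lemma smult_mult_smult:
  fixes A B :: "complex mat"
  assumes "A \<in> carrier_mat n n" "B \<in> carrier_mat n n"
  shows "(c \<cdot>\<^sub>m A) * (d \<cdot>\<^sub>m B) = (c * d) \<cdot>\<^sub>m (A * B)"
proof -
  have "(c \<cdot>\<^sub>m A) * (d \<cdot>\<^sub>m B) = c \<cdot>\<^sub>m (A * (d \<cdot>\<^sub>m B))"
    using assms by (intro mult_smult_assoc_mat[of _ n n _ n]) auto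
  also have "A * (d \<cdot>\<^sub>m B) = d \<cdot>\<^sub>m (A * B)" using assms by (intro mult_smult_distrib)
  also have "c \<cdot>\<^sub>m (d \<cdot>\<^sub>m (A * B)) = (c * d) \<cdot>\<^sub>m (A * B)" using assms by (intro eq_matI) auto
  finally show ?thesis .
qed

context real_commutator_group
begin

text \<open>
  With \<open>c\<close> in the group, \<open>c\<close> times a commutator is a commutator, so every eigenvalue \<open>e\<close> of a commutator is
  real together with \<open>c * e\<close>, and commutators are nilpotent. Scalars may be plentiful in \<open>G\<close>, so the
  determinants are normalized to one first: this leaves only roots of unity as scalars, hence a finite group.
\<close>

lemma nonreal_scalar_dim_one:
  assumes unimod: "\<And>A. A \<in> G \<Longrightarrow> cmod (det A) = 1" and c: "c \<cdot>\<^sub>m 1\<^sub>m n \<in> G" "c \<notin> \<real>"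
  shows "n = 1"
proof -
  have nil: "spectrum (A * B - B * A) \<subseteq> {0}" if A: "A \<in> G" and B: "B \<in> G" for A B
  proof
    fix e assume e: "e \<in> spectrum (A * B - B * A)"
    have K: "A * B - B * A \<in> carrier_mat n n" using A B by (auto intro!: minus_carrier_mat mult_carrier_mat[of _ n n])
    have "(c \<cdot>\<^sub>m 1\<^sub>m n) * A = c \<cdot>\<^sub>m A" using A by (simp add: mult_smult_assoc_mat[of _ n n _ n] square_mult_one[of _ n])
    hence cA: "c \<cdot>\<^sub>m A \<in> G" using mult_in_G[OF c(1) A] by simp
    have "(c \<cdot>\<^sub>m A) * B - B * (c \<cdot>\<^sub>m A) = c \<cdot>\<^sub>m (A * B - B * A)"
      using A B mat_regroup(4)[of "A * B" n "B * A" "A * B" c] mult_in_G[OF A B] mult_in_G[OF B A]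
      by (simp add: mult_smult_assoc_mat[of _ n n _ n] mult_smult_distrib[of _ n n _ n])
    hence "has_real_spectrum (c \<cdot>\<^sub>m (A * B - B * A))" using real_commutator[OF cA B] by simp
    hence "c * e \<in> \<real>" using spectrum_smult[OF K e, of c] unfolding has_real_spectrum_def by blast
    moreover have "e \<in> \<real>" using real_commutator[OF A B] e unfolding has_real_spectrum_def by blast
    ultimately have "e \<noteq> 0 \<Longrightarrow> c * e / e \<in> \<real>" by (intro Reals_divide)
    thus "e \<in> {0}" using c(2) by auto
  qed
  define G1 where "G1 = {M \<in> carrier_mat n n. det M = 1 \<and> (\<exists>d. d \<noteq> 0 \<and> d \<cdot>\<^sub>m M \<in> G)}"
  have nil1: "spectrum (A * B - B * A) \<subseteq> {0}" if "A \<in> G1" "B \<in> G1" for A B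
  proof
    fix e assume e: "e \<in> spectrum (A * B - B * A)"
    from that obtain d d' where d: "A \<in> carrier_mat n n" "B \<in> carrier_mat n n" "d \<noteq> 0" "d' \<noteq> 0" "d \<cdot>\<^sub>m A \<in> G" "d' \<cdot>\<^sub>m B \<in> G"
      unfolding G1_def by blast
    have K: "A * B - B * A \<in> carrier_mat n n" using d by (auto intro!: minus_carrier_mat mult_carrier_mat[of _ n n])
    have "(d \<cdot>\<^sub>m A) * (d' \<cdot>\<^sub>m B) - (d' \<cdot>\<^sub>m B) * (d \<cdot>\<^sub>m A) = (d * d') \<cdot>\<^sub>m (A * B - B * A)"
      using d mat_regroup(4)[of "A * B" n "B * A" "A * B" "d * d'"] by (simp add: smult_mult_smult[of _ n] mult.commute mult_carrier_mat[of _ n n])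
    hence "(d * d') * e \<in> {0}" using nil[OF d(5,6)] spectrum_smult[OF K e, of "d * d'"] by auto
    thus "e \<in> {0}" using d by auto
  qed
  interpret G1: real_commutator_group n G1
  proof
    show "G1 \<subseteq> carrier_mat n n" unfolding G1_def by auto
    have "1 \<cdot>\<^sub>m 1\<^sub>m n = (1\<^sub>m n :: complex mat)" by auto
    hence "\<exists>d :: complex. d \<noteq> 0 \<and> d \<cdot>\<^sub>m 1\<^sub>m n \<in> G" using one_in_G by (intro exI[of _ 1]) auto
    thus "1\<^sub>m n \<in> G1" unfolding G1_def by simp
    show "A * B \<in> G1" if "A \<in> G1" "B \<in> G1" for A B
    proof -
      from that obtain d d' where d: "A \<in> carrier_mat n n" "B \<in> carrier_mat n n" "d \<noteq> 0" "d' \<noteq> 0" "d \<cdot>\<^sub>m A \<in> G" "d' \<cdot>\<^sub>m B \<in> G"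
         "det A = 1" "det B = 1" unfolding G1_def by blast
      have "(d * d') \<cdot>\<^sub>m (A * B) \<in> G" using mult_in_G[OF d(5,6)] d by (simp add: smult_mult_smult[of _ n])
      moreover have "d * d' \<noteq> 0" using d by simp
      ultimately have "\<exists>d. d \<noteq> 0 \<and> d \<cdot>\<^sub>m (A * B) \<in> G" by blast
      moreover have "det (A * B) = 1" using d by (simp add: det_mult[of _ n])
      ultimately show ?thesis unfolding G1_def using d by (auto intro!: mult_carrier_mat[of _ n n])
    qed
    show "\<exists>B\<in>G1. A * B = 1\<^sub>m n \<and> B * A = 1\<^sub>m n" if "A \<in> G1" for A
    proof -
      from that obtain d where d: "A \<in> carrier_mat n n" "d \<noteq> 0" "d \<cdot>\<^sub>m A \<in> G" "det A = 1" unfolding G1_def by blast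
      let ?B = "d \<cdot>\<^sub>m ginv (d \<cdot>\<^sub>m A)"
      have gc: "ginv (d \<cdot>\<^sub>m A) \<in> carrier_mat n n" using d by simp
      have AB: "A * ?B = 1\<^sub>m n" "?B * A = 1\<^sub>m n"
        using ginv(2,3)[OF d(3)] d(1) gc by (simp_all add: mult_smult_assoc_mat[of _ n n _ n] mult_smult_distrib[of _ n n _ n])
      have "det (A * ?B) = det A * det ?B" using d gc by (intro det_mult) auto
      hence "det ?B = 1" unfolding AB d(4) by simp
      moreover have "inverse d \<cdot>\<^sub>m ?B = ginv (d \<cdot>\<^sub>m A)" using d gc by (intro eq_matI) auto
      hence "\<exists>e. e \<noteq> 0 \<and> e \<cdot>\<^sub>m ?B \<in> G" using ginv(1)[OF d(3)] d(2) by (intro exI[of _ "inverse d"]) auto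
      ultimately have "?B \<in> G1" unfolding G1_def using gc by auto
      thus ?thesis using AB by blast
    qed
    show "n > 0" by (rule dim_pos)
    show "irreducible_matrices n G1"
      unfolding irreducible_matrices_def
    proof (intro allI impI)
      fix W assume W: "invariant_subspace n G1 W"
      have "invariant_subspace n G W"
        unfolding invariant_subspace_iff
      proof (intro conjI ballI allI)
        fix A w assume A: "A \<in> G" and w: "w \<in> W"
        have det: "det A \<noteq> 0" using unimod[OF A] by auto
        \<comment> \<open>Each member of \<open>G\<close> is a scalar multiple of a member of \<open>G1\<close>, so both have
          the same invariant subspaces.\<close>
        obtain d where d: "d ^ n = det A"
        proof -
          have "card {z. z ^ n = det A} > 0" using card_nth_roots[OF det dim_pos] dim_pos by simp
          hence "{z. z ^ n = det A} \<noteq> {}" by (metis card.empty less_irrefl)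
          thus thesis using that by blast
        qed
        have d0: "d \<noteq> 0" using d det dim_pos by (auto simp: power_0_left)
        let ?M = "inverse d \<cdot>\<^sub>m A"
        have "det ?M = 1" using carrier[OF A] d0 d det by (simp add: power_inverse)
        moreover have "d \<cdot>\<^sub>m ?M = A" using d0 by (intro eq_matI) auto
        ultimately have M: "?M \<in> G1" unfolding G1_def using A d0 by auto
        have wc: "w \<in> carrier_vec n" using W w unfolding invariant_subspace_iff by auto
        have "A *\<^sub>v w = d \<cdot>\<^sub>v (?M *\<^sub>v w)"
          using smult_mult_mat_vec[of ?M n n w d] carrier[OF A] wc unfolding \<open>d \<cdot>\<^sub>m ?M = A\<close> by simp
        moreover have "?M *\<^sub>v w \<in> W" using W M w unfolding invariant_subspace_iff by blast
        ultimately show "A *\<^sub>v w \<in> W" using W unfolding invariant_subspace_iff by simp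
      qed (use W[unfolded invariant_subspace_iff] in blast)+
      thus "W = {0\<^sub>v n} \<or> W = carrier_vec n" using irreducible unfolding irreducible_matrices_def by blast
    qed
    obtain C where C: "\<forall>A\<in>G. \<forall>i<n. \<forall>j<n. cmod (A $$ (i,j)) \<le> C" using bounded by blast
    show "\<exists>C. \<forall>A\<in>G1. \<forall>i<n. \<forall>j<n. cmod (A $$ (i,j)) \<le> C"
    proof (intro exI[of _ C] ballI allI impI)
      fix A i j assume "A \<in> G1" and ij: "i < n" "j < n"
      then obtain d where d: "A \<in> carrier_mat n n" "d \<noteq> 0" "d \<cdot>\<^sub>m A \<in> G" "det A = 1" unfolding G1_def by blast
      have "cmod d ^ n = 1" using unimod[OF d(3)] d(1,4) by (simp add: norm_power)
      hence "cmod d = 1" using power_eq_imp_eq_base[of "cmod d" n 1] dim_pos by simp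
      moreover have "cmod ((d \<cdot>\<^sub>m A) $$ (i,j)) \<le> C" using C d(3) ij by blast
      ultimately show "cmod (A $$ (i,j)) \<le> C" using d(1) ij by (simp add: norm_mult)
    qed
    show "has_real_spectrum (A * B - B * A)" if "A \<in> G1" "B \<in> G1" for A B
      using nil1[OF that] unfolding has_real_spectrum_def by auto
  qed
  have "c ^ n = 1" if "c \<cdot>\<^sub>m 1\<^sub>m n \<in> G1" for c
  proof -
    have "det (c \<cdot>\<^sub>m 1\<^sub>m n) = 1" using that unfolding G1_def by blast
    thus ?thesis by simp
  qed
  hence "{c. c \<cdot>\<^sub>m 1\<^sub>m n \<in> G1} \<subseteq> {z. z ^ n = 1}" by blast
  hence "finite {c. c \<cdot>\<^sub>m 1\<^sub>m n \<in> G1}" using finite_nth_roots[OF dim_pos, of 1] finite_subset by blast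
  hence "finite G1" by (rule G1.finite_if_finitely_many_scalars)
  thus ?thesis by (rule G1.nilpotent_commutators_dim_one[OF _ dim_pos G1.irreducible nil1])
qed

text \<open>
  Real scalars with determinant of modulus one are \<open>1\<close> and \<open>-1\<close>.
\<close>

lemma finite_if_real_scalars:
  assumes unimod: "\<And>A. A \<in> G \<Longrightarrow> cmod (det A) = 1" and real: "\<And>c. c \<cdot>\<^sub>m 1\<^sub>m n \<in> G \<Longrightarrow> c \<in> \<real>"
  shows "finite G"
proof -
  have "c \<in> {1, -1}" if c: "c \<cdot>\<^sub>m 1\<^sub>m n \<in> G" for c
  proof -
    obtain x where x: "c = complex_of_real x" using Reals_cases[OF real[OF c]] by metis
    have "cmod c ^ n = 1" using unimod[OF c] by (simp add: norm_power)
    hence "cmod c = 1" using power_eq_imp_eq_base[of "cmod c" n 1] dim_pos by simp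
    hence "\<bar>x\<bar> = 1" unfolding x norm_of_real .
    hence "x = 1 \<or> x = -1" by linarith
    thus ?thesis unfolding x by auto
  qed
  hence "{c. c \<cdot>\<^sub>m 1\<^sub>m n \<in> G} \<subseteq> {1, -1}" by blast
  hence "finite {c. c \<cdot>\<^sub>m 1\<^sub>m n \<in> G}" by (rule finite_subset) simp
  thus ?thesis by (rule finite_if_finitely_many_scalars)
qed

end

section \<open>Real forms invariant under finite irreducible groups\<close>

text \<open>
  A nonzero real subspace that contains no complex line. For an irreducible set of matrices leaving it invariant
  its complex span is everything, so that it is a real form of \<open>\<complex>\<^sup>n\<close> in the usual sense.
\<close>

definition real_form :: "nat \<Rightarrow> complex vec set \<Rightarrow> bool" where
  "real_form n W \<longleftrightarrow> W \<subseteq> carrier_vec n \<and>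
     (\<forall>x\<in>W. \<forall>y\<in>W. x + y \<in> W) \<and> (\<forall>c. \<forall>x\<in>W. complex_of_real c \<cdot>\<^sub>v x \<in> W) \<and>
     (\<forall>x\<in>W. \<i> \<cdot>\<^sub>v x \<in> W \<longrightarrow> x = 0\<^sub>v n) \<and> (\<exists>x\<in>W. x \<noteq> 0\<^sub>v n)"

abbreviation (input) cnj_vec :: "complex vec \<Rightarrow> complex vec" where "cnj_vec \<equiv> map_vec cnj"
abbreviation (input) cnj_mat :: "complex mat \<Rightarrow> complex mat" where "cnj_mat \<equiv> map_mat cnj"

lemma cnj_mat_mult_vec:
  assumes "A \<in> carrier_mat nr nc" "v \<in> carrier_vec nc"
  shows "cnj_vec (A *\<^sub>v v) = cnj_mat A *\<^sub>v cnj_vec v"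
  using assms by (intro eq_vecI) (auto simp: scalar_prod_def cnj_sum)

lemma cnj_mat_mult:
  assumes "A \<in> carrier_mat nr m" "B \<in> carrier_mat m nc"
  shows "cnj_mat (A * B) = cnj_mat A * cnj_mat B"
  using assms by (intro eq_matI) (auto simp: scalar_prod_def cnj_sum)

lemma cnj_vec_cnj_vec: "cnj_vec (cnj_vec v) = v"
  by (intro eq_vecI) auto

lemma cnj_scalar_prod:
  assumes "v \<in> carrier_vec m" "w \<in> carrier_vec m"
  shows "cnj_vec v \<bullet> cnj_vec w = cnj (v \<bullet> w)"
  using assms by (auto simp: scalar_prod_def cnj_sum)

lemma nonzero_mat_entry:
  fixes B :: "complex mat"
  assumes "B \<in> carrier_mat n m" "B \<noteq> 0\<^sub>m n m"
  obtains i j where "i < n" "j < m" "B $$ (i,j) \<noteq> 0"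
proof -
  have "\<not> (\<forall>i<n. \<forall>j<m. B $$ (i,j) = 0)"
  proof
    assume "\<forall>i<n. \<forall>j<m. B $$ (i,j) = 0"
    hence "B = 0\<^sub>m n m" using assms(1) by (intro eq_matI) auto
    thus False using assms(2) by simp
  qed
  thus thesis using that by blast
qed

context matrix_group
begin

definition gsum :: "(complex mat \<Rightarrow> complex mat) \<Rightarrow> complex mat" where
  "gsum f = mat n n (\<lambda>p. \<Sum>u\<in>G. f u $$ p)"

lemma gsum_carrier [simp]: "gsum f \<in> carrier_mat n n" unfolding gsum_def by simp

lemma gsum_cong: "(\<And>u. u \<in> G \<Longrightarrow> f u = g u) \<Longrightarrow> gsum f = gsum g"
  unfolding gsum_def by (intro eq_matI) (auto intro: sum.cong)

lemma mult_gsum: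
  assumes "A \<in> carrier_mat n n" "\<And>u. u \<in> G \<Longrightarrow> f u \<in> carrier_mat n n"
  shows "A * gsum f = gsum (\<lambda>u. A * f u)"
proof (rule eq_matI)
  fix i j assume "i < dim_row (gsum (\<lambda>u. A * f u))" "j < dim_col (gsum (\<lambda>u. A * f u))"
  hence ij: "i < n" "j < n" unfolding gsum_def by auto
  have "(A * gsum f) $$ (i,j) = (\<Sum>l<n. A $$ (i,l) * (\<Sum>u\<in>G. f u $$ (l,j)))"
    using ij assms(1) unfolding gsum_def by (simp add: scalar_prod_def atLeast0LessThan)
  also have "\<dots> = (\<Sum>u\<in>G. \<Sum>l<n. A $$ (i,l) * f u $$ (l,j))" by (simp add: sum_distrib_left) (rule sum.swap)
  also have "\<dots> = (\<Sum>u\<in>G. (A * f u) $$ (i,j))"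
  proof (rule sum.cong)
    fix u assume u: "u \<in> G"
    show "(\<Sum>l<n. A $$ (i,l) * f u $$ (l,j)) = (A * f u) $$ (i,j)"
      using assms(2)[OF u] assms(1) ij by (simp add: scalar_prod_def atLeast0LessThan)
  qed simp
  finally show "(A * gsum f) $$ (i,j) = gsum (\<lambda>u. A * f u) $$ (i,j)" using ij unfolding gsum_def by simp
qed (use assms gsum_def in auto)

lemma gsum_mult:
  assumes "A \<in> carrier_mat n n" "\<And>u. u \<in> G \<Longrightarrow> f u \<in> carrier_mat n n"
  shows "gsum f * A = gsum (\<lambda>u. f u * A)"
proof (rule eq_matI)
  fix i j assume "i < dim_row (gsum (\<lambda>u. f u * A))" "j < dim_col (gsum (\<lambda>u. f u * A))"
  hence ij: "i < n" "j < n" unfolding gsum_def by auto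
  have "(gsum f * A) $$ (i,j) = (\<Sum>l<n. (\<Sum>u\<in>G. f u $$ (i,l)) * A $$ (l,j))"
    using ij assms(1) unfolding gsum_def by (simp add: scalar_prod_def atLeast0LessThan)
  also have "\<dots> = (\<Sum>u\<in>G. \<Sum>l<n. f u $$ (i,l) * A $$ (l,j))" by (simp add: sum_distrib_right) (rule sum.swap)
  also have "\<dots> = (\<Sum>u\<in>G. (f u * A) $$ (i,j))"
  proof (rule sum.cong)
    fix u assume u: "u \<in> G"
    show "(\<Sum>l<n. f u $$ (i,l) * A $$ (l,j)) = (f u * A) $$ (i,j)"
      using assms(2)[OF u] assms(1) ij by (simp add: scalar_prod_def atLeast0LessThan)
  qed simp
  finally show "(gsum f * A) $$ (i,j) = gsum (\<lambda>u. f u * A) $$ (i,j)" using ij unfolding gsum_def by simp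
qed (use assms gsum_def in auto)

lemma gsum_shift_left:
  assumes "A \<in> G"
  shows "gsum (\<lambda>u. f (A * u)) = gsum f"
proof -
  have "bij_betw (\<lambda>u. A * u) G G"
    by (rule bij_betw_byWitness[where f' = "\<lambda>u. ginv A * u"]) (use assms ginv[OF assms] in \<open>auto simp: ginv_mult_cancel mult_in_G\<close>)
  hence "(\<Sum>u\<in>G. f (A * u) $$ p) = (\<Sum>u\<in>G. f u $$ p)" for p
    by (rule sum.reindex_bij_betw[where g = "\<lambda>u. f u $$ p"])
  thus ?thesis unfolding gsum_def by simp
qed

lemma gsum_shift_right:
  assumes "A \<in> G"
  shows "gsum (\<lambda>u. f (u * A)) = gsum f"
proof -
  have "bij_betw (\<lambda>u. u * A) G G"
    by (rule bij_betw_byWitness[where f' = "\<lambda>u. u * ginv A"]) (use assms ginv[OF assms] in \<open>auto simp: ginv_mult_cancel mult_in_G\<close>)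
  hence "(\<Sum>u\<in>G. f (u * A) $$ p) = (\<Sum>u\<in>G. f u $$ p)" for p
    by (rule sum.reindex_bij_betw[where g = "\<lambda>u. f u $$ p"])
  thus ?thesis unfolding gsum_def by simp
qed

lemma trace_gsum:
  assumes "\<And>u. u \<in> G \<Longrightarrow> f u \<in> carrier_mat n n"
  shows "mat_trace (gsum f) = (\<Sum>u\<in>G. mat_trace (f u))"
proof -
  have "mat_trace (gsum f) = (\<Sum>i<n. \<Sum>u\<in>G. f u $$ (i,i))" unfolding mat_trace_def gsum_def by simp
  also have "\<dots> = (\<Sum>u\<in>G. \<Sum>i<n. f u $$ (i,i))" by (rule sum.swap)
  also have "\<dots> = (\<Sum>u\<in>G. mat_trace (f u))"
    unfolding mat_trace_def using assms by (intro sum.cong) auto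
  finally show ?thesis .
qed

lemma trace_conj:
  assumes "u \<in> G" "M \<in> carrier_mat n n"
  shows "mat_trace (u * M * ginv u) = mat_trace M"
proof -
  have "mat_trace (u * M * ginv u) = mat_trace (ginv u * (u * M))"
    using assms by (intro mat_trace_comm[of _ n n]) (auto intro!: mult_carrier_mat[of _ n n])
  thus ?thesis using ginv_mult_cancel(1)[OF assms] by simp
qed

lemma conj_by_inverse:
  assumes "u \<in> G" "A \<in> G" "M \<in> carrier_mat n n"
  shows "A * (u * M * ginv u) = ((A * u) * M * ginv (A * u)) * A"
proof -
  have Au: "A * u \<in> G" using assms by (intro mult_in_G)
  have c: "ginv (A * u) \<in> carrier_mat n n" "u * M \<in> carrier_mat n n" using Au assms by (auto intro!: mult_carrier_mat[of _ n n])
  have "ginv u = ginv (A * u) * A"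
  proof -
    have "ginv (A * u) * A = ginv (A * u) * (A * (u * ginv u))"
      using assms ginv(2)[OF assms(1)] by (simp add: square_mult_one[of _ n])
    also have "\<dots> = ginv (A * u) * ((A * u) * ginv u)" using assms by (simp add: assoc_mult_mat[of _ n n _ n _ n])
    also have "\<dots> = ginv u" using ginv_mult_cancel(1)[OF Au ginv_carrier[OF assms(1)]] .
    finally show ?thesis ..
  qed
  hence "A * (u * M * ginv u) = A * (u * M * (ginv (A * u) * A))" by simp
  also have "\<dots> = ((A * u) * M * ginv (A * u)) * A"
    using assms c by (simp add: assoc_mult_mat[of _ n n _ n _ n] mult_carrier_mat[of _ n n])
  finally show ?thesis .
qed

definition invariant_form :: "complex mat \<Rightarrow> bool" where
  "invariant_form B \<longleftrightarrow> B \<in> carrier_mat n n \<and> (\<forall>g\<in>G. transpose_mat g * B * g = B)"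

lemma transpose_ginv:
  assumes "g \<in> G"
  shows "transpose_mat (ginv g) * transpose_mat g = 1\<^sub>m n"
  using transpose_mult[OF carrier[OF assms] ginv_carrier[OF assms]] ginv(2)[OF assms] by simp

lemma invariant_form_shift:
  assumes B: "invariant_form B" and g: "g \<in> G"
  shows "B * g = transpose_mat (ginv g) * B"
proof -
  have c: "B \<in> carrier_mat n n" "transpose_mat g \<in> carrier_mat n n" "transpose_mat (ginv g) \<in> carrier_mat n n"
    using B g unfolding invariant_form_def by auto
  have "transpose_mat (ginv g) * B = transpose_mat (ginv g) * (transpose_mat g * B * g)"
    using B g unfolding invariant_form_def by simp
  also have "\<dots> = (transpose_mat (ginv g) * transpose_mat g) * (B * g)"
    using c g by (simp add: assoc_mult_mat[of _ n n _ n _ n] mult_carrier_mat[of _ n n])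
  also have "\<dots> = B * g" unfolding transpose_ginv[OF g] using c g by (simp add: mult_carrier_mat[of _ n n] square_mult_one[of _ n])
  finally show ?thesis ..
qed

end

lemma injective_square_inverse:
  fixes A :: "complex mat"
  assumes A: "A \<in> carrier_mat n n" and inj: "\<And>v. v \<in> carrier_vec n \<Longrightarrow> A *\<^sub>v v = 0\<^sub>v n \<Longrightarrow> v = 0\<^sub>v n"
  obtains B where "B \<in> carrier_mat n n" "A * B = 1\<^sub>m n" "B * A = 1\<^sub>m n"
proof -
  have "det A \<noteq> 0" using det_0_iff_vec_prod_zero[OF A] inj by blast
  hence "A \<in> Units (ring_mat TYPE(complex) n ())" by (rule det_non_zero_imp_unit[OF A])
  thus thesis using that unfolding Units_def by (auto simp: ring_mat_simps)
qed

context real_commutator_group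
begin

text \<open>
  Averaging \<open>u * M * u\<^sup>-\<^sup>1\<close> over the group gives a matrix commuting with it, that is the scalar with the
  same trace as \<open>M\<close>.
\<close>

lemma sum_trace_conj:
  assumes M: "M \<in> carrier_mat n n" and E: "E \<in> carrier_mat n n"
  shows "(\<Sum>u\<in>G. mat_trace (E * (u * M * ginv u))) = of_nat (card G) * mat_trace M * mat_trace E / of_nat n"
proof -
  let ?S = "gsum (\<lambda>u. u * M * ginv u)"
  have c: "u * M * ginv u \<in> carrier_mat n n" if "u \<in> G" for u using conj_carrier[OF that M] .
  have comm: "?S * A = A * ?S" if A: "A \<in> G" for A
  proof -
    have "A * ?S = gsum (\<lambda>u. A * (u * M * ginv u))" using A by (intro mult_gsum c) auto
    also have "\<dots> = gsum (\<lambda>u. ((A * u) * M * ginv (A * u)) * A)" by (rule gsum_cong, rule conj_by_inverse[OF _ A M])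
    also have "\<dots> = gsum (\<lambda>u. (u * M * ginv u) * A)" by (rule gsum_shift_left[OF A, of "\<lambda>u. (u * M * ginv u) * A"])
    also have "\<dots> = ?S * A" using A by (intro gsum_mult[symmetric] c) auto
    finally show ?thesis ..
  qed
  obtain s where s: "?S = s \<cdot>\<^sub>m 1\<^sub>m n"
    using commuting_with_irreducible_scalar[OF irreducible G_carrier dim_pos gsum_carrier comm] by blast
  have "mat_trace ?S = (\<Sum>u\<in>G. mat_trace (u * M * ginv u))" by (rule trace_gsum[OF c])
  also have "\<dots> = of_nat (card G) * mat_trace M" using trace_conj[OF _ M] by simp
  finally have "mat_trace ?S = of_nat (card G) * mat_trace M" .
  moreover have "mat_trace ?S = s * of_nat n" unfolding s by (simp add: mat_trace_smult[of _ n]) (simp add: mat_trace_def)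
  ultimately have sn: "s = of_nat (card G) * mat_trace M / of_nat n" using dim_pos by (simp add: field_simps)
  have "(\<Sum>u\<in>G. mat_trace (E * (u * M * ginv u))) = mat_trace (gsum (\<lambda>u. E * (u * M * ginv u)))"
    using c E by (intro trace_gsum[symmetric]) (auto intro!: mult_carrier_mat[of _ n n])
  also have "gsum (\<lambda>u. E * (u * M * ginv u)) = E * ?S" by (rule mult_gsum[OF E c, symmetric])
  also have "\<dots> = s \<cdot>\<^sub>m E" unfolding s using E by (simp add: mult_smult_distrib[of _ n n _ n] square_mult_one[of _ n])
  also have "mat_trace \<dots> = s * mat_trace E" using E by (rule mat_trace_smult)
  finally show ?thesis unfolding sn by simp
qed

text \<open>
  The squared norm, in the sense of the trace form, of how far \<open>u\<close> moves \<open>E\<close> by conjugation.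
\<close>

definition energy :: "complex mat \<Rightarrow> complex mat \<Rightarrow> complex" where
  "energy E u = mat_trace ((E - u * E * ginv u) * (E - u * E * ginv u))"

lemma energy_expand:
  assumes E: "E \<in> G" and u: "u \<in> G"
  shows "energy E u = 2 * mat_trace (E * E) - 2 * mat_trace (E * (u * E * ginv u))"
proof -
  define F where "F = u * E * ginv u"
  have c: "E \<in> carrier_mat n n" "F \<in> carrier_mat n n" unfolding F_def using conj_carrier[OF u carrier[OF E]] E by auto
  have pc: "E * E \<in> carrier_mat n n" "E * F \<in> carrier_mat n n" "F * E \<in> carrier_mat n n" "F * F \<in> carrier_mat n n" "E - F \<in> carrier_mat n n"
    using c by (auto intro!: mult_carrier_mat[of _ n n] minus_carrier_mat)
  have "(E - F) * (E - F) = (E * E - F * E) - (E * F - F * F)"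
    using mult_diff_cancel_left(1)[OF pc(5) c] mult_diff_cancel_left(2)[OF c(1) c] mult_diff_cancel_left(2)[OF c(2) c] by simp
  hence "mat_trace ((E - F) * (E - F)) = (mat_trace (E * E) - mat_trace (F * E)) - (mat_trace (E * F) - mat_trace (F * F))"
    using pc by (simp add: mat_trace_diff[of _ n] minus_carrier_mat)
  moreover have "mat_trace (F * E) = mat_trace (E * F)" by (rule mat_trace_comm[OF c(2,1)])
  moreover have "F * F = u * (E * E) * ginv u"
  proof -
    have "F * F = u * (E * (ginv u * (u * (E * ginv u))))"
      unfolding F_def using E u by (simp add: assoc_mult_mat[of _ n n _ n _ n] mult_carrier_mat[of _ n n])
    also have "ginv u * (u * (E * ginv u)) = E * ginv u" using u E by (intro ginv_mult_cancel) (auto intro!: mult_carrier_mat[of _ n n])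
    finally show ?thesis using E u by (simp add: assoc_mult_mat[of _ n n _ n _ n] mult_carrier_mat[of _ n n])
  qed
  hence "mat_trace (F * F) = mat_trace (E * E)" using trace_conj[OF u pc(1)] by simp
  ultimately show ?thesis unfolding energy_def F_def[symmetric] by simp
qed

lemma energy_nonneg:
  assumes E: "E \<in> G" and u: "u \<in> G"
  shows "Re (energy E u) \<ge> 0" "Re (energy E u) = 0 \<Longrightarrow> spectrum (E - u * E * ginv u) \<subseteq> {0}"
proof -
  have c: "E - u * E * ginv u \<in> carrier_mat n n" using conj_carrier[OF u carrier[OF E]] by (rule minus_carrier_mat)
  obtain t where "t \<ge> 0" "energy E u = of_real t" "t = 0 \<Longrightarrow> spectrum (E - u * E * ginv u) \<subseteq> {0}"
    using real_spectrum_trace_square[OF c real_conjugate_difference[OF E u]] unfolding energy_def by metis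
  thus "Re (energy E u) \<ge> 0" "Re (energy E u) = 0 \<Longrightarrow> spectrum (E - u * E * ginv u) \<subseteq> {0}" by auto
qed

lemma total_energy:
  "(\<Sum>E\<in>G. \<Sum>u\<in>G. energy E u) =
     2 * of_nat (card G) * ((\<Sum>E\<in>G. mat_trace (E * E)) - (\<Sum>E\<in>G. mat_trace E * mat_trace E) / of_nat n)"
proof -
  have "(\<Sum>u\<in>G. energy E u) = 2 * of_nat (card G) * (mat_trace (E * E) - mat_trace E * mat_trace E / of_nat n)" if E: "E \<in> G" for E
  proof -
    have "(\<Sum>u\<in>G. energy E u) = (\<Sum>u\<in>G. 2 * mat_trace (E * E) - 2 * mat_trace (E * (u * E * ginv u)))"
      using energy_expand[OF E] by (intro sum.cong) auto
    also have "\<dots> = of_nat (card G) * (2 * mat_trace (E * E)) - 2 * (\<Sum>u\<in>G. mat_trace (E * (u * E * ginv u)))"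
      by (simp add: sum_subtractf sum_distrib_left)
    finally show ?thesis unfolding sum_trace_conj[OF carrier[OF E] carrier[OF E]] by (simp add: algebra_simps)
  qed
  hence "(\<Sum>E\<in>G. \<Sum>u\<in>G. energy E u) = (\<Sum>E\<in>G. 2 * of_nat (card G) * (mat_trace (E * E) - mat_trace E * mat_trace E / of_nat n))"
    by (intro sum.cong) auto
  also have "\<dots> = 2 * of_nat (card G) * (\<Sum>E\<in>G. mat_trace (E * E) - mat_trace E * mat_trace E / of_nat n)"
    by (rule sum_distrib_left[symmetric])
  also have "(\<Sum>E\<in>G. mat_trace (E * E) - mat_trace E * mat_trace E / of_nat n) = (\<Sum>E\<in>G. mat_trace (E * E)) - (\<Sum>E\<in>G. mat_trace E * mat_trace E) / of_nat n"
    by (simp add: sum_subtractf sum_divide_distrib)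
  finally show ?thesis .
qed

text \<open>
  The correlations of the matrix entries, from which both trace sums in \<open>total_energy\<close> are obtained by
  contracting indices. For fixed \<open>a\<close> and \<open>b\<close> they form an invariant bilinear form.
\<close>

definition corr :: "nat \<Rightarrow> nat \<Rightarrow> nat \<Rightarrow> nat \<Rightarrow> complex" where
  "corr a b c d = (\<Sum>g\<in>G. g $$ (a,c) * g $$ (b,d))"

lemma sum_trace_square: "(\<Sum>E\<in>G. mat_trace (E * E)) = (\<Sum>a<n. \<Sum>c<n. corr a c c a)"
proof -
  have "mat_trace (E * E) = (\<Sum>a<n. \<Sum>c<n. E $$ (a,c) * E $$ (c,a))" if E: "E \<in> G" for E
    using carrier[OF E] unfolding mat_trace_def by (auto simp: scalar_prod_def atLeast0LessThan intro!: sum.cong)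
  hence "(\<Sum>E\<in>G. mat_trace (E * E)) = (\<Sum>E\<in>G. \<Sum>a<n. \<Sum>c<n. E $$ (a,c) * E $$ (c,a))" by (intro sum.cong) auto
  also have "\<dots> = (\<Sum>a<n. \<Sum>E\<in>G. \<Sum>c<n. E $$ (a,c) * E $$ (c,a))" by (rule sum.swap)
  also have "\<dots> = (\<Sum>a<n. \<Sum>c<n. \<Sum>E\<in>G. E $$ (a,c) * E $$ (c,a))" by (intro sum.cong refl sum.swap)
  finally show ?thesis unfolding corr_def .
qed

lemma sum_square_trace: "(\<Sum>E\<in>G. mat_trace E * mat_trace E) = (\<Sum>a<n. \<Sum>b<n. corr a b a b)"
proof -
  have "mat_trace E * mat_trace E = (\<Sum>a<n. \<Sum>b<n. E $$ (a,a) * E $$ (b,b))" if E: "E \<in> G" for E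
  proof -
    have "dim_row E = n" using carrier[OF E] by auto
    thus ?thesis unfolding mat_trace_def by (simp add: sum_product)
  qed
  hence "(\<Sum>E\<in>G. mat_trace E * mat_trace E) = (\<Sum>E\<in>G. \<Sum>a<n. \<Sum>b<n. E $$ (a,a) * E $$ (b,b))" by (intro sum.cong) auto
  also have "\<dots> = (\<Sum>a<n. \<Sum>E\<in>G. \<Sum>b<n. E $$ (a,a) * E $$ (b,b))" by (rule sum.swap)
  also have "\<dots> = (\<Sum>a<n. \<Sum>b<n. \<Sum>E\<in>G. E $$ (a,a) * E $$ (b,b))" by (intro sum.cong refl sum.swap)
  finally show ?thesis unfolding corr_def .
qed

lemma bilinear_entries:
  fixes B g :: "complex mat"
  assumes "B \<in> carrier_mat n n" "g \<in> carrier_mat n n" "i < n" "j < n"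
  shows "(transpose_mat g * B * g) $$ (i,j) = (\<Sum>a<n. \<Sum>b<n. B $$ (a,b) * (g $$ (a,i) * g $$ (b,j)))"
proof -
  have [simp]: "dim_row B = n" "dim_col B = n" "dim_row g = n" "dim_col g = n" using assms by auto
  have "(transpose_mat g * B * g) $$ (i,j) = (\<Sum>b<n. (\<Sum>a<n. g $$ (a,i) * B $$ (a,b)) * g $$ (b,j))"
    using assms(3,4) by (simp add: scalar_prod_def atLeast0LessThan)
  also have "\<dots> = (\<Sum>b<n. \<Sum>a<n. B $$ (a,b) * (g $$ (a,i) * g $$ (b,j)))"
    unfolding sum_distrib_right by (intro sum.cong refl) (simp add: algebra_simps)
  also have "\<dots> = (\<Sum>a<n. \<Sum>b<n. B $$ (a,b) * (g $$ (a,i) * g $$ (b,j)))" by (rule sum.swap)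
  finally show ?thesis .
qed

lemma corr_invariant: "invariant_form (mat n n (\<lambda>(c,d). corr a b c d))" if ab: "a < n" "b < n"
  unfolding invariant_form_def
proof (intro conjI ballI)
  let ?B = "mat n n (\<lambda>(c,d). corr a b c d)"
  fix h assume h: "h \<in> G"
  show "transpose_mat h * ?B * h = ?B"
  proof (rule eq_matI)
    fix i j assume "i < dim_row ?B" "j < dim_col ?B"
    hence ij: "i < n" "j < n" by auto
    have "(transpose_mat h * ?B * h) $$ (i,j) = (\<Sum>c<n. \<Sum>d<n. corr a b c d * (h $$ (c,i) * h $$ (d,j)))"
      using bilinear_entries[of ?B h i j] h ij by simp
    also have "\<dots> = (\<Sum>c<n. \<Sum>d<n. \<Sum>g\<in>G. (g $$ (a,c) * h $$ (c,i)) * (g $$ (b,d) * h $$ (d,j)))"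
      unfolding corr_def sum_distrib_right by (intro sum.cong refl) (simp add: algebra_simps)
    also have "\<dots> = (\<Sum>c<n. \<Sum>g\<in>G. \<Sum>d<n. (g $$ (a,c) * h $$ (c,i)) * (g $$ (b,d) * h $$ (d,j)))"
      by (intro sum.cong refl sum.swap)
    also have "\<dots> = (\<Sum>g\<in>G. \<Sum>c<n. \<Sum>d<n. (g $$ (a,c) * h $$ (c,i)) * (g $$ (b,d) * h $$ (d,j)))"
      by (rule sum.swap)
    also have "\<dots> = (\<Sum>g\<in>G. (g * h) $$ (a,i) * (g * h) $$ (b,j))"
    proof (rule sum.cong)
      fix g assume g: "g \<in> G"
      have [simp]: "dim_row g = n" "dim_col g = n" "dim_row h = n" "dim_col h = n" using carrier[OF g] carrier[OF h] by auto
      show "(\<Sum>c<n. \<Sum>d<n. (g $$ (a,c) * h $$ (c,i)) * (g $$ (b,d) * h $$ (d,j))) = (g * h) $$ (a,i) * (g * h) $$ (b,j)"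
        using ab ij by (simp add: scalar_prod_def atLeast0LessThan sum_product)
    qed simp
    also have "\<dots> = corr a b i j"
    proof -
      have "gsum (\<lambda>u. mat n n (\<lambda>(i,j). (u * h) $$ (a,i) * (u * h) $$ (b,j))) = gsum (\<lambda>u. mat n n (\<lambda>(i,j). u $$ (a,i) * u $$ (b,j)))"
        by (rule gsum_shift_right[OF h, of "\<lambda>u. mat n n (\<lambda>(i,j). u $$ (a,i) * u $$ (b,j))"])
      hence "gsum (\<lambda>u. mat n n (\<lambda>(i,j). (u * h) $$ (a,i) * (u * h) $$ (b,j))) $$ (i,j) = gsum (\<lambda>u. mat n n (\<lambda>(i,j). u $$ (a,i) * u $$ (b,j))) $$ (i,j)" by simp
      thus ?thesis unfolding gsum_def corr_def using ij by simp
    qed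
    finally show "(transpose_mat h * ?B * h) $$ (i,j) = ?B $$ (i,j)" using ij by simp
  qed (use carrier[OF h] in auto)
qed simp

text \<open>
  The kernel of an invariant form is an invariant subspace.
\<close>

lemma invariant_form_invertible:
  assumes B: "invariant_form B" and B0: "B \<noteq> 0\<^sub>m n n"
  obtains Bi where "Bi \<in> carrier_mat n n" "B * Bi = 1\<^sub>m n" "Bi * B = 1\<^sub>m n"
proof -
  have Bc: "B \<in> carrier_mat n n" using B unfolding invariant_form_def by simp
  have inj: "v = 0\<^sub>v n" if v: "v \<in> carrier_vec n" "B *\<^sub>v v = 0\<^sub>v n" for v
  proof (rule ccontr)
    assume v0: "v \<noteq> 0\<^sub>v n"
    let ?W = "{v \<in> carrier_vec n. B *\<^sub>v v = 0\<^sub>v n}"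
    have "?W = carrier_vec n"
    proof (rule irreducible_matricesD[OF irreducible, of _ v])
      show "x + y \<in> ?W" if "x \<in> ?W" "y \<in> ?W" for x y using that Bc by (auto simp: mult_add_distrib_mat_vec[of _ n n])
      show "c \<cdot>\<^sub>v x \<in> ?W" if "x \<in> ?W" for c x using that Bc by (auto simp: mult_mat_vec[of _ n n])
      show "g *\<^sub>v x \<in> ?W" if g: "g \<in> G" and x: "x \<in> ?W" for g x
      proof -
        have t: "transpose_mat (ginv g) \<in> carrier_mat n n" using g by simp
        have xc: "x \<in> carrier_vec n" "B *\<^sub>v x = 0\<^sub>v n" using x by auto
        have "B *\<^sub>v (g *\<^sub>v x) = (B * g) *\<^sub>v x" using assoc_mult_mat_vec[OF Bc carrier[OF g] xc(1)] by simp
        also have "\<dots> = transpose_mat (ginv g) *\<^sub>v (B *\<^sub>v x)" unfolding invariant_form_shift[OF B g] by (rule assoc_mult_mat_vec[OF t Bc xc(1)])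
        also have "\<dots> = 0\<^sub>v n" unfolding xc(2) by (rule mult_mat_zero_vec[OF t])
        finally show ?thesis using mult_mat_vec_carrier[OF carrier[OF g] xc(1)] by simp
      qed
    qed (use v v0 in auto)
    hence "B = 0\<^sub>m n n" using eq_zero_mat_by_mult_vec[OF Bc] by blast
    thus False using B0 by simp
  qed
  from injective_square_inverse[OF Bc inj] show thesis using that by blast
qed

text \<open>
  Two invariant forms differ by a matrix that commutes with the group, to which Schur's lemma applies.
\<close>

lemma invariant_form_unique:
  assumes B: "invariant_form B" "B \<noteq> 0\<^sub>m n n" and B': "invariant_form B'"
  obtains c where "B' = c \<cdot>\<^sub>m B"
proof -
  obtain Bi where Bi: "Bi \<in> carrier_mat n n" "B * Bi = 1\<^sub>m n" "Bi * B = 1\<^sub>m n" using invariant_form_invertible[OF B] by blast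
  have Bc: "B \<in> carrier_mat n n" "B' \<in> carrier_mat n n" using B B' unfolding invariant_form_def by auto
  have "(Bi * B') * g = g * (Bi * B')" if g: "g \<in> G" for g
  proof -
    let ?t = "transpose_mat (ginv g)"
    have t: "?t \<in> carrier_mat n n" using g by simp
    note gc = carrier[OF g]
    have "(Bi * B') * g = Bi * (B' * g)" by (rule assoc_mult_mat[OF Bi(1) Bc(2) gc])
    also have "B' * g = ?t * B'" by (rule invariant_form_shift[OF B' g])
    also have "Bi * (?t * B') = Bi * (?t * ((B * Bi) * B'))" unfolding Bi(2) using Bc by (simp add: square_mult_one[of _ n])
    also have "\<dots> = Bi * ((?t * B) * (Bi * B'))" using Bi(1) Bc t by (simp add: assoc_mult_mat[of _ n n _ n _ n] mult_carrier_mat[of _ n n])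
    also have "?t * B = B * g" by (rule invariant_form_shift[OF B(1) g, symmetric])
    also have "Bi * ((B * g) * (Bi * B')) = (Bi * B) * (g * (Bi * B'))" using Bi(1) Bc gc by (simp add: assoc_mult_mat[of _ n n _ n _ n] mult_carrier_mat[of _ n n])
    also have "\<dots> = g * (Bi * B')" unfolding Bi(3) using Bi(1) Bc gc by (simp add: square_mult_one[of _ n] mult_carrier_mat[of _ n n])
    finally show ?thesis .
  qed
  then obtain c where c: "Bi * B' = c \<cdot>\<^sub>m 1\<^sub>m n"
    using commuting_with_irreducible_scalar[OF irreducible G_carrier dim_pos mult_carrier_mat[OF Bi(1) Bc(2)]] by blast
  have "B' = (B * Bi) * B'" unfolding Bi(2) using Bc by (simp add: square_mult_one[of _ n])
  also have "\<dots> = B * (Bi * B')" by (rule assoc_mult_mat[OF Bc(1) Bi(1) Bc(2)])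
  also have "\<dots> = c \<cdot>\<^sub>m B" unfolding c using Bc by (simp add: mult_smult_distrib[of _ n n _ n] square_mult_one[of _ n])
  finally show thesis by (rule that)
qed

lemma invariant_form_transpose:
  assumes B: "invariant_form B"
  shows "invariant_form (transpose_mat B)"
  unfolding invariant_form_def
proof (intro conjI ballI)
  have Bc: "B \<in> carrier_mat n n" using B unfolding invariant_form_def by simp
  thus "transpose_mat B \<in> carrier_mat n n" by simp
  fix g assume g: "g \<in> G"
  note gc = carrier[OF g]
  have "transpose_mat (transpose_mat g * B * g) = transpose_mat g * (transpose_mat B * g)"
    using transpose_mult[of "transpose_mat g * B" n n g n] transpose_mult[of "transpose_mat g" n n B n] gc Bc by simp
  also have "\<dots> = transpose_mat g * transpose_mat B * g" using gc Bc by (intro assoc_mult_mat[symmetric, of _ n n _ n _ n]) auto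
  finally show "transpose_mat g * transpose_mat B * g = transpose_mat B" using B g unfolding invariant_form_def by simp
qed

text \<open>
  The transpose is a multiple \<open>c\<close> of the form by uniqueness, and transposing twice shows \<open>c\<^sup>2 = 1\<close>.
\<close>

lemma invariant_form_symmetric_or_skew:
  assumes B: "invariant_form B" "B \<noteq> 0\<^sub>m n n"
  shows "transpose_mat B = B \<or> transpose_mat B = (- 1) \<cdot>\<^sub>m B"
proof -
  have Bc: "B \<in> carrier_mat n n" using B unfolding invariant_form_def by simp
  obtain c where c: "transpose_mat B = c \<cdot>\<^sub>m B" using invariant_form_unique[OF B invariant_form_transpose[OF B(1)]] by blast
  have entry: "B $$ (j,i) = c * B $$ (i,j)" if "i < n" "j < n" for i j
  proof -
    have "transpose_mat B $$ (i,j) = (c \<cdot>\<^sub>m B) $$ (i,j)" by (rule arg_cong[OF c])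
    thus ?thesis using that Bc by simp
  qed
  obtain i j where ij: "i < n" "j < n" "B $$ (i,j) \<noteq> 0" using nonzero_mat_entry[OF Bc B(2)] by blast
  have "B $$ (i,j) = c * (c * B $$ (i,j))" using entry[OF ij(2,1)] unfolding entry[OF ij(1,2)] .
  hence "(c * c - 1) * B $$ (i,j) = 0" by (simp add: algebra_simps)
  hence "c * c = 1" using ij(3) by simp
  hence "c = 1 \<or> c = -1" by (simp add: square_eq_1_iff)
  moreover have "1 \<cdot>\<^sub>m B = B" using Bc by (intro eq_matI) auto
  ultimately show ?thesis using c by metis
qed

text \<open>
  The correlations are \<open>\<beta> a b * B c d\<close> by uniqueness of the invariant form. Contracting with \<open>B\<close> shows that
  the squared traces sum to \<open>|G|\<close>, and skew symmetry makes the traces of the squares sum to \<open>- |G|\<close>. The total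
  energy would then be negative. This is the indicator argument of Frobenius and Schur.
\<close>

lemma finite_not_skew:
  assumes fin: "finite G" and B: "invariant_form B" "B \<noteq> 0\<^sub>m n n"
  shows "transpose_mat B \<noteq> (- 1) \<cdot>\<^sub>m B"
proof
  assume skew: "transpose_mat B = (- 1) \<cdot>\<^sub>m B"
  have Bc: "B \<in> carrier_mat n n" using B unfolding invariant_form_def by simp
  have sk: "B $$ (d,c) = - B $$ (c,d)" if "c < n" "d < n" for c d
  proof -
    have "transpose_mat B $$ (c,d) = ((- 1) \<cdot>\<^sub>m B) $$ (c,d)" unfolding skew ..
    thus ?thesis using that Bc by simp
  qed
  obtain c0 d0 where cd0: "c0 < n" "d0 < n" "B $$ (c0,d0) \<noteq> 0" using nonzero_mat_entry[OF Bc B(2)] by blast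
  have "\<exists>\<beta>. \<forall>c<n. \<forall>d<n. corr a b c d = \<beta> * B $$ (c,d)" if ab: "a < n" "b < n" for a b
  proof -
    obtain \<beta> where \<beta>: "mat n n (\<lambda>(c,d). corr a b c d) = \<beta> \<cdot>\<^sub>m B" using invariant_form_unique[OF B corr_invariant[OF ab]] by blast
    have "corr a b c d = \<beta> * B $$ (c,d)" if "c < n" "d < n" for c d
    proof -
      have "mat n n (\<lambda>(c,d). corr a b c d) $$ (c,d) = (\<beta> \<cdot>\<^sub>m B) $$ (c,d)" unfolding \<beta> ..
      thus ?thesis using that Bc by simp
    qed
    thus ?thesis by blast
  qed
  then obtain \<beta> where \<beta>: "\<And>a b c d. a < n \<Longrightarrow> b < n \<Longrightarrow> c < n \<Longrightarrow> d < n \<Longrightarrow> corr a b c d = \<beta> a b * B $$ (c,d)" by metis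
  have "(\<Sum>a<n. \<Sum>b<n. B $$ (a,b) * corr a b c0 d0) = of_nat (card G) * B $$ (c0,d0)"
  proof -
    have "(\<Sum>a<n. \<Sum>b<n. B $$ (a,b) * corr a b c0 d0) = (\<Sum>a<n. \<Sum>b<n. \<Sum>g\<in>G. B $$ (a,b) * (g $$ (a,c0) * g $$ (b,d0)))"
      unfolding corr_def by (simp add: sum_distrib_left)
    also have "\<dots> = (\<Sum>a<n. \<Sum>g\<in>G. \<Sum>b<n. B $$ (a,b) * (g $$ (a,c0) * g $$ (b,d0)))" by (intro sum.cong refl sum.swap)
    also have "\<dots> = (\<Sum>g\<in>G. \<Sum>a<n. \<Sum>b<n. B $$ (a,b) * (g $$ (a,c0) * g $$ (b,d0)))" by (rule sum.swap)
    also have "\<dots> = (\<Sum>g\<in>G. B $$ (c0,d0))"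
    proof (rule sum.cong)
      fix g assume g: "g \<in> G"
      have "(transpose_mat g * B * g) $$ (c0,d0) = B $$ (c0,d0)" using B(1) g unfolding invariant_form_def by simp
      thus "(\<Sum>a<n. \<Sum>b<n. B $$ (a,b) * (g $$ (a,c0) * g $$ (b,d0))) = B $$ (c0,d0)"
        using bilinear_entries[OF Bc carrier[OF g] cd0(1,2)] by simp
    qed simp
    finally show ?thesis by simp
  qed
  moreover have "(\<Sum>a<n. \<Sum>b<n. B $$ (a,b) * corr a b c0 d0) = (\<Sum>a<n. \<Sum>b<n. \<beta> a b * B $$ (a,b)) * B $$ (c0,d0)"
    unfolding sum_distrib_right using \<beta> cd0 by (intro sum.cong) auto
  ultimately have s: "(\<Sum>a<n. \<Sum>b<n. \<beta> a b * B $$ (a,b)) = of_nat (card G)" using cd0(3) by simp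
  have 1: "(\<Sum>E\<in>G. mat_trace E * mat_trace E) = of_nat (card G)"
    unfolding sum_square_trace s[symmetric] using \<beta> by (intro sum.cong) auto
  have "corr a c c a = - (\<beta> a c * B $$ (a,c))" if "a < n" "c < n" for a c
    unfolding \<beta>[OF that that(2,1)] sk[OF that] by simp
  hence "(\<Sum>E\<in>G. mat_trace (E * E)) = (\<Sum>a<n. \<Sum>c<n. - (\<beta> a c * B $$ (a,c)))"
    unfolding sum_trace_square by (intro sum.cong) auto
  hence 2: "(\<Sum>E\<in>G. mat_trace (E * E)) = - of_nat (card G)" using s by (simp add: sum_negf)
  have N: "card G > 0" using fin one_in_G card_gt_0_iff by blast
  have "(\<Sum>E\<in>G. \<Sum>u\<in>G. energy E u) = complex_of_real (- (2 * real (card G) * (real (card G) + real (card G) / real n)))"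
    unfolding total_energy 1 2 by (simp add: algebra_simps)
  hence "Re (\<Sum>E\<in>G. \<Sum>u\<in>G. energy E u) = Re (complex_of_real (- (2 * real (card G) * (real (card G) + real (card G) / real n))))"
    by (rule arg_cong)
  also have "\<dots> = - (2 * real (card G) * (real (card G) + real (card G) / real n))" by (rule Re_complex_of_real)
  also have "\<dots> < 0" using N dim_pos by (simp add: add_pos_pos)
  finally have "Re (\<Sum>E\<in>G. \<Sum>u\<in>G. energy E u) < 0" .
  moreover have "Re (\<Sum>E\<in>G. \<Sum>u\<in>G. energy E u) \<ge> 0" using energy_nonneg(1) by (auto intro!: sum_nonneg)
  ultimately show False by simp
qed

text \<open>
  Without an invariant form all correlations vanish, so the total energy is zero. Being a sum of nonnegative terms,
  it vanishes termwise, and all commutators are nilpotent.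
\<close>

lemma no_invariant_form_dim_one:
  assumes fin: "finite G" and none: "\<And>B. invariant_form B \<Longrightarrow> B = 0\<^sub>m n n"
  shows "n = 1"
proof (rule nilpotent_commutators_dim_one[OF fin dim_pos irreducible])
  have corr0: "corr a b c d = 0" if "a < n" "b < n" "c < n" "d < n" for a b c d
  proof -
    have "mat n n (\<lambda>(c,d). corr a b c d) $$ (c,d) = 0\<^sub>m n n $$ (c,d)" unfolding none[OF corr_invariant[OF that(1,2)]] ..
    thus ?thesis using that by simp
  qed
  have "(\<Sum>E\<in>G. \<Sum>u\<in>G. energy E u) = 0" unfolding total_energy sum_trace_square sum_square_trace by (simp add: corr0)
  hence "Re (\<Sum>E\<in>G. \<Sum>u\<in>G. energy E u) = 0" by simp
  hence "(\<Sum>E\<in>G. \<Sum>u\<in>G. Re (energy E u)) = 0" unfolding Re_sum .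
  note total = this
  have nonneg: "0 \<le> (\<Sum>u\<in>G. Re (energy E u))" if "E \<in> G" for E
    using energy_nonneg(1)[OF that] by (rule sum_nonneg)
  have inner: "(\<Sum>u\<in>G. Re (energy E u)) = 0" if E: "E \<in> G" for E
    by (rule sum_nonneg_0[OF fin nonneg total E])
  have z: "Re (energy E u) = 0" if "E \<in> G" "u \<in> G" for E u
    by (rule sum_nonneg_0[OF fin energy_nonneg(1)[OF that(1)] inner[OF that(1)] that(2)])
  fix A B assume A: "A \<in> G" and B: "B \<in> G"
  have AB: "A * B \<in> G" using A B by (rule mult_in_G)
  have "A * B * ginv B = A" using B A by (intro ginv_mult_cancel) auto
  hence "A * B - B * (A * B) * ginv B = A * B - B * A" using conjugate_difference[OF AB B] by simp
  thus "spectrum (A * B - B * A) \<subseteq> {0}" using energy_nonneg(2)[OF AB B z[OF AB B]] by simp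
qed

definition adj :: "complex mat \<Rightarrow> complex mat" where
  "adj A = transpose_mat (cnj_mat A)"

lemma adj_carrier [simp]: "A \<in> carrier_mat n n \<Longrightarrow> adj A \<in> carrier_mat n n"
  unfolding adj_def by simp

lemma adj_mult:
  assumes "A \<in> carrier_mat n n" "B \<in> carrier_mat n n"
  shows "adj (A * B) = adj B * adj A"
  unfolding adj_def cnj_mat_mult[OF assms] using assms by (intro transpose_mult) auto

lemma adj_scalar_prod:
  assumes "A \<in> carrier_mat n n" "x \<in> carrier_vec n" "y \<in> carrier_vec n"
  shows "cnj_vec x \<bullet> (adj A *\<^sub>v y) = cnj_vec (A *\<^sub>v x) \<bullet> y"
proof -
  have c: "cnj_vec x \<in> carrier_vec n" "adj A *\<^sub>v y \<in> carrier_vec n" "cnj_mat A \<in> carrier_mat n n" "cnj_vec (A *\<^sub>v x) \<in> carrier_vec n"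
    using assms mult_mat_vec_carrier[OF adj_carrier[OF assms(1)] assms(3)] mult_mat_vec_carrier[OF assms(1,2)] by auto
  have "cnj_vec x \<bullet> (adj A *\<^sub>v y) = (adj A *\<^sub>v y) \<bullet> cnj_vec x" by (rule comm_scalar_prod[OF c(1,2)])
  also have "\<dots> = y \<bullet> (cnj_mat A *\<^sub>v cnj_vec x)" unfolding adj_def by (rule transpose_vec_mult_scalar[OF c(3) c(1) assms(3)])
  also have "cnj_mat A *\<^sub>v cnj_vec x = cnj_vec (A *\<^sub>v x)" by (rule cnj_mat_mult_vec[OF assms(1,2), symmetric])
  also have "y \<bullet> \<dots> = cnj_vec (A *\<^sub>v x) \<bullet> y" by (rule comm_scalar_prod[OF assms(3) c(4)])
  finally show ?thesis .
qed

lemma cnj_scalar_self: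
  assumes "x \<in> carrier_vec n"
  shows "cnj_vec x \<bullet> x = complex_of_real (\<Sum>i<n. (cmod (x $ i))\<^sup>2)"
proof -
  have "cnj_vec x \<bullet> x = (\<Sum>i<n. cnj (x $ i) * x $ i)" using assms by (simp add: scalar_prod_def atLeast0LessThan)
  also have "\<dots> = (\<Sum>i<n. complex_of_real ((cmod (x $ i))\<^sup>2))" by (intro sum.cong refl) (subst mult.commute, rule complex_norm_square[symmetric])
  finally show ?thesis by simp
qed

text \<open>
  The Gram matrix of the inner product obtained by averaging over the group.
\<close>

definition hermitian_form :: "complex mat" where
  "hermitian_form = gsum (\<lambda>g. adj g * g)"

lemma hermitian_form_carrier [simp]: "hermitian_form \<in> carrier_mat n n" unfolding hermitian_form_def by simp

lemma hermitian_form_shift: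
  assumes h: "h \<in> G"
  shows "hermitian_form * h = adj (ginv h) * hermitian_form"
proof -
  have c: "adj g * g \<in> carrier_mat n n" if "g \<in> G" for g using that by (auto intro!: mult_carrier_mat[of _ n n])
  have "hermitian_form * h = gsum (\<lambda>g. (adj g * g) * h)" unfolding hermitian_form_def by (rule gsum_mult[OF carrier[OF h] c])
  also have "\<dots> = gsum (\<lambda>g. adj (ginv h) * (adj (g * h) * (g * h)))"
  proof (rule gsum_cong)
    fix g assume g: "g \<in> G"
    have gh: "g * h \<in> carrier_mat n n" using g h by (auto intro!: mult_carrier_mat[of _ n n])
    have "adj (ginv h) * adj (g * h) = adj ((g * h) * ginv h)" by (rule adj_mult[OF gh ginv_carrier[OF h], symmetric])
    also have "(g * h) * ginv h = g" using g h by (intro ginv_mult_cancel) auto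
    finally have "adj (ginv h) * (adj (g * h) * (g * h)) = adj g * (g * h)"
      using assoc_mult_mat[of "adj (ginv h)" n n "adj (g * h)" n "g * h" n] gh h by simp
    also have "\<dots> = (adj g * g) * h" using g h by (intro assoc_mult_mat[symmetric, of _ n n _ n _ n]) auto
    finally show "(adj g * g) * h = adj (ginv h) * (adj (g * h) * (g * h))" ..
  qed
  also have "\<dots> = gsum (\<lambda>g. adj (ginv h) * (adj g * g))"
    by (rule gsum_shift_right[OF h, of "\<lambda>g. adj (ginv h) * (adj g * g)"])
  also have "\<dots> = adj (ginv h) * hermitian_form" unfolding hermitian_form_def
    by (rule mult_gsum[symmetric, OF adj_carrier[OF ginv_carrier[OF h]] c])
  finally show ?thesis .
qed

lemma hermitian_form_positive:
  assumes fin: "finite G" and x: "x \<in> carrier_vec n" "x \<noteq> 0\<^sub>v n"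
  obtains q where "q > 0" "cnj_vec x \<bullet> (hermitian_form *\<^sub>v x) = complex_of_real q"
proof -
  define q where "q = (\<Sum>g\<in>G. \<Sum>i<n. (cmod ((g *\<^sub>v x) $ i))\<^sup>2)"
  have c: "adj g * g \<in> carrier_mat n n" if "g \<in> G" for g using that by (auto intro!: mult_carrier_mat[of _ n n])
  have Hx: "(hermitian_form *\<^sub>v x) $ i = (\<Sum>g\<in>G. ((adj g * g) *\<^sub>v x) $ i)" if i: "i < n" for i
  proof -
    have "(hermitian_form *\<^sub>v x) $ i = (\<Sum>j<n. (\<Sum>g\<in>G. (adj g * g) $$ (i,j)) * x $ j)"
      using i x(1) unfolding hermitian_form_def gsum_def by (simp add: scalar_prod_def atLeast0LessThan)
    also have "\<dots> = (\<Sum>g\<in>G. \<Sum>j<n. (adj g * g) $$ (i,j) * x $ j)" unfolding sum_distrib_right by (rule sum.swap)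
    also have "\<dots> = (\<Sum>g\<in>G. ((adj g * g) *\<^sub>v x) $ i)"
    proof (rule sum.cong)
      fix g assume "g \<in> G"
      hence d: "dim_row (adj g * g) = n" "dim_col (adj g * g) = n" using c[of g] by (blast dest: carrier_matD)+
      show "(\<Sum>j<n. (adj g * g) $$ (i,j) * x $ j) = ((adj g * g) *\<^sub>v x) $ i"
        using d i x(1) by (simp add: scalar_prod_def atLeast0LessThan del: index_mult_mat)
    qed simp
    finally show ?thesis .
  qed
  have "cnj_vec x \<bullet> (hermitian_form *\<^sub>v x) = (\<Sum>i<n. cnj (x $ i) * (hermitian_form *\<^sub>v x) $ i)"
  proof -
    have "dim_vec (hermitian_form *\<^sub>v x) = n" by (simp add: carrier_matD[OF hermitian_form_carrier])
    thus ?thesis using x(1) by (simp add: scalar_prod_def atLeast0LessThan del: index_mult_mat_vec)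
  qed
  also have "\<dots> = (\<Sum>i<n. \<Sum>g\<in>G. cnj (x $ i) * ((adj g * g) *\<^sub>v x) $ i)"
    by (intro sum.cong refl) (simp add: Hx sum_distrib_left del: index_mult_mat_vec)
  also have "\<dots> = (\<Sum>g\<in>G. \<Sum>i<n. cnj (x $ i) * ((adj g * g) *\<^sub>v x) $ i)" by (rule sum.swap)
  also have "\<dots> = (\<Sum>g\<in>G. complex_of_real (\<Sum>i<n. (cmod ((g *\<^sub>v x) $ i))\<^sup>2))"
  proof (rule sum.cong)
    fix g assume g: "g \<in> G"
    have gx: "g *\<^sub>v x \<in> carrier_vec n" by (rule mult_mat_vec_carrier[OF carrier[OF g] x(1)])
    have "dim_vec ((adj g * g) *\<^sub>v x) = n" using carrier_matD(1)[OF c[OF g]] by simp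
    hence "(\<Sum>i<n. cnj (x $ i) * ((adj g * g) *\<^sub>v x) $ i) = cnj_vec x \<bullet> ((adj g * g) *\<^sub>v x)"
      using x(1) by (simp add: scalar_prod_def atLeast0LessThan del: index_mult_mat_vec)
    also have "\<dots> = cnj_vec x \<bullet> (adj g *\<^sub>v (g *\<^sub>v x))"
      unfolding assoc_mult_mat_vec[OF adj_carrier[OF carrier[OF g]] carrier[OF g] x(1)] ..
    also have "\<dots> = cnj_vec (g *\<^sub>v x) \<bullet> (g *\<^sub>v x)" by (rule adj_scalar_prod[OF carrier[OF g] x(1) gx])
    also have "\<dots> = complex_of_real (\<Sum>i<n. (cmod ((g *\<^sub>v x) $ i))\<^sup>2)" by (rule cnj_scalar_self[OF gx])
    finally show "(\<Sum>i<n. cnj (x $ i) * ((adj g * g) *\<^sub>v x) $ i) = complex_of_real (\<Sum>i<n. (cmod ((g *\<^sub>v x) $ i))\<^sup>2)" .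
  qed simp
  finally have e: "cnj_vec x \<bullet> (hermitian_form *\<^sub>v x) = complex_of_real q" unfolding q_def by simp
  obtain i where i: "i < n" "x $ i \<noteq> 0" using x by (metis carrier_vecD eq_vecI index_zero_vec)
  have "0 < (\<Sum>i<n. (cmod ((1\<^sub>m n *\<^sub>v x) $ i))\<^sup>2)" using i x(1) by (intro sum_pos2[of _ i]) auto
  hence "0 < q" unfolding q_def using fin one_in_G by (intro sum_pos2[of _ "1\<^sub>m n"]) (auto intro!: sum_nonneg)
  thus thesis using e by (rule that)
qed

text \<open>
  Comparing the symmetric form \<open>B\<close> with the invariant inner product \<open>H\<close> gives a conjugate linear map \<open>J\<close>
  commuting with the group, \<open>H (J x) = cnj (B x)\<close>. Its square is a scalar, and symmetry of \<open>B\<close> makes the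
  scalar positive, say \<open>s\<^sup>2\<close>. Then \<open>J / s\<close> is a complex conjugation, and its fixed vectors are a real form.
\<close>

lemma symmetric_form_real_form:
  assumes fin: "finite G" and B: "invariant_form B" "B \<noteq> 0\<^sub>m n n" and sym: "transpose_mat B = B"
  obtains W where "real_form n W" "\<And>g w. g \<in> G \<Longrightarrow> w \<in> W \<Longrightarrow> g *\<^sub>v w \<in> W"
proof -
  let ?H = hermitian_form
  have Bc: "B \<in> carrier_mat n n" using B unfolding invariant_form_def by simp
  note Hc = hermitian_form_carrier
  have Hinj: "v = 0\<^sub>v n" if v: "v \<in> carrier_vec n" "?H *\<^sub>v v = 0\<^sub>v n" for v
  proof (rule ccontr)
    assume "v \<noteq> 0\<^sub>v n"
    then obtain q where q: "q > 0" "cnj_vec v \<bullet> (?H *\<^sub>v v) = complex_of_real q" using hermitian_form_positive[OF fin v(1)] by blast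
    have "cnj_vec v \<bullet> 0\<^sub>v n = 0" using v(1) by (intro scalar_prod_right_zero) simp
    thus False using q unfolding v(2) by simp
  qed
  obtain Hi where Hi: "Hi \<in> carrier_mat n n" "?H * Hi = 1\<^sub>m n" "Hi * ?H = 1\<^sub>m n" using injective_square_inverse[OF Hc Hinj] by blast
  obtain Bi where Bi: "Bi \<in> carrier_mat n n" "Bi * B = 1\<^sub>m n" using invariant_form_invertible[OF B] by metis
  define J where "J x = Hi *\<^sub>v cnj_vec (B *\<^sub>v x)" for x
  have Bx: "B *\<^sub>v x \<in> carrier_vec n" "cnj_vec (B *\<^sub>v x) \<in> carrier_vec n" if "x \<in> carrier_vec n" for x
    using mult_mat_vec_carrier[OF Bc that] by auto
  have Jc: "J x \<in> carrier_vec n" if "x \<in> carrier_vec n" for x unfolding J_def by (rule mult_mat_vec_carrier[OF Hi(1) Bx(2)[OF that]])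
  have HJ: "?H *\<^sub>v J x = cnj_vec (B *\<^sub>v x)" if x: "x \<in> carrier_vec n" for x
    using assoc_mult_mat_vec[OF Hc Hi(1) Bx(2)[OF x]] Bx(2)[OF x] unfolding J_def Hi(2) by simp
  have Jadd: "J (x + y) = J x + J y" if "x \<in> carrier_vec n" "y \<in> carrier_vec n" for x y
  proof -
    have "cnj_vec (B *\<^sub>v (x + y)) = cnj_vec (B *\<^sub>v x) + cnj_vec (B *\<^sub>v y)"
      unfolding mult_add_distrib_mat_vec[OF Bc that] using Bx[OF that(1)] Bx[OF that(2)] by (intro eq_vecI) (auto simp del: index_mult_mat_vec)
    thus ?thesis unfolding J_def using mult_add_distrib_mat_vec[OF Hi(1) Bx(2)[OF that(1)] Bx(2)[OF that(2)]] by simp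
  qed
  have Jsmult: "J (c \<cdot>\<^sub>v x) = cnj c \<cdot>\<^sub>v J x" if "x \<in> carrier_vec n" for c x
  proof -
    have "cnj_vec (B *\<^sub>v (c \<cdot>\<^sub>v x)) = cnj c \<cdot>\<^sub>v cnj_vec (B *\<^sub>v x)"
      unfolding mult_mat_vec[OF Bc that] using Bx[OF that] by (intro eq_vecI) (auto simp del: index_mult_mat_vec)
    thus ?thesis unfolding J_def using mult_mat_vec[OF Hi(1) Bx(2)[OF that]] by simp
  qed
  have Jg: "J (g *\<^sub>v x) = g *\<^sub>v J x" if g: "g \<in> G" and x: "x \<in> carrier_vec n" for g x
  proof -
    have gx: "g *\<^sub>v x \<in> carrier_vec n" and gJ: "g *\<^sub>v J x \<in> carrier_vec n"
      using mult_mat_vec_carrier[OF carrier[OF g]] x Jc[OF x] by auto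
    let ?t = "transpose_mat (ginv g)"
    have t: "?t \<in> carrier_mat n n" using g by simp
    have ct: "cnj_mat ?t = adj (ginv g)" unfolding adj_def using g by (intro eq_matI) auto
    have ca: "adj (ginv g) \<in> carrier_mat n n" using g by simp
    have "?H *\<^sub>v (g *\<^sub>v J x) = (?H * g) *\<^sub>v J x" by (rule assoc_mult_mat_vec[OF Hc carrier[OF g] Jc[OF x], symmetric])
    also have "\<dots> = adj (ginv g) *\<^sub>v (?H *\<^sub>v J x)"
      unfolding hermitian_form_shift[OF g] by (rule assoc_mult_mat_vec[OF ca Hc Jc[OF x]])
    also have "\<dots> = cnj_vec (?t *\<^sub>v (B *\<^sub>v x))" unfolding HJ[OF x] ct[symmetric] by (rule cnj_mat_mult_vec[OF t Bx(1)[OF x], symmetric])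
    also have "?t *\<^sub>v (B *\<^sub>v x) = B *\<^sub>v (g *\<^sub>v x)"
      using assoc_mult_mat_vec[OF t Bc x] assoc_mult_mat_vec[OF Bc carrier[OF g] x] unfolding invariant_form_shift[OF B(1) g] by simp
    finally have "?H *\<^sub>v (g *\<^sub>v J x) = cnj_vec (B *\<^sub>v (g *\<^sub>v x))" .
    hence "J (g *\<^sub>v x) = Hi *\<^sub>v (?H *\<^sub>v (g *\<^sub>v J x))" unfolding J_def by simp
    also have "\<dots> = g *\<^sub>v J x" using assoc_mult_mat_vec[OF Hi(1) Hc gJ] gJ unfolding Hi(3) by simp
    finally show ?thesis .
  qed
  have cB: "cnj_mat B \<in> carrier_mat n n" "cnj_mat Hi \<in> carrier_mat n n" using Bc Hi(1) by auto
  define K where "K = Hi * cnj_mat B * cnj_mat Hi * B"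
  have Kc: "K \<in> carrier_mat n n" unfolding K_def using Hi(1) Bc cB by (auto intro!: mult_carrier_mat[of _ n n])
  have JJ: "J (J x) = K *\<^sub>v x" if x: "x \<in> carrier_vec n" for x
  proof -
    have "cnj_vec (J x) = cnj_mat Hi *\<^sub>v (B *\<^sub>v x)" unfolding J_def cnj_mat_mult_vec[OF Hi(1) Bx(2)[OF x]] cnj_vec_cnj_vec ..
    hence "J (J x) = Hi *\<^sub>v (cnj_mat B *\<^sub>v (cnj_mat Hi *\<^sub>v (B *\<^sub>v x)))"
      unfolding J_def[of "J x"] cnj_mat_mult_vec[OF Bc Jc[OF x]] by simp
    also have "\<dots> = K *\<^sub>v x" unfolding K_def using Hi(1) Bc cB x
      by (simp add: assoc_mult_mat_vec[of _ n n _ n] assoc_mult_mat[of _ n n _ n _ n] mult_carrier_mat[of _ n n] mult_mat_vec_carrier[of _ n n])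
    finally show ?thesis .
  qed
  have "K * g = g * K" if g: "g \<in> G" for g
  proof (rule eq_mat_by_mult_vec)
    show "K * g \<in> carrier_mat n n" "g * K \<in> carrier_mat n n" using Kc g by (auto intro!: mult_carrier_mat[of _ n n])
    fix v :: "complex vec" assume v: "v \<in> carrier_vec n"
    have gv: "g *\<^sub>v v \<in> carrier_vec n" by (rule mult_mat_vec_carrier[OF carrier[OF g] v])
    have "(K * g) *\<^sub>v v = K *\<^sub>v (g *\<^sub>v v)" by (rule assoc_mult_mat_vec[OF Kc carrier[OF g] v])
    also have "\<dots> = g *\<^sub>v J (J v)" unfolding JJ[OF gv, symmetric] Jg[OF g v] Jg[OF g Jc[OF v]] ..
    also have "\<dots> = (g * K) *\<^sub>v v" unfolding JJ[OF v] by (rule assoc_mult_mat_vec[OF carrier[OF g] Kc v, symmetric])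
    finally show "(K * g) *\<^sub>v v = (g * K) *\<^sub>v v" .
  qed
  then obtain l where l: "K = l \<cdot>\<^sub>m 1\<^sub>m n" using commuting_with_irreducible_scalar[OF irreducible G_carrier dim_pos Kc] by blast
  \<comment> \<open>The scalar \<open>l\<close> is positive: \<open>l q\<close> equals \<open>p\<close> for the squared
    lengths \<open>q\<close> of \<open>x0\<close> and \<open>p\<close> of \<open>J x0\<close>.\<close>
  have JJl: "J (J x) = l \<cdot>\<^sub>v x" if x: "x \<in> carrier_vec n" for x unfolding JJ[OF x] l by (rule smult_one_mult_vec[OF x])
  define x0 :: "complex vec" where "x0 = unit_vec n 0"
  have x0: "x0 \<in> carrier_vec n" unfolding x0_def by simp
  have "x0 $ 0 = 1" "0\<^sub>v n $ 0 = (0 :: complex)" unfolding x0_def using dim_pos by auto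
  hence x00: "x0 \<noteq> 0\<^sub>v n" by (metis zero_neq_one)
  obtain q where q: "q > 0" "cnj_vec x0 \<bullet> (?H *\<^sub>v x0) = complex_of_real q" using hermitian_form_positive[OF fin x0 x00] by blast
  let ?y = "J x0"
  have y0: "?y \<noteq> 0\<^sub>v n"
  proof
    assume "?y = 0\<^sub>v n"
    hence z: "cnj_vec (B *\<^sub>v x0) = 0\<^sub>v n" using HJ[OF x0] mult_mat_zero_vec[OF Hc] by simp
    have "cnj_vec (cnj_vec (B *\<^sub>v x0)) = 0\<^sub>v n" unfolding z by (intro eq_vecI) auto
    hence "B *\<^sub>v x0 = 0\<^sub>v n" unfolding cnj_vec_cnj_vec .
    hence "Bi *\<^sub>v (B *\<^sub>v x0) = 0\<^sub>v n" using mult_mat_zero_vec[OF Bi(1)] by simp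
    hence "x0 = 0\<^sub>v n" using assoc_mult_mat_vec[OF Bi(1) Bc x0] x0 unfolding Bi(2) by simp
    thus False using x00 by simp
  qed
  obtain p where p: "p > 0" "cnj_vec ?y \<bullet> (?H *\<^sub>v ?y) = complex_of_real p" using hermitian_form_positive[OF fin Jc[OF x0] y0] by blast
  have pe: "complex_of_real p = cnj (?y \<bullet> (B *\<^sub>v x0))" using p(2) unfolding HJ[OF x0] cnj_scalar_prod[OF Jc[OF x0] Bx(1)[OF x0]] by simp
  have "l * complex_of_real q = cnj_vec x0 \<bullet> (l \<cdot>\<^sub>v (?H *\<^sub>v x0))"
    unfolding q(2)[symmetric] using x0 mult_mat_vec_carrier[OF Hc x0] by (intro scalar_prod_smult_distrib[symmetric]) auto
  also have "l \<cdot>\<^sub>v (?H *\<^sub>v x0) = ?H *\<^sub>v J ?y" unfolding JJl[OF x0] by (rule mult_mat_vec[OF Hc x0, symmetric])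
  also have "\<dots> = cnj_vec (B *\<^sub>v ?y)" by (rule HJ[OF Jc[OF x0]])
  also have "cnj_vec x0 \<bullet> \<dots> = cnj (x0 \<bullet> (B *\<^sub>v ?y))" by (rule cnj_scalar_prod[OF x0 Bx(1)[OF Jc[OF x0]]])
  also have "x0 \<bullet> (B *\<^sub>v ?y) = (transpose_mat B *\<^sub>v x0) \<bullet> ?y" by (rule transpose_vec_mult_scalar[OF Bc Jc[OF x0] x0, symmetric])
  also have "\<dots> = ?y \<bullet> (B *\<^sub>v x0)" unfolding sym by (rule comm_scalar_prod[OF Bx(1)[OF x0] Jc[OF x0]])
  finally have "l * complex_of_real q = complex_of_real p" unfolding pe .
  hence lr: "l = complex_of_real (p / q)" using q(1) by (simp add: field_simps)
  define s where "s = sqrt (p / q)"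
  have s: "s > 0" "l = complex_of_real s * complex_of_real s" unfolding lr s_def using p(1) q(1) by (auto simp flip: of_real_mult)
  define W where "W = {x \<in> carrier_vec n. J x = complex_of_real s \<cdot>\<^sub>v x}"
  have ii: "\<i> \<cdot>\<^sub>v x \<in> W \<longleftrightarrow> J x = complex_of_real (- s) \<cdot>\<^sub>v x" if x: "x \<in> carrier_vec n" for x
  proof -
    have "J (\<i> \<cdot>\<^sub>v x) = complex_of_real s \<cdot>\<^sub>v (\<i> \<cdot>\<^sub>v x) \<longleftrightarrow> (- \<i>) \<cdot>\<^sub>v J x = (- \<i>) \<cdot>\<^sub>v (complex_of_real (- s) \<cdot>\<^sub>v x)"
      unfolding Jsmult[OF x] by (simp add: smult_smult_assoc mult.commute)
    also have "\<dots> \<longleftrightarrow> J x = complex_of_real (- s) \<cdot>\<^sub>v x"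
    proof
      assume "(- \<i>) \<cdot>\<^sub>v J x = (- \<i>) \<cdot>\<^sub>v (complex_of_real (- s) \<cdot>\<^sub>v x)"
      hence "\<i> \<cdot>\<^sub>v ((- \<i>) \<cdot>\<^sub>v J x) = \<i> \<cdot>\<^sub>v ((- \<i>) \<cdot>\<^sub>v (complex_of_real (- s) \<cdot>\<^sub>v x))" by simp
      thus "J x = complex_of_real (- s) \<cdot>\<^sub>v x" by (simp add: smult_smult_assoc)
    qed simp
    finally show ?thesis unfolding W_def using x by simp
  qed
  have "real_form n W"
    unfolding real_form_def
  proof (intro conjI ballI allI impI)
    show "W \<subseteq> carrier_vec n" unfolding W_def by auto
    show "x + y \<in> W" if "x \<in> W" "y \<in> W" for x y
      using that unfolding W_def by (auto simp: Jadd smult_add_distrib_vec[of _ n])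
    show "complex_of_real c \<cdot>\<^sub>v x \<in> W" if "x \<in> W" for c x
      using that unfolding W_def by (auto simp: Jsmult smult_smult_assoc mult.commute)
    show "x = 0\<^sub>v n" if x: "x \<in> W" and ix: "\<i> \<cdot>\<^sub>v x \<in> W" for x
    proof (rule ccontr)
      assume nz: "x \<noteq> 0\<^sub>v n"
      have xc: "x \<in> carrier_vec n" using x unfolding W_def by simp
      have "complex_of_real s \<cdot>\<^sub>v x = complex_of_real (- s) \<cdot>\<^sub>v x" using x ix ii[OF xc] unfolding W_def by simp
      hence "complex_of_real s \<cdot>\<^sub>v x + complex_of_real s \<cdot>\<^sub>v x = complex_of_real s \<cdot>\<^sub>v x + complex_of_real (- s) \<cdot>\<^sub>v x" by simp
      hence "(complex_of_real s + complex_of_real s) \<cdot>\<^sub>v x = (complex_of_real s + complex_of_real (- s)) \<cdot>\<^sub>v x" unfolding add_smult_distrib_vec .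
      hence "(complex_of_real s + complex_of_real s) \<cdot>\<^sub>v x = 0\<^sub>v n" using xc by auto
      hence "complex_of_real s + complex_of_real s = 0" by (rule smult_vec_eq_zeroD[OF _ xc nz])
      thus False using s(1) by simp
    qed
    show "\<exists>x\<in>W. x \<noteq> 0\<^sub>v n"
    \<comment> \<open>\<open>J x0 + s x0\<close> is fixed by \<open>J / s\<close>; if it vanishes, then \<open>\<i>
      x0\<close> is fixed instead.\<close>
    proof (cases "J x0 + complex_of_real s \<cdot>\<^sub>v x0 = 0\<^sub>v n")
      case False
      have sc: "complex_of_real s \<cdot>\<^sub>v x0 \<in> carrier_vec n" using x0 by simp
      have "J (J x0 + complex_of_real s \<cdot>\<^sub>v x0) = l \<cdot>\<^sub>v x0 + complex_of_real s \<cdot>\<^sub>v J x0"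
        unfolding Jadd[OF Jc[OF x0] sc] JJl[OF x0] Jsmult[OF x0] by simp
      also have "\<dots> = complex_of_real s \<cdot>\<^sub>v (J x0 + complex_of_real s \<cdot>\<^sub>v x0)"
        unfolding s(2) using x0 Jc[OF x0] by (intro eq_vecI) (auto simp: algebra_simps)
      finally have "J x0 + complex_of_real s \<cdot>\<^sub>v x0 \<in> W" unfolding W_def using Jc[OF x0] sc by simp
      thus ?thesis using False by blast
    next
      case True
      have "J x0 = complex_of_real (- s) \<cdot>\<^sub>v x0"
      proof (rule eq_vecI)
        fix i assume "i < dim_vec (complex_of_real (- s) \<cdot>\<^sub>v x0)"
        hence i: "i < n" using x0 by simp
        have "(J x0 + complex_of_real s \<cdot>\<^sub>v x0) $ i = 0" unfolding True using i by simp
        hence "J x0 $ i + complex_of_real s * x0 $ i = 0" using i x0 Jc[OF x0] by simp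
        thus "J x0 $ i = (complex_of_real (- s) \<cdot>\<^sub>v x0) $ i" using i x0 by (simp add: add_eq_0_iff)
      qed (use x0 Jc[OF x0] in simp)
      hence "\<i> \<cdot>\<^sub>v x0 \<in> W" using ii[OF x0] by simp
      moreover have "\<i> \<cdot>\<^sub>v x0 \<noteq> 0\<^sub>v n" using smult_vec_eq_zeroD[OF _ x0 x00, of \<i>] by auto
      ultimately show ?thesis by blast
    qed
  qed
  moreover have "g *\<^sub>v w \<in> W" if g: "g \<in> G" and w: "w \<in> W" for g w
  proof -
    have wc: "w \<in> carrier_vec n" "J w = complex_of_real s \<cdot>\<^sub>v w" using w unfolding W_def by auto
    have "J (g *\<^sub>v w) = complex_of_real s \<cdot>\<^sub>v (g *\<^sub>v w)" unfolding Jg[OF g wc(1)] wc(2) by (rule mult_mat_vec[OF carrier[OF g] wc(1)])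
    thus ?thesis unfolding W_def using mult_mat_vec_carrier[OF carrier[OF g] wc(1)] by simp
  qed
  ultimately show thesis using that by blast
qed

text \<open>
  The group is finite by the absence of nonreal scalars, and its invariant form exists and is symmetric.
\<close>

theorem real_commutator_group_real_form:
  assumes unimod: "\<And>A. A \<in> G \<Longrightarrow> cmod (det A) = 1" and n: "n \<noteq> 1"
  obtains W where "real_form n W" "\<And>g w. g \<in> G \<Longrightarrow> w \<in> W \<Longrightarrow> g *\<^sub>v w \<in> W"
proof -
  have "c \<in> \<real>" if "c \<cdot>\<^sub>m 1\<^sub>m n \<in> G" for c using nonreal_scalar_dim_one[OF unimod that] n by blast
  hence fin: "finite G" using finite_if_real_scalars[OF unimod] by blast
  obtain B where B: "invariant_form B" "B \<noteq> 0\<^sub>m n n" using no_invariant_form_dim_one[OF fin] n by blast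
  have "transpose_mat B = B" using invariant_form_symmetric_or_skew[OF B] finite_not_skew[OF fin B] by blast
  from symmetric_form_real_form[OF fin B this] show thesis using that by blast
qed

end

section \<open>Rank one members of irreducible semigroups\<close>

text \<open>
  The vectors \<open>y\<close> with \<open>C * U * y \<in> W\<close> for all \<open>U\<close> in \<open>S\<close> form an invariant subspace, hence everything. Thus
  \<open>{y. C * y \<in> W}\<close> contains the range of every member of \<open>S\<close>; it is again invariant, and nonzero.
\<close>

lemma irreducible_annihilator:
  assumes irr: "irreducible_matrices n S" and S: "S \<subseteq> carrier_mat n n" and n: "n \<ge> 2"
    and closed: "\<And>A B. A \<in> S \<Longrightarrow> B \<in> S \<Longrightarrow> A * B \<in> S"
    and C: "C \<in> carrier_mat m n"
    and W: "0\<^sub>v m \<in> W" "\<And>x y. x \<in> W \<Longrightarrow> y \<in> W \<Longrightarrow> x + y \<in> W" "\<And>c x. x \<in> W \<Longrightarrow> c \<cdot>\<^sub>v x \<in> W"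
    and x: "x \<in> carrier_vec n" "x \<noteq> 0\<^sub>v n" "\<And>U. U \<in> S \<Longrightarrow> C *\<^sub>v (U *\<^sub>v x) \<in> W"
    and z: "z \<in> carrier_vec n"
  shows "C *\<^sub>v z \<in> W"
proof -
  let ?V = "{y \<in> carrier_vec n. \<forall>U\<in>S. C *\<^sub>v (U *\<^sub>v y) \<in> W}"
  have V: "?V = carrier_vec n"
  proof (rule irreducible_matricesD[OF irr, of _ x])
    show "?V \<subseteq> carrier_vec n" by blast
    show "u + v \<in> ?V" if uv: "u \<in> ?V" "v \<in> ?V" for u v
    proof -
      have c: "u \<in> carrier_vec n" "v \<in> carrier_vec n" using uv by auto
      have "C *\<^sub>v (U *\<^sub>v (u + v)) \<in> W" if U: "U \<in> S" for U
      proof -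
        have Uc: "U \<in> carrier_mat n n" using U S by blast
        show ?thesis
          unfolding mult_add_distrib_mat_vec[OF Uc c]
            mult_add_distrib_mat_vec[OF C mult_mat_vec_carrier[OF Uc c(1)] mult_mat_vec_carrier[OF Uc c(2)]]
          using uv U by (intro W(2)) auto
      qed
      thus ?thesis using c by simp
    qed
    show "a \<cdot>\<^sub>v u \<in> ?V" if u: "u \<in> ?V" for a u
    proof -
      have c: "u \<in> carrier_vec n" using u by auto
      have "C *\<^sub>v (U *\<^sub>v (a \<cdot>\<^sub>v u)) \<in> W" if U: "U \<in> S" for U
      proof -
        have Uc: "U \<in> carrier_mat n n" using U S by blast
        show ?thesis unfolding mult_mat_vec[OF Uc c] mult_mat_vec[OF C mult_mat_vec_carrier[OF Uc c]] using u U by (intro W(3)) auto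
      qed
      thus ?thesis using c by simp
    qed
    show "M *\<^sub>v u \<in> ?V" if M: "M \<in> S" and u: "u \<in> ?V" for M u
    proof -
      have Mc: "M \<in> carrier_mat n n" and uc: "u \<in> carrier_vec n" using M S u by auto
      have "C *\<^sub>v (U *\<^sub>v (M *\<^sub>v u)) \<in> W" if U: "U \<in> S" for U
      proof -
        have Uc: "U \<in> carrier_mat n n" using U S by blast
        show ?thesis using u closed[OF U M] unfolding assoc_mult_mat_vec[OF Uc Mc uc, symmetric] by blast
      qed
      thus ?thesis using mult_mat_vec_carrier[OF Mc uc] by simp
    qed
  qed (use x in auto)
  obtain B y where B: "B \<in> S" and y: "y \<in> carrier_vec n" "B *\<^sub>v y \<noteq> 0\<^sub>v n"
  proof (rule ccontr)
    assume "\<not> thesis"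
    hence z: "B *\<^sub>v y = 0\<^sub>v n" if "B \<in> S" "y \<in> carrier_vec n" for B y using that \<open>\<not> thesis\<close> \<open>\<And>B y. B \<in> S \<Longrightarrow> y \<in> carrier_vec n \<Longrightarrow> B *\<^sub>v y \<noteq> 0\<^sub>v n \<Longrightarrow> thesis\<close> by blast
    have "n = 1"
    proof (rule irreducible_scalars_dim_one[OF irr])
      fix M assume M: "M \<in> S"
      hence "M = 0\<^sub>m n n" using z S by (intro eq_zero_mat_by_mult_vec) auto
      also have "\<dots> = 0 \<cdot>\<^sub>m 1\<^sub>m n" by (intro eq_matI) auto
      finally show "\<exists>c. M = c \<cdot>\<^sub>m 1\<^sub>m n" by blast
    qed (use n in simp)
    thus False using n by simp
  qed
  have Bc: "B \<in> carrier_mat n n" using B S by blast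
  let ?V2 = "{y \<in> carrier_vec n. C *\<^sub>v y \<in> W}"
  have "?V2 = carrier_vec n"
  proof (rule irreducible_matricesD[OF irr, of _ "B *\<^sub>v y"])
    show "?V2 \<subseteq> carrier_vec n" by blast
    show "u + v \<in> ?V2" if "u \<in> ?V2" "v \<in> ?V2" for u v using that C W(2) by (auto simp: mult_add_distrib_mat_vec[of _ m n])
    show "a \<cdot>\<^sub>v u \<in> ?V2" if "u \<in> ?V2" for a u using that C W(3) by (auto simp: mult_mat_vec[of _ m n])
    show "M *\<^sub>v u \<in> ?V2" if M: "M \<in> S" and u: "u \<in> ?V2" for M u
    proof -
      have "M \<in> carrier_mat n n" "u \<in> ?V" using M S u V by auto
      thus ?thesis using M mult_mat_vec_carrier[of M n n u] by blast
    qed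
    show "B *\<^sub>v y \<in> ?V2" using B y(1) V mult_mat_vec_carrier[OF Bc y(1)] by blast
  qed (rule y(2))
  thus ?thesis using z by blast
qed

lemma scalar_prod_as_mult_vec:
  fixes h z :: "complex vec"
  assumes "h \<in> carrier_vec n" "z \<in> carrier_vec n"
  shows "(mat_of_row h *\<^sub>v z) = vec 1 (\<lambda>_. h \<bullet> z)"
  using assms by (intro eq_vecI) auto

lemma irreducible_functional_zero:
  fixes h x z :: "complex vec"
  assumes irr: "irreducible_matrices n S" and S: "S \<subseteq> carrier_mat n n" and n: "n \<ge> 2"
    and closed: "\<And>A B. A \<in> S \<Longrightarrow> B \<in> S \<Longrightarrow> A * B \<in> S"
    and h: "h \<in> carrier_vec n"
    and x: "x \<in> carrier_vec n" "x \<noteq> 0\<^sub>v n" "\<And>U. U \<in> S \<Longrightarrow> h \<bullet> (U *\<^sub>v x) = 0"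
    and z: "z \<in> carrier_vec n"
  shows "h \<bullet> z = 0"
proof -
  have "mat_of_row h *\<^sub>v z \<in> {0\<^sub>v 1}"
  proof (rule irreducible_annihilator[OF irr S n closed, of _ 1 _ x])
    show "mat_of_row h \<in> carrier_mat 1 n" using h by auto
    show "mat_of_row h *\<^sub>v (U *\<^sub>v x) \<in> {0\<^sub>v 1}" if U: "U \<in> S" for U
    proof -
      have "U *\<^sub>v x \<in> carrier_vec n" using U S x(1) by (auto intro: mult_mat_vec_carrier)
      thus ?thesis using scalar_prod_as_mult_vec[OF h] x(3)[OF U] by auto
    qed
  qed (use x z in auto)
  hence "vec 1 (\<lambda>_. h \<bullet> z) $ 0 = 0\<^sub>v 1 $ 0" using scalar_prod_as_mult_vec[OF h z] by simp
  thus ?thesis by simp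
qed

text \<open>
  The rank one matrix \<open>x f\<^sup>T\<close>.
\<close>

definition outer :: "nat \<Rightarrow> complex vec \<Rightarrow> complex vec \<Rightarrow> complex mat" where
  "outer n x f = mat n n (\<lambda>(i,j). x $ i * f $ j)"

lemma outer_carrier [simp]: "outer n x f \<in> carrier_mat n n" unfolding outer_def by simp

lemma outer_mult_vec:
  assumes "x \<in> carrier_vec n" "f \<in> carrier_vec n" "v \<in> carrier_vec n"
  shows "outer n x f *\<^sub>v v = (f \<bullet> v) \<cdot>\<^sub>v x"
  using assms unfolding outer_def by (intro eq_vecI) (auto simp: scalar_prod_def sum_distrib_left mult_ac)

lemma mult_outer:
  assumes M: "M \<in> carrier_mat n n" and x: "x \<in> carrier_vec n" and f: "f \<in> carrier_vec n"
  shows "M * outer n x f = outer n (M *\<^sub>v x) f"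
proof (rule eq_mat_by_mult_vec)
  fix v :: "complex vec" assume v: "v \<in> carrier_vec n"
  have "(M * outer n x f) *\<^sub>v v = M *\<^sub>v ((f \<bullet> v) \<cdot>\<^sub>v x)"
    unfolding assoc_mult_mat_vec[OF M outer_carrier v] outer_mult_vec[OF x f v] ..
  thus "(M * outer n x f) *\<^sub>v v = outer n (M *\<^sub>v x) f *\<^sub>v v"
    unfolding mult_mat_vec[OF M x] outer_mult_vec[OF mult_mat_vec_carrier[OF M x] f v] .
qed (use M in \<open>auto intro!: mult_carrier_mat[of _ n n]\<close>)

lemma outer_mult:
  assumes M: "M \<in> carrier_mat n n" and x: "x \<in> carrier_vec n" and f: "f \<in> carrier_vec n"
  shows "outer n x f * M = outer n x (transpose_mat M *\<^sub>v f)"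
proof (rule eq_mat_by_mult_vec)
  fix v :: "complex vec" assume v: "v \<in> carrier_vec n"
  have tf: "transpose_mat M *\<^sub>v f \<in> carrier_vec n" using M f by (intro mult_mat_vec_carrier[of _ n n]) auto
  have "(outer n x f * M) *\<^sub>v v = (f \<bullet> (M *\<^sub>v v)) \<cdot>\<^sub>v x"
    unfolding assoc_mult_mat_vec[OF outer_carrier M v] by (rule outer_mult_vec[OF x f mult_mat_vec_carrier[OF M v]])
  thus "(outer n x f * M) *\<^sub>v v = outer n x (transpose_mat M *\<^sub>v f) *\<^sub>v v"
    unfolding outer_mult_vec[OF x tf v] transpose_vec_mult_scalar[OF M v f] .
qed (use M in \<open>auto intro!: mult_carrier_mat[of _ n n]\<close>)

lemma trace_outer:
  assumes "x \<in> carrier_vec n" "f \<in> carrier_vec n"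
  shows "mat_trace (outer n x f) = f \<bullet> x"
  using assms unfolding outer_def mat_trace_def by (simp add: scalar_prod_def atLeast0LessThan mult.commute)

lemma outer_outer:
  assumes "x \<in> carrier_vec n" "f \<in> carrier_vec n" "y \<in> carrier_vec n" "g \<in> carrier_vec n"
  shows "outer n x f * outer n y g = (f \<bullet> y) \<cdot>\<^sub>m outer n x g"
  unfolding mult_outer[OF outer_carrier assms(3,4)] outer_mult_vec[OF assms(1-3)]
  using assms unfolding outer_def by (intro eq_matI) auto

lemma trace_commutator_square:
  assumes A: "A \<in> carrier_mat n n" and B: "B \<in> carrier_mat n n"
  shows "mat_trace ((A * B - B * A) * (A * B - B * A)) =
    mat_trace ((A * B) * (A * B)) - mat_trace ((A * B) * (B * A)) - mat_trace ((B * A) * (A * B)) + mat_trace ((B * A) * (B * A))"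
proof -
  define E F where "E = A * B" and "F = B * A"
  have c: "E \<in> carrier_mat n n" "F \<in> carrier_mat n n" unfolding E_def F_def using A B by (auto intro!: mult_carrier_mat[of _ n n])
  have pc: "E * E \<in> carrier_mat n n" "E * F \<in> carrier_mat n n" "F * E \<in> carrier_mat n n" "F * F \<in> carrier_mat n n" "E - F \<in> carrier_mat n n"
    using c by (auto intro!: mult_carrier_mat[of _ n n] minus_carrier_mat)
  have "(E - F) * (E - F) = (E * E - F * E) - (E * F - F * F)"
    using mult_diff_cancel_left(1)[OF pc(5) c] mult_diff_cancel_left(2)[OF c(1) c] mult_diff_cancel_left(2)[OF c(2) c] by simp
  hence "mat_trace ((E - F) * (E - F)) = (mat_trace (E * E) - mat_trace (F * E)) - (mat_trace (E * F) - mat_trace (F * F))"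
    using pc by (simp add: mat_trace_diff[of _ n] minus_carrier_mat)
  thus ?thesis unfolding E_def F_def by simp
qed

text \<open>
  Half the trace of the squared commutator of \<open>x f\<^sup>T\<close> and \<open>y g\<^sup>T\<close>.
\<close>

lemma rank_one_commutator:
  assumes c: "x \<in> carrier_vec n" "f \<in> carrier_vec n" "y \<in> carrier_vec n" "g \<in> carrier_vec n"
    and real: "has_real_spectrum (outer n x f * outer n y g - outer n y g * outer n x f)"
  obtains t where "t \<ge> 0" "((f \<bullet> y) * (g \<bullet> x)) * ((f \<bullet> y) * (g \<bullet> x) - (f \<bullet> x) * (g \<bullet> y)) = complex_of_real t"
proof -
  let ?A = "outer n x f" and ?B = "outer n y g"
  have AB: "?A * ?B = (f \<bullet> y) \<cdot>\<^sub>m outer n x g" and BA: "?B * ?A = (g \<bullet> x) \<cdot>\<^sub>m outer n y f"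
    using c by (auto intro: outer_outer)
  have tr: "mat_trace ((s \<cdot>\<^sub>m outer n u h) * (t \<cdot>\<^sub>m outer n v k)) = s * t * (h \<bullet> v) * (k \<bullet> u)"
    if "u \<in> carrier_vec n" "h \<in> carrier_vec n" "v \<in> carrier_vec n" "k \<in> carrier_vec n" for s t u h v k
  proof -
    have "(s \<cdot>\<^sub>m outer n u h) * (t \<cdot>\<^sub>m outer n v k) = (s * t) \<cdot>\<^sub>m ((h \<bullet> v) \<cdot>\<^sub>m outer n u k)"
      using smult_mult_smult[OF outer_carrier outer_carrier, where n = n] outer_outer[OF that] by simp
    thus ?thesis using trace_outer[OF that(1,4)] by (simp add: mat_trace_smult[of _ n])
  qed
  have K: "?A * ?B - ?B * ?A \<in> carrier_mat n n" by (auto intro!: minus_carrier_mat mult_carrier_mat[of _ n n])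
  obtain t where t: "t \<ge> 0" "mat_trace ((?A * ?B - ?B * ?A) * (?A * ?B - ?B * ?A)) = complex_of_real t"
    using real_spectrum_trace_square[OF K real] by metis
  have "mat_trace ((?A * ?B - ?B * ?A) * (?A * ?B - ?B * ?A)) = 2 * (((f \<bullet> y) * (g \<bullet> x)) * ((f \<bullet> y) * (g \<bullet> x) - (f \<bullet> x) * (g \<bullet> y)))"
    unfolding trace_commutator_square[OF outer_carrier outer_carrier] unfolding AB BA using c by (simp add: tr algebra_simps)
  hence "2 * (((f \<bullet> y) * (g \<bullet> x)) * ((f \<bullet> y) * (g \<bullet> x) - (f \<bullet> x) * (g \<bullet> y))) = complex_of_real t" using t(2) by simp
  hence "((f \<bullet> y) * (g \<bullet> x)) * ((f \<bullet> y) * (g \<bullet> x) - (f \<bullet> x) * (g \<bullet> y)) = complex_of_real (t / 2)" by (simp add: field_simps)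
  thus thesis using that[of "t / 2"] t(1) by simp
qed

lemma real_if_square_nonneg:
  assumes "a * a = complex_of_real u" "u \<ge> 0"
  shows "a \<in> \<real>"
proof -
  have "(a - complex_of_real (sqrt u)) * (a + complex_of_real (sqrt u)) = 0"
    using assms by (simp add: algebra_simps flip: of_real_mult)
  hence "a = complex_of_real (sqrt u) \<or> a = complex_of_real (- sqrt u)" by (auto simp: eq_neg_iff_add_eq_0)
  thus ?thesis by auto
qed

text \<open>
  Suppose that \<open>a = f \<bullet> x\<close> is not real. As \<open>A = x f\<^sup>T\<close> satisfies \<open>A\<^sup>2 = a A\<close>, the number
  \<open>p (p - q)\<close> of \<open>rank_one_commutator\<close> and its multiple by \<open>a\<^sup>2\<close> are both nonnegative, so it vanishes. Applied
  to the rank one matrices \<open>U A V\<close> this makes the kernel of \<open>f\<close> invariant under the semigroup. A nonzero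
  linear functional in dimension at least two has a nontrivial kernel, so irreducibility is violated.
\<close>

lemma real_rank_one_corner:
  assumes irr: "irreducible_matrices n T" and sg: "matrix_semigroup n T" and n: "n \<ge> 2"
    and real: "\<And>A B. A \<in> T \<Longrightarrow> B \<in> T \<Longrightarrow> has_real_spectrum (A * B - B * A)"
    and x: "x \<in> carrier_vec n" and f: "f \<in> carrier_vec n" and A: "outer n x f \<in> T"
  shows "f \<bullet> x \<in> \<real>"
proof (rule ccontr)
  define a where "a = f \<bullet> x"
  assume "f \<bullet> x \<notin> \<real>"
  hence a: "a \<notin> \<real>" unfolding a_def .
  hence a0: "a \<noteq> 0" by auto
  have T: "T \<subseteq> carrier_mat n n" and closed: "\<And>A B. A \<in> T \<Longrightarrow> B \<in> T \<Longrightarrow> A * B \<in> T" using sg unfolding matrix_semigroup_def by auto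
  have Tc: "U \<in> carrier_mat n n" if "U \<in> T" for U using that T by blast
  have Uv: "U *\<^sub>v v \<in> carrier_vec n" "transpose_mat U *\<^sub>v v \<in> carrier_vec n" if "U \<in> T" "v \<in> carrier_vec n" for U v
    using mult_mat_vec_carrier[OF Tc[OF that(1)] that(2)] mult_mat_vec_carrier[of "transpose_mat U" n n v] Tc[OF that(1)] that(2) by auto
  have adj: "(transpose_mat U *\<^sub>v h) \<bullet> v = h \<bullet> (U *\<^sub>v v)" if "U \<in> T" "h \<in> carrier_vec n" "v \<in> carrier_vec n" for U h v
    using transpose_vec_mult_scalar[OF Tc[OF that(1)] that(3,2)] .
  have x0: "x \<noteq> 0\<^sub>v n" using a0 f unfolding a_def by auto
  \<comment> \<open>Nonnegativity of \<open>p (p - q)\<close> and of \<open>a\<^sup>2 p (p - q)\<close>, where \<open>a\<^sup>2\<close> is not a nonnegative real.\<close>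
  have dich: "(h \<bullet> y) * (g \<bullet> u) = 0 \<or> (h \<bullet> y) * (g \<bullet> u) = (h \<bullet> u) * (g \<bullet> y)"
    if c: "u \<in> carrier_vec n" "h \<in> carrier_vec n" "y \<in> carrier_vec n" "g \<in> carrier_vec n"
      and m: "outer n u h \<in> T" "outer n (a \<cdot>\<^sub>v u) h \<in> T" "outer n y g \<in> T" for u h y g
  proof (rule ccontr)
    assume neg: "\<not> ?thesis"
    let ?p = "(h \<bullet> y) * (g \<bullet> u)" and ?q = "(h \<bullet> u) * (g \<bullet> y)"
    obtain t where t: "t \<ge> 0" "?p * (?p - ?q) = complex_of_real t"
      using rank_one_commutator[OF c real[OF m(1,3)]] by blast
    have ac: "a \<cdot>\<^sub>v u \<in> carrier_vec n" using c(1) by simp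
    obtain t' where t': "t' \<ge> 0" "((h \<bullet> y) * (g \<bullet> (a \<cdot>\<^sub>v u))) * ((h \<bullet> y) * (g \<bullet> (a \<cdot>\<^sub>v u)) - (h \<bullet> (a \<cdot>\<^sub>v u)) * (g \<bullet> y)) = complex_of_real t'"
      using rank_one_commutator[OF ac c(2-4) real[OF m(2,3)]] by blast
    have "complex_of_real t' = (a * a) * complex_of_real t"
      unfolding t'(2)[symmetric] t(2)[symmetric] using c by (simp add: algebra_simps)
    moreover have "t \<noteq> 0"
    proof
      assume "t = 0"
      hence "?p * (?p - ?q) = 0" using t(2) by simp
      thus False using neg by (simp only: mult_eq_0_iff right_minus_eq) blast
    qed
    ultimately have "a * a = complex_of_real (t' / t)" by (simp add: field_simps)
    thus False using real_if_square_nonneg[of a "t' / t"] t(1) t'(1) a by simp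
  qed
  define \<alpha> where "\<alpha> U = f \<bullet> (U *\<^sub>v x)" for U
  have UAV: "outer n (U *\<^sub>v x) (transpose_mat V *\<^sub>v f) \<in> T" if "U \<in> T" "V \<in> T" for U V
    using closed[OF closed[OF that(1) A] that(2)] unfolding mult_outer[OF Tc[OF that(1)] x f] outer_mult[OF Tc[OF that(2)] Uv(1)[OF that(1) x] f] .
  have AA: "outer n (a \<cdot>\<^sub>v x) f \<in> T"
    using closed[OF A A] unfolding mult_outer[OF outer_carrier x f] outer_mult_vec[OF x f x] a_def .
  have \<alpha>A: "\<alpha> (outer n x f) \<noteq> 0" unfolding \<alpha>_def outer_mult_vec[OF x f x] using a0 f x unfolding a_def by simp
  \<comment> \<open>For \<open>P\<close> with \<open>\<alpha> P = 0\<close> the term \<open>q\<close> drops out of the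
    dichotomy for \<open>A P\<close>, respectively \<open>P A\<close>, and any \<open>U A V\<close>.\<close>
  have zeroL: "f \<bullet> (P *\<^sub>v z) = 0" if P: "P \<in> T" "\<alpha> P = 0" and z: "z \<in> carrier_vec n" for P z
  proof -
    let ?h = "transpose_mat P *\<^sub>v f"
    have hc: "?h \<in> carrier_vec n" by (rule Uv(2)[OF P(1) f])
    have hx: "?h \<bullet> x = 0" using adj[OF P(1) f x] P(2) unfolding \<alpha>_def by simp
    have m1: "outer n x ?h \<in> T" using closed[OF A P(1)] unfolding outer_mult[OF Tc[OF P(1)] x f] .
    have m2: "outer n (a \<cdot>\<^sub>v x) ?h \<in> T" using closed[OF AA P(1)] outer_mult[OF Tc[OF P(1)] _ f, of "a \<cdot>\<^sub>v x"] x by simp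
    have "?h \<bullet> (U *\<^sub>v x) = 0" if U: "U \<in> T" for U
    proof -
      let ?g = "transpose_mat (outer n x f) *\<^sub>v f"
      have "(?h \<bullet> (U *\<^sub>v x)) * (?g \<bullet> x) = 0"
        using dich[OF x hc Uv(1)[OF U x] Uv(2)[OF A f] m1 m2 UAV[OF U A]] hx by auto
      moreover have "?g \<bullet> x \<noteq> 0" using adj[OF A f x] \<alpha>A unfolding \<alpha>_def by simp
      ultimately show ?thesis by simp
    qed
    hence "?h \<bullet> z = 0" using irreducible_functional_zero[OF irr T n closed hc x x0 _ z] by blast
    thus ?thesis using adj[OF P(1) f z] by simp
  qed
  have zeroR: "P *\<^sub>v x = 0\<^sub>v n" if P: "P \<in> T" "\<alpha> P = 0" for P
  proof (rule ccontr)
    assume nz: "P *\<^sub>v x \<noteq> 0\<^sub>v n"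
    have Px: "P *\<^sub>v x \<in> carrier_vec n" by (rule Uv(1)[OF P(1) x])
    have m1: "outer n (P *\<^sub>v x) f \<in> T" using closed[OF P(1) A] unfolding mult_outer[OF Tc[OF P(1)] x f] .
    have m2: "outer n (a \<cdot>\<^sub>v (P *\<^sub>v x)) f \<in> T"
      using closed[OF P(1) AA] mult_outer[OF Tc[OF P(1)] _ f, of "a \<cdot>\<^sub>v x"] x unfolding mult_mat_vec[OF Tc[OF P(1)] x] by simp
    have "f \<bullet> (V *\<^sub>v (P *\<^sub>v x)) = 0" if V: "V \<in> T" for V
    proof -
      let ?g = "transpose_mat V *\<^sub>v f"
      have "(f \<bullet> (outer n x f *\<^sub>v x)) * (?g \<bullet> (P *\<^sub>v x)) = 0"
        using dich[OF Px f Uv(1)[OF A x] Uv(2)[OF V f] m1 m2 UAV[OF A V]] P(2) unfolding \<alpha>_def by auto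
      hence "?g \<bullet> (P *\<^sub>v x) = 0" using \<alpha>A unfolding \<alpha>_def by simp
      thus ?thesis using adj[OF V f Px] by simp
    qed
    hence "f \<bullet> x = 0" using irreducible_functional_zero[OF irr T n closed f Px nz _ x] by blast
    thus False using a0 unfolding a_def by simp
  qed
  have eig: "\<exists>c. \<forall>z\<in>carrier_vec n. f \<bullet> (V *\<^sub>v z) = c * (f \<bullet> z)" if V: "V \<in> T" for V
  proof (cases "\<alpha> V = 0")
    case True
    thus ?thesis using zeroL[OF V True] by (intro exI[of _ 0]) auto
  next
    case False
    let ?g = "transpose_mat V *\<^sub>v f"
    let ?h = "\<alpha> V \<cdot>\<^sub>v f + (- a) \<cdot>\<^sub>v ?g"
    have gc: "?g \<in> carrier_vec n" by (rule Uv(2)[OF V f])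
    have hc: "?h \<in> carrier_vec n" using f gc by simp
    have hz: "?h \<bullet> z = \<alpha> V * (f \<bullet> z) - a * (f \<bullet> (V *\<^sub>v z))" if z: "z \<in> carrier_vec n" for z
      using f gc z by (subst add_scalar_prod_distrib[of _ n]) (auto simp: adj[OF V f z])
    have "?h \<bullet> (U *\<^sub>v x) = 0" if U: "U \<in> T" for U
    proof (cases "\<alpha> U = 0")
      case True
      have "V *\<^sub>v (U *\<^sub>v x) = 0\<^sub>v n" unfolding zeroR[OF U True] by (rule mult_mat_zero_vec[OF Tc[OF V]])
      hence "f \<bullet> (V *\<^sub>v (U *\<^sub>v x)) = 0" using f by simp
      thus ?thesis unfolding hz[OF Uv(1)[OF U x]] using True unfolding \<alpha>_def by simp
    next
      case ne: False
      have "(f \<bullet> (U *\<^sub>v x)) * (?g \<bullet> x) = 0 \<or> (f \<bullet> (U *\<^sub>v x)) * (?g \<bullet> x) = (f \<bullet> x) * (?g \<bullet> (U *\<^sub>v x))"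
        by (rule dich[OF x f Uv(1)[OF U x] gc A AA UAV[OF U V]])
      thus ?thesis unfolding hz[OF Uv(1)[OF U x]] using ne False adj[OF V f x] adj[OF V f Uv(1)[OF U x]]
        unfolding \<alpha>_def a_def by (auto simp: mult.commute)
    qed
    hence h0: "?h \<bullet> z = 0" if "z \<in> carrier_vec n" for z using irreducible_functional_zero[OF irr T n closed hc x x0 _ that] by blast
    have "f \<bullet> (V *\<^sub>v z) = (\<alpha> V / a) * (f \<bullet> z)" if z: "z \<in> carrier_vec n" for z
      using h0[OF z] a0 unfolding hz[OF z] by (simp add: field_simps)
    thus ?thesis by blast
  qed
  define z0 :: "complex vec" where "z0 = (if f $ 0 = 0 then unit_vec n 0 else f $ 1 \<cdot>\<^sub>v unit_vec n 0 + (- f $ 0) \<cdot>\<^sub>v unit_vec n 1)"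
  have z0: "z0 \<in> carrier_vec n" unfolding z0_def by simp
  have z0n: "z0 \<noteq> 0\<^sub>v n"
  proof
    assume e: "z0 = 0\<^sub>v n"
    have "z0 $ 0 = 0" "z0 $ 1 = 0" unfolding e using n by auto
    thus False unfolding z0_def using n by (auto split: if_splits)
  qed
  have fz0: "f \<bullet> z0 = 0"
  proof (cases "f $ 0 = 0")
    case True
    thus ?thesis unfolding z0_def using n f by simp
  next
    case False
    have "f \<bullet> (f $ 1 \<cdot>\<^sub>v unit_vec n 0 + (- f $ 0) \<cdot>\<^sub>v unit_vec n 1) = 0"
      using n f by (subst scalar_prod_add_distrib[of _ n]) auto
    thus ?thesis unfolding z0_def using False by simp
  qed
  have "{z \<in> carrier_vec n. f \<bullet> z = 0} = carrier_vec n"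
  proof (rule irreducible_matricesD[OF irr, of _ z0])
    show "u + v \<in> {z \<in> carrier_vec n. f \<bullet> z = 0}" if "u \<in> {z \<in> carrier_vec n. f \<bullet> z = 0}" "v \<in> {z \<in> carrier_vec n. f \<bullet> z = 0}" for u v
      using that f by (auto simp: scalar_prod_add_distrib[of _ n])
    show "c \<cdot>\<^sub>v u \<in> {z \<in> carrier_vec n. f \<bullet> z = 0}" if "u \<in> {z \<in> carrier_vec n. f \<bullet> z = 0}" for c u
      using that f by auto
    show "M *\<^sub>v u \<in> {z \<in> carrier_vec n. f \<bullet> z = 0}" if M: "M \<in> T" and u: "u \<in> {z \<in> carrier_vec n. f \<bullet> z = 0}" for M u
      using eig[OF M] u Uv(1)[OF M] by auto
  qed (use z0 z0n fz0 in auto)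
  hence "f \<bullet> x = 0" using x by blast
  thus False using a0 unfolding a_def by simp
qed

section \<open>Closed cones of matrices and their unimodular groups\<close>

text \<open>
  The hypotheses of the theorem: an irreducible semigroup whose commutators have real spectra.
\<close>

definition rc_semigroup :: "nat \<Rightarrow> complex mat set \<Rightarrow> bool" where
  "rc_semigroup n S \<longleftrightarrow> matrix_semigroup n S \<and> irreducible_matrices n S \<and>
     (\<forall>A\<in>S. \<forall>B\<in>S. has_real_spectrum (A * B - B * A))"

lemma rc_semigroupD:
  assumes "rc_semigroup n S"
  shows "S \<subseteq> carrier_mat n n" "\<And>A B. A \<in> S \<Longrightarrow> B \<in> S \<Longrightarrow> A * B \<in> S" "irreducible_matrices n S"
    "\<And>A B. A \<in> S \<Longrightarrow> B \<in> S \<Longrightarrow> has_real_spectrum (A * B - B * A)" "\<And>A. A \<in> S \<Longrightarrow> A \<in> carrier_mat n n"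
  using assms unfolding rc_semigroup_def matrix_semigroup_def by auto

definition nonneg_cone :: "complex mat set \<Rightarrow> complex mat set" where
  "nonneg_cone S = {complex_of_real c \<cdot>\<^sub>m M | c M. c \<ge> 0 \<and> M \<in> S}"

text \<open>
  The closure in the space of matrices, in terms of the largest distance between entries.
\<close>

definition mclosure :: "nat \<Rightarrow> complex mat set \<Rightarrow> complex mat set" where
  "mclosure n S = {M \<in> carrier_mat n n. \<forall>e>0. \<exists>N\<in>S. \<forall>i<n. \<forall>j<n. cmod (N $$ (i,j) - M $$ (i,j)) < e}"

lemma mclosure_sequence:
  assumes S: "S \<subseteq> carrier_mat n n" and M: "M \<in> mclosure n S"
  obtains P where "\<And>k. P k \<in> S" "mat_lim n n P M"
proof -
  have "\<forall>k. \<exists>N\<in>S. \<forall>i<n. \<forall>j<n. cmod (N $$ (i,j) - M $$ (i,j)) < 1 / real (Suc k)"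
    using M unfolding mclosure_def by auto
  then obtain P where P: "\<And>k. P k \<in> S" "\<And>k i j. i < n \<Longrightarrow> j < n \<Longrightarrow> cmod (P k $$ (i,j) - M $$ (i,j)) < 1 / real (Suc k)" by metis
  have "(\<lambda>k. P k $$ (i,j)) \<longlonglongrightarrow> M $$ (i,j)" if ij: "i < n" "j < n" for i j
  proof -
    have "(\<lambda>k. P k $$ (i,j) - M $$ (i,j)) \<longlonglongrightarrow> 0"
      using LIMSEQ_Suc[OF lim_1_over_n] by (rule tendsto_null_comparison) (use P(2)[OF ij] in \<open>auto intro: less_imp_le\<close>)
    thus ?thesis by (rule LIM_zero_cancel)
  qed
  hence "mat_lim n n P M" unfolding mat_lim_def using P(1) S M unfolding mclosure_def by auto
  thus thesis using P(1) that by blast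
qed

lemma mclosure_subset: "S \<subseteq> carrier_mat n n \<Longrightarrow> S \<subseteq> mclosure n S"
  unfolding mclosure_def by force

lemma mclosure_closed:
  assumes P: "\<And>k. P k \<in> mclosure n S" and lim: "mat_lim n n P M"
  shows "M \<in> mclosure n S"
  unfolding mclosure_def
proof (intro CollectI conjI allI impI)
  show "M \<in> carrier_mat n n" using mat_lim_carrier[OF lim] by simp
  fix e :: real assume e: "e > 0"
  have "\<forall>p\<in>{..<n} \<times> {..<n}. \<forall>\<^sub>F k in sequentially. dist (P k $$ p) (M $$ p) < e / 2"
  proof
    fix p assume "p \<in> {..<n} \<times> {..<n}"
    hence "(\<lambda>k. P k $$ p) \<longlonglongrightarrow> M $$ p" using lim unfolding mat_lim_def by auto
    thus "\<forall>\<^sub>F k in sequentially. dist (P k $$ p) (M $$ p) < e / 2" by (rule tendstoD[OF _ half_gt_zero[OF e]])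
  qed
  hence "\<forall>\<^sub>F k in sequentially. \<forall>p\<in>{..<n} \<times> {..<n}. dist (P k $$ p) (M $$ p) < e / 2"
    by (intro eventually_ball_finite) auto
  then obtain k where k: "\<forall>p\<in>{..<n} \<times> {..<n}. dist (P k $$ p) (M $$ p) < e / 2"
    using eventually_happens'[OF sequentially_bot] by blast
  obtain N where N: "N \<in> S" "\<And>i j. i < n \<Longrightarrow> j < n \<Longrightarrow> cmod (N $$ (i,j) - P k $$ (i,j)) < e / 2"
    using P[of k] half_gt_zero[OF e] unfolding mclosure_def by blast
  have "cmod (N $$ (i,j) - M $$ (i,j)) < e" if "i < n" "j < n" for i j
  proof -
    have "dist (N $$ (i,j)) (M $$ (i,j)) < e"
    proof (rule dist_triangle_half_l)
      show "dist (N $$ (i,j)) (P k $$ (i,j)) < e / 2" unfolding dist_norm by (rule N(2)[OF that])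
      show "dist (M $$ (i,j)) (P k $$ (i,j)) < e / 2" unfolding dist_commute[of "M $$ (i,j)"] using k that by blast
    qed
    thus ?thesis by (simp add: dist_norm)
  qed
  thus "\<exists>N\<in>S. \<forall>i<n. \<forall>j<n. cmod (N $$ (i,j) - M $$ (i,j)) < e" using N(1) by blast
qed

lemma mclosure_mem:
  assumes "S \<subseteq> carrier_mat n n" "\<And>k. P k \<in> S" "mat_lim n n P M"
  shows "M \<in> mclosure n S"
  using mclosure_closed[OF _ assms(3)] mclosure_subset[OF assms(1)] assms(2) by blast

definition closed_cone_semigroup :: "nat \<Rightarrow> complex mat set \<Rightarrow> bool" where
  "closed_cone_semigroup n T \<longleftrightarrow> rc_semigroup n T \<and>
     (\<forall>c M. c \<ge> 0 \<longrightarrow> M \<in> T \<longrightarrow> complex_of_real c \<cdot>\<^sub>m M \<in> T) \<and>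
     (\<forall>P M. (\<forall>k. P k \<in> T) \<longrightarrow> mat_lim n n P M \<longrightarrow> M \<in> T)"

lemma closed_cone_semigroupD:
  assumes "closed_cone_semigroup n T"
  shows "rc_semigroup n T" "\<And>c M. c \<ge> 0 \<Longrightarrow> M \<in> T \<Longrightarrow> complex_of_real c \<cdot>\<^sub>m M \<in> T"
    "\<And>P M. (\<And>k. P k \<in> T) \<Longrightarrow> mat_lim n n P M \<Longrightarrow> M \<in> T"
  using assms unfolding closed_cone_semigroup_def by blast+

lemma smult_commutator:
  fixes A B :: "complex mat"
  assumes "A \<in> carrier_mat n n" "B \<in> carrier_mat n n"
  shows "(c \<cdot>\<^sub>m A) * (d \<cdot>\<^sub>m B) - (d \<cdot>\<^sub>m B) * (c \<cdot>\<^sub>m A) = (c * d) \<cdot>\<^sub>m (A * B - B * A)"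
  using assms mat_regroup(4)[of "A * B" n "B * A" "A * B" "c * d"]
  by (simp add: smult_mult_smult[of _ n] mult.commute mult_carrier_mat[of _ n n])

lemma commutator_carrier:
  fixes A B :: "complex mat"
  assumes "A \<in> carrier_mat n n" "B \<in> carrier_mat n n"
  shows "A * B - B * A \<in> carrier_mat n n"
  using assms by (auto intro!: minus_carrier_mat mult_carrier_mat[of _ n n])

lemma rc_semigroup_cone:
  assumes S: "rc_semigroup n S"
  shows "rc_semigroup n (nonneg_cone S)"
  unfolding rc_semigroup_def matrix_semigroup_def
proof (intro conjI ballI)
  note D = rc_semigroupD[OF S]
  show "nonneg_cone S \<subseteq> carrier_mat n n" using D(1) unfolding nonneg_cone_def by auto
  fix A B assume "A \<in> nonneg_cone S" "B \<in> nonneg_cone S"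
  then obtain c d M N where M: "M \<in> S" "c \<ge> 0" "A = complex_of_real c \<cdot>\<^sub>m M" and N: "N \<in> S" "d \<ge> 0" "B = complex_of_real d \<cdot>\<^sub>m N"
    unfolding nonneg_cone_def by blast
  note Mc = D(5)[OF M(1)] D(5)[OF N(1)]
  have "A * B = complex_of_real (c * d) \<cdot>\<^sub>m (M * N)" unfolding M(3) N(3) smult_mult_smult[OF Mc] by simp
  thus "A * B \<in> nonneg_cone S" unfolding nonneg_cone_def using D(2)[OF M(1) N(1)] M(2) N(2) by (metis (mono_tags, lifting) mem_Collect_eq mult_nonneg_nonneg)
  have "A * B - B * A = complex_of_real (c * d) \<cdot>\<^sub>m (M * N - N * M)" unfolding M(3) N(3) smult_commutator[OF Mc] by simp
  thus "has_real_spectrum (A * B - B * A)"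
    using has_real_spectrum_smult[OF commutator_carrier[OF Mc] D(4)[OF M(1) N(1)], of "c * d"] by (simp del: of_real_mult)
next
  note D = rc_semigroupD[OF S]
  have "S \<subseteq> nonneg_cone S"
  proof
    fix M assume M: "M \<in> S"
    have "M = complex_of_real 1 \<cdot>\<^sub>m M" by (intro eq_matI) auto
    thus "M \<in> nonneg_cone S" unfolding nonneg_cone_def using M by (metis (mono_tags, lifting) mem_Collect_eq zero_le_one)
  qed
  thus "irreducible_matrices n (nonneg_cone S)" by (rule irreducible_matrices_mono[OF D(3)])
qed

lemma closure_of_cone_semigroup:
  assumes S: "rc_semigroup n S" and cone: "\<And>c M. c \<ge> 0 \<Longrightarrow> M \<in> S \<Longrightarrow> complex_of_real c \<cdot>\<^sub>m M \<in> S"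
  shows "closed_cone_semigroup n (mclosure n S)"
proof -
  note D = rc_semigroupD[OF S]
  have "rc_semigroup n (mclosure n S)"
    unfolding rc_semigroup_def matrix_semigroup_def
  proof (intro conjI ballI)
    show "mclosure n S \<subseteq> carrier_mat n n" unfolding mclosure_def by auto
    show "irreducible_matrices n (mclosure n S)" by (rule irreducible_matrices_mono[OF D(3) mclosure_subset[OF D(1)]])
    fix A B assume A: "A \<in> mclosure n S" and B: "B \<in> mclosure n S"
    obtain P where P: "\<And>k. P k \<in> S" "mat_lim n n P A" using mclosure_sequence[OF D(1) A] by blast
    obtain Y where Y: "\<And>k. Y k \<in> S" "mat_lim n n Y B" using mclosure_sequence[OF D(1) B] by blast
    show "A * B \<in> mclosure n S" by (rule mclosure_mem[OF D(1) D(2)[OF P(1) Y(1)] mat_lim_mult[OF P(2) Y(2)]])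
    show "has_real_spectrum (A * B - B * A)"
      by (rule real_spectrum_limit[OF mat_lim_diff[OF mat_lim_mult[OF P(2) Y(2)] mat_lim_mult[OF Y(2) P(2)]] D(4)[OF P(1) Y(1)]])
  qed
  moreover have "complex_of_real c \<cdot>\<^sub>m M \<in> mclosure n S" if c: "c \<ge> 0" and M: "M \<in> mclosure n S" for c M
  proof -
    obtain P where P: "\<And>k. P k \<in> S" "mat_lim n n P M" using mclosure_sequence[OF D(1) M] by blast
    show ?thesis by (rule mclosure_mem[OF D(1) cone[OF c P(1)] mat_lim_smult[OF tendsto_const P(2)]])
  qed
  ultimately show ?thesis unfolding closed_cone_semigroup_def using mclosure_closed by blast
qed

lemma irreducible_nonzero_member:
  assumes irr: "irreducible_matrices n S" and S: "S \<subseteq> carrier_mat n n" and n: "n \<ge> 2"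
  obtains M where "M \<in> S" "M \<noteq> 0\<^sub>m n n"
proof -
  have "\<not> (\<forall>M\<in>S. M = 0\<^sub>m n n)"
  proof
    assume z: "\<forall>M\<in>S. M = 0\<^sub>m n n"
    have "n = 1"
    proof (rule irreducible_scalars_dim_one[OF irr])
      fix M assume "M \<in> S"
      hence "M = 0\<^sub>m n n" using z by blast
      also have "\<dots> = 0 \<cdot>\<^sub>m 1\<^sub>m n" by (intro eq_matI) auto
      finally show "\<exists>c. M = c \<cdot>\<^sub>m 1\<^sub>m n" by blast
    qed (use n in simp)
    thus False using n by simp
  qed
  thus thesis using that by blast
qed

lemma pow_mat_plus:
  fixes M :: "complex mat"
  assumes "M \<in> carrier_mat n n"
  shows "M ^\<^sub>m (a + b) = M ^\<^sub>m a * M ^\<^sub>m b"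
proof (induction b)
  case 0
  have "M ^\<^sub>m a \<in> carrier_mat n n" using assms by simp
  thus ?case using assms by auto
next
  case (Suc b)
  have "M ^\<^sub>m a \<in> carrier_mat n n" "M ^\<^sub>m b \<in> carrier_mat n n" using assms by auto
  from assoc_mult_mat[OF this assms] show ?case using Suc by simp
qed

lemma det_nonzero_left_cancel:
  fixes N E F :: "complex mat"
  assumes N: "N \<in> carrier_mat n n" "det N \<noteq> 0" and E: "E \<in> carrier_mat n n" "F \<in> carrier_mat n n" and eq: "N * E = N * F"
  shows "E = F"
proof -
  have "v = 0\<^sub>v n" if "v \<in> carrier_vec n" "N *\<^sub>v v = 0\<^sub>v n" for v
    using that det_0_iff_vec_prod_zero[OF N(1)] N(2) by blast
  then obtain Ni where Ni: "Ni \<in> carrier_mat n n" "Ni * N = 1\<^sub>m n" using injective_square_inverse[OF N(1)] by metis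
  have "E = Ni * (N * E)" using assoc_mult_mat[OF Ni(1) N(1) E(1)] E unfolding Ni(2) by simp
  also have "\<dots> = F" unfolding eq using assoc_mult_mat[OF Ni(1) N(1) E(2)] E unfolding Ni(2) by simp
  finally show ?thesis .
qed

text \<open>
  Every nonzero member is a positive multiple of a member of \<open>G = {M \<in> T. \<bar>det M\<bar> = 1}\<close>, so \<open>G\<close> is irreducible
  and has the same invariant real forms as \<open>T\<close>. It is bounded, since otherwise normalized members would converge to a
  nonzero singular member; and a compact semigroup of invertible matrices is a group.
\<close>

theorem invertible_semigroup_real_form:
  assumes T: "closed_cone_semigroup r T" and r: "r \<ge> 2" and inv: "\<And>M. M \<in> T \<Longrightarrow> M \<noteq> 0\<^sub>m r r \<Longrightarrow> det M \<noteq> 0"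
  obtains W where "real_form r W" "\<And>M w. M \<in> T \<Longrightarrow> w \<in> W \<Longrightarrow> M *\<^sub>v w \<in> W"
proof -
  note C = closed_cone_semigroupD[OF T]
  note D = rc_semigroupD[OF C(1)]
  define G where "G = {M \<in> T. cmod (det M) = 1}"
  have GT: "M \<in> T" "cmod (det M) = 1" "M \<in> carrier_mat r r" if "M \<in> G" for M using that D(5) unfolding G_def by auto
  have Gm: "A * B \<in> G" if "A \<in> G" "B \<in> G" for A B
    using D(2)[OF GT(1)[OF that(1)] GT(1)[OF that(2)]] GT(2)[OF that(1)] GT(2)[OF that(2)] det_mult[OF GT(3)[OF that(1)] GT(3)[OF that(2)]]
    unfolding G_def by (simp add: norm_mult)
  have Gcl: "M \<in> G" if "\<And>k. P k \<in> G" "mat_lim r r P M" for P M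
  proof -
    have "M \<in> T" using C(3)[OF GT(1)[OF that(1)] that(2)] .
    moreover have "(\<lambda>k. cmod (det (P k))) \<longlonglongrightarrow> cmod (det M)" by (rule tendsto_norm[OF mat_lim_det[OF that(2)]])
    hence "cmod (det M) = 1" using GT(2)[OF that(1)] by (simp add: LIMSEQ_const_iff)
    ultimately show ?thesis unfolding G_def by simp
  qed
  have norm: "\<exists>c. c > 0 \<and> complex_of_real c \<cdot>\<^sub>m M \<in> G" if M: "M \<in> T" "M \<noteq> 0\<^sub>m r r" for M
  proof -
    define d where "d = root r (cmod (det M))"
    have d: "d > 0" "d ^ r = cmod (det M)" unfolding d_def using inv[OF M] r by (auto simp: real_root_pow_pos2)
    have "cmod (det (complex_of_real (1 / d) \<cdot>\<^sub>m M)) = (1 / d) ^ r * d ^ r"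
      unfolding d(2) using carrier_matD[OF D(5)[OF M(1)]] d(1) by (simp add: norm_mult norm_power norm_divide)
    also have "\<dots> = 1" using d(1) by (simp add: power_one_over)
    finally have "complex_of_real (1 / d) \<cdot>\<^sub>m M \<in> G" unfolding G_def using C(2)[OF _ M(1), of "1 / d"] d(1) by simp
    thus ?thesis using d(1) by (intro exI[of _ "1 / d"]) auto
  qed
  \<comment> \<open>Unbounded members, scaled to size one, have determinants tending to zero but accumulate at a
    nonzero, hence invertible, member of \<open>T\<close>.\<close>
  have bounded: "\<exists>C. \<forall>A\<in>G. \<forall>i<r. \<forall>j<r. cmod (A $$ (i,j)) \<le> C"
  proof (rule ccontr)
    assume "\<not> ?thesis"
    hence "\<exists>A\<in>G. \<exists>i<r. \<exists>j<r. b < cmod (A $$ (i,j))" for b by (simp add: not_le)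
    hence "\<exists>A i j. A \<in> G \<and> i < r \<and> j < r \<and> cmod (A $$ (i,j)) > real (Suc k)" for k by blast
    hence "\<forall>k. \<exists>q. fst q \<in> G \<and> fst (snd q) < r \<and> snd (snd q) < r \<and> cmod (fst q $$ snd q) > real (Suc k)" by fastforce
    from choice[OF this] obtain q where q: "\<And>k. fst (q k) \<in> G \<and> fst (snd (q k)) < r \<and> snd (snd (q k)) < r \<and> cmod (fst (q k) $$ snd (q k)) > real (Suc k)" by blast
    define A i j where "A k = fst (q k)" and "i k = fst (snd (q k))" and "j k = snd (snd (q k))" for k
    have A: "A k \<in> G" "i k < r" "j k < r" "cmod (A k $$ (i k, j k)) > real (Suc k)" for k
      using q[of k] unfolding A_def i_def j_def by auto
    define \<mu> where "\<mu> k = (\<Sum>i<r. \<Sum>j<r. cmod (A k $$ (i,j)))" for k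
    have entry_le: "cmod (A k $$ (i,j)) \<le> \<mu> k" if "i < r" "j < r" for i j k
    proof -
      have "cmod (A k $$ (i,j)) \<le> (\<Sum>j<r. cmod (A k $$ (i,j)))" using that by (intro member_le_sum) auto
      also have "\<dots> \<le> \<mu> k" unfolding \<mu>_def using that by (intro member_le_sum[of i "{..<r}" "\<lambda>i. \<Sum>j<r. cmod (A k $$ (i,j))"]) (auto intro: sum_nonneg)
      finally show ?thesis .
    qed
    have \<mu>: "\<mu> k > real (Suc k)" for k using A(4)[of k] entry_le[OF A(2)[of k] A(3)[of k], of k] by linarith
    have \<mu>0: "\<mu> k > 0" for k using \<mu>[of k] by linarith
    define Y where "Y k = complex_of_real (1 / \<mu> k) \<cdot>\<^sub>m A k" for k
    have YT: "Y k \<in> T" for k unfolding Y_def by (rule C(2)[OF _ GT(1)[OF A(1)]]) (use \<mu>0[of k] in simp)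
    have Ye: "cmod (Y k $$ (i,j)) = cmod (A k $$ (i,j)) / \<mu> k" if "i < r" "j < r" for i j k
      unfolding Y_def using GT(3)[OF A(1)[of k]] that \<mu>0[of k] by (simp add: norm_divide)
    have "cmod (Y k $$ (i,j)) \<le> 1" if "i < r" "j < r" for i j k
      using entry_le[OF that, of k] \<mu>0[of k] unfolding Ye[OF that] by simp
    then obtain s N where s: "strict_mono s" and N: "mat_lim r r (\<lambda>k. Y (s k)) N"
      using bounded_mat_convergent_subseq[of Y r r 1] D(5)[OF YT] by blast
    have "(\<Sum>i<r. \<Sum>j<r. cmod (Y k $$ (i,j))) = 1" for k
      using \<mu>0[of k] by (simp add: Ye sum_divide_distrib[symmetric] \<mu>_def[symmetric])
    moreover have "(\<lambda>k. \<Sum>i<r. \<Sum>j<r. cmod (Y (s k) $$ (i,j))) \<longlonglongrightarrow> (\<Sum>i<r. \<Sum>j<r. cmod (N $$ (i,j)))"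
      using N unfolding mat_lim_def by (intro tendsto_sum tendsto_norm) auto
    ultimately have "(\<Sum>i<r. \<Sum>j<r. cmod (N $$ (i,j))) = 1" by (simp add: LIMSEQ_const_iff)
    hence "N \<noteq> 0\<^sub>m r r" by auto
    moreover have "N \<in> T" using C(3)[OF YT N] .
    ultimately have "det N \<noteq> 0" using inv by blast
    have "cmod (det (Y k)) \<le> 1 / real (Suc k)" for k
    proof -
      have "cmod (det (Y k)) = (1 / \<mu> k) ^ r"
        unfolding Y_def using carrier_matD[OF GT(3)[OF A(1)[of k]]] GT(2)[OF A(1)[of k]] \<mu>0[of k] by (simp add: norm_mult norm_power norm_divide)
      also have "\<dots> \<le> (1 / \<mu> k) ^ 1" using r \<mu>[of k] by (intro power_decreasing) auto
      also have "\<dots> \<le> 1 / real (Suc k)" using \<mu>[of k] by (simp add: frac_le)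
      finally show ?thesis .
    qed
    hence "(\<lambda>k. det (Y k)) \<longlonglongrightarrow> 0" by (rule tendsto_null_comparison[OF LIMSEQ_Suc[OF lim_1_over_n]])
    hence "(\<lambda>k. det (Y (s k))) \<longlonglongrightarrow> 0" using LIMSEQ_subseq_LIMSEQ[OF _ s] by (auto simp: o_def)
    hence "det N = 0" using mat_lim_det[OF N] LIMSEQ_unique by blast
    thus False using \<open>det N \<noteq> 0\<close> by simp
  qed
  then obtain Cb where Cb: "\<And>A i j. A \<in> G \<Longrightarrow> i < r \<Longrightarrow> j < r \<Longrightarrow> cmod (A $$ (i,j)) \<le> Cb" by blast
  have sub: "\<exists>s M. strict_mono s \<and> mat_lim r r (\<lambda>k. P (s k)) M \<and> M \<in> G" if P: "\<And>k. P k \<in> G" for P :: "nat \<Rightarrow> complex mat"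
  proof -
    obtain s M where "strict_mono s" "mat_lim r r (\<lambda>k. P (s k)) M"
      using bounded_mat_convergent_subseq[of P r r Cb] GT(3)[OF P] Cb[OF P] by blast
    thus ?thesis using Gcl[of "\<lambda>k. P (s k)" M] P by blast
  qed
  have pow: "M ^\<^sub>m Suc k \<in> G" if M: "M \<in> G" for M k
  proof (induction k)
    case 0
    thus ?case using M GT(3)[OF M] by simp
  next
    case (Suc k)
    thus ?case using Gm[OF Suc M] by simp
  qed
  \<comment> \<open>If \<open>M\<^sup>s\<close> converges to \<open>N\<close> along a subsequence of exponents, then
    \<open>M\<close> to the gap between exponents acts on \<open>N\<close> as the identity in the limit.
    Gaps between every second exponent are used so that one factor \<open>M\<close> can be split off and
    a positive power remains.\<close>
  have inverse: "1\<^sub>m r \<in> G \<and> (\<exists>V\<in>G. M * V = 1\<^sub>m r)" if M: "M \<in> G" for M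
  proof -
    note Mc = GT(3)[OF M]
    obtain s N where s: "strict_mono s" and N: "mat_lim r r (\<lambda>k. M ^\<^sub>m Suc (s k)) N" "N \<in> G"
      using sub[of "\<lambda>k. M ^\<^sub>m Suc k"] pow[OF M] by blast
    define d where "d k = s (Suc (Suc k)) - s k" for k
    have d2: "d k \<ge> 2" "s (Suc (Suc k)) = s k + d k" for k
      using strict_monoD[OF s, of k "Suc k"] strict_monoD[OF s, of "Suc k" "Suc (Suc k)"] unfolding d_def by auto
    have V: "M ^\<^sub>m (d k - 1) \<in> G" for k
    proof -
      have "d k - 1 = Suc (d k - 2)" using d2(1)[of k] by simp
      thus ?thesis using pow[OF M] by metis
    qed
    obtain t V where t: "strict_mono t" and V: "mat_lim r r (\<lambda>k. M ^\<^sub>m (d (t k) - 1)) V" "V \<in> G"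
      using sub[of "\<lambda>k. M ^\<^sub>m (d k - 1)"] V by blast
    have l1: "mat_lim r r (\<lambda>k. M ^\<^sub>m Suc (s (t k))) N" by (rule mat_lim_subseq[OF N(1) t])
    have t2: "strict_mono (\<lambda>k. Suc (Suc (t k)))" using t by (simp add: strict_mono_def)
    have l2: "mat_lim r r (\<lambda>k. M ^\<^sub>m Suc (s (Suc (Suc (t k))))) N" by (rule mat_lim_subseq[OF N(1) t2])
    have l3: "mat_lim r r (\<lambda>k. M ^\<^sub>m Suc (s (t k)) * (M * M ^\<^sub>m (d (t k) - 1))) (N * (M * V))"
      by (rule mat_lim_mult[OF l1 mat_lim_mult[OF mat_lim_const[OF Mc] V(1)]])
    have e: "M ^\<^sub>m Suc (s (t k)) * (M * M ^\<^sub>m (d (t k) - 1)) = M ^\<^sub>m Suc (s (Suc (Suc (t k))))" for k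
    proof -
      have "M * M ^\<^sub>m (d (t k) - 1) = M ^\<^sub>m (1 + (d (t k) - 1))" using pow_mat_plus[OF Mc, of 1 "d (t k) - 1"] Mc by simp
      also have "1 + (d (t k) - 1) = d (t k)" using d2(1)[of "t k"] by simp
      finally have "M ^\<^sub>m Suc (s (t k)) * (M * M ^\<^sub>m (d (t k) - 1)) = M ^\<^sub>m (Suc (s (t k)) + d (t k))"
        unfolding pow_mat_plus[OF Mc, of "Suc (s (t k))"] by simp
      also have "Suc (s (t k)) + d (t k) = Suc (s (Suc (Suc (t k))))" unfolding d2(2) by simp
      finally show ?thesis .
    qed
    have "N * (M * V) = N" using mat_lim_unique[OF l3[unfolded e] l2] .
    hence N1: "N * (M * V) = N * 1\<^sub>m r" unfolding square_mult_one(1)[OF GT(3)[OF N(2)]] .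
    have dN: "det N \<noteq> 0" using GT(2)[OF N(2)] by auto
    have MV: "M * V = 1\<^sub>m r"
      by (rule det_nonzero_left_cancel[OF GT(3)[OF N(2)] dN mult_carrier_mat[OF Mc GT(3)[OF V(2)]] one_carrier_mat N1])
    have "1\<^sub>m r \<in> G" using Gm[OF M V(2)] unfolding MV .
    thus ?thesis using V(2) MV by blast
  qed
  obtain M0 where M0: "M0 \<in> T" "M0 \<noteq> 0\<^sub>m r r" by (rule irreducible_nonzero_member[OF D(3,1) r])
  obtain c0 where c0: "c0 > 0 \<and> complex_of_real c0 \<cdot>\<^sub>m M0 \<in> G" by (rule exE[OF norm[OF M0]])
  note M1 = conjunct2[OF c0]
  have g1: "G \<subseteq> carrier_mat r r" unfolding G_def using D(1) by auto
  have g2: "1\<^sub>m r \<in> G" by (rule inverse[OF M1, THEN conjunct1])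
  have g3: "A * B \<in> G" if "A \<in> G" "B \<in> G" for A B by (rule Gm[OF that])
  have g4: "\<exists>B\<in>G. A * B = 1\<^sub>m r \<and> B * A = 1\<^sub>m r" if A: "A \<in> G" for A
  proof -
    obtain B where B: "B \<in> G" "A * B = 1\<^sub>m r" using inverse[OF A] by blast
    thus ?thesis using mat_mult_left_right_inverse[OF GT(3)[OF A] GT(3)[OF B(1)] B(2)] by blast
  qed
  have g5: "irreducible_matrices r G"
    unfolding irreducible_matrices_def
  proof (intro allI impI)
    fix W assume W: "invariant_subspace r G W"
    have W_sub: "W \<subseteq> carrier_vec r" and W_zero: "0\<^sub>v r \<in> W"
      and W_add: "\<And>x y. x \<in> W \<Longrightarrow> y \<in> W \<Longrightarrow> x + y \<in> W" and W_smult: "\<And>c x. x \<in> W \<Longrightarrow> c \<cdot>\<^sub>v x \<in> W"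
      and W_inv: "\<And>M w. M \<in> G \<Longrightarrow> w \<in> W \<Longrightarrow> M *\<^sub>v w \<in> W"
      using W unfolding invariant_subspace_iff by blast+
    have T_inv: "M *\<^sub>v w \<in> W" if M: "M \<in> T" and w: "w \<in> W" for M w
    proof -
      have wc: "w \<in> carrier_vec r" using W_sub w by blast
      show "M *\<^sub>v w \<in> W"
      proof (cases "M = 0\<^sub>m r r")
        case True
        show ?thesis unfolding True zero_mat_mult_vec[OF wc] by (rule W_zero)
      next
        case False
        obtain c where c: "c > 0" "complex_of_real c \<cdot>\<^sub>m M \<in> G" using norm[OF M False] by blast
        have "(complex_of_real c \<cdot>\<^sub>m M) *\<^sub>v w \<in> W" by (rule W_inv[OF c(2) w])
        hence "complex_of_real (1 / c) \<cdot>\<^sub>v ((complex_of_real c \<cdot>\<^sub>m M) *\<^sub>v w) \<in> W" by (rule W_smult)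
        thus ?thesis unfolding smult_mult_mat_vec[OF D(5)[OF M] wc] using c(1) by (simp add: smult_smult_assoc)
      qed
    qed
    show "W = {0\<^sub>v r} \<or> W = carrier_vec r"
    proof (rule disjCI)
      assume ne: "W \<noteq> carrier_vec r"
      have "x = 0\<^sub>v r" if x: "x \<in> W" for x
        using irreducible_matricesD[OF D(3) W_sub W_add W_smult T_inv x] ne by blast
      thus "W = {0\<^sub>v r}" using W_zero by blast
    qed
  qed
  have g6: "has_real_spectrum (A * B - B * A)" if "A \<in> G" "B \<in> G" for A B by (rule D(4)[OF GT(1)[OF that(1)] GT(1)[OF that(2)]])
  have g7: "r > 0" using r by simp
  interpret G: real_commutator_group r G
    by (intro real_commutator_group.intro matrix_group.intro real_commutator_group_axioms.intro)
      (fact g1 g2 g3 g4 g5 g6 g7 bounded)+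
  have "\<exists>W. real_form r W \<and> (\<forall>g\<in>G. \<forall>w\<in>W. g *\<^sub>v w \<in> W)"
  proof (rule G.real_commutator_group_real_form)
    show "cmod (det M) = 1" if "M \<in> G" for M by (rule GT(2)[OF that])
    show "r \<noteq> 1" using r by simp
    fix W assume "real_form r W" "\<And>g w. g \<in> G \<Longrightarrow> w \<in> W \<Longrightarrow> g *\<^sub>v w \<in> W"
    thus "\<exists>W. real_form r W \<and> (\<forall>g\<in>G. \<forall>w\<in>W. g *\<^sub>v w \<in> W)" by blast
  qed
  then obtain W where W: "real_form r W" "\<And>g w. g \<in> G \<Longrightarrow> w \<in> W \<Longrightarrow> g *\<^sub>v w \<in> W" by blast
  have W_carrier: "w \<in> carrier_vec r" if "w \<in> W" for w using W(1) that unfolding real_form_def by blast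
  have W_smult: "complex_of_real c \<cdot>\<^sub>v w \<in> W" if "w \<in> W" for c w using W(1) that unfolding real_form_def by blast
  have "M *\<^sub>v w \<in> W" if M: "M \<in> T" and w: "w \<in> W" for M w
  proof (cases "M = 0\<^sub>m r r")
    case True
    note wc = W_carrier[OF w]
    have "complex_of_real 0 \<cdot>\<^sub>v w \<in> W" by (rule W_smult[OF w])
    moreover have "complex_of_real 0 \<cdot>\<^sub>v w = 0\<^sub>v r" using wc by auto
    ultimately show ?thesis unfolding True zero_mat_mult_vec[OF wc] by simp
  next
    case False
    note wc = W_carrier[OF w]
    obtain c where c: "c > 0" "complex_of_real c \<cdot>\<^sub>m M \<in> G" using norm[OF M False] by blast
    have "complex_of_real (1 / c) \<cdot>\<^sub>v ((complex_of_real c \<cdot>\<^sub>m M) *\<^sub>v w) \<in> W" by (rule W_smult[OF W(2)[OF c(2) w]])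
    thus ?thesis unfolding smult_mult_mat_vec[OF D(5)[OF M] wc] using c(1) by (simp add: smult_smult_assoc)
  qed
  thus thesis using W(1) that by blast
qed

section \<open>Compression to minimal rank\<close>

text \<open>
  A linear relation between the columns expresses one of them, column \<open>j\<close>, by the others.
\<close>

lemma factor_through_smaller:
  fixes A :: "complex mat"
  assumes A: "A \<in> carrier_mat m (Suc r)" and v: "v \<in> carrier_vec (Suc r)" "v \<noteq> 0\<^sub>v (Suc r)" "A *\<^sub>v v = 0\<^sub>v m"
  obtains A0 B0 where "A0 \<in> carrier_mat m r" "B0 \<in> carrier_mat r (Suc r)" "A = A0 * B0"
proof -
  obtain j where j: "j < Suc r" "v $ j \<noteq> 0"
  proof -
    have "\<exists>j<Suc r. v $ j \<noteq> 0"
    proof (rule ccontr)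
      assume "\<not> ?thesis"
      hence "v = 0\<^sub>v (Suc r)" using v(1) by (intro eq_vecI) auto
      thus False using v(2) by simp
    qed
    thus thesis using that by blast
  qed
  \<comment> \<open>\<open>\<sigma>\<close> enumerates the columns other than \<open>j\<close> by putting the last one
    in place of column \<open>j\<close>; \<open>\<tau>\<close> is its inverse.\<close>
  define \<sigma> where "\<sigma> k = (if k = j then r else k)" for k
  define \<tau> where "\<tau> k = (if k = r then j else k)" for k
  have reindex: "(\<Sum>k<r. f (\<sigma> k)) = (\<Sum>k\<in>{..<Suc r} - {j}. f k)" for f :: "nat \<Rightarrow> complex"
    by (rule sum.reindex_bij_witness[of _ \<tau> \<sigma>]) (use j(1) in \<open>auto simp: \<sigma>_def \<tau>_def split: if_splits\<close>)
  define c where "c l k = (if l = j then - v $ k / v $ j else if l = k then 1 else 0)" for l k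
  define A0 where "A0 = mat m r (\<lambda>(i,k). A $$ (i, \<sigma> k))"
  define B0 where "B0 = mat r (Suc r) (\<lambda>(k,l). c l (\<sigma> k))"
  have "A $$ (i,l) = (A0 * B0) $$ (i,l)" if i: "i < m" and l: "l < Suc r" for i l
  proof -
    have "(A0 * B0) $$ (i,l) = (\<Sum>k<r. A $$ (i, \<sigma> k) * c l (\<sigma> k))"
      using i l unfolding A0_def B0_def by (simp add: scalar_prod_def atLeast0LessThan)
    also have "\<dots> = (\<Sum>k\<in>{..<Suc r} - {j}. A $$ (i,k) * c l k)" by (rule reindex)
    also have "\<dots> = A $$ (i,l)"
    proof (cases "l = j")
      case True
      have "(A *\<^sub>v v) $ i = (\<Sum>k<Suc r. A $$ (i,k) * v $ k)"
        using i A v(1) by (simp add: scalar_prod_def atLeast0LessThan del: sum.lessThan_Suc)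
      hence "0 = (\<Sum>k<Suc r. A $$ (i,k) * v $ k)" unfolding v(3) using i by simp
      also have "\<dots> = A $$ (i,j) * v $ j + (\<Sum>k\<in>{..<Suc r} - {j}. A $$ (i,k) * v $ k)"
        by (rule sum.remove) (use j in auto)
      finally have "(\<Sum>k\<in>{..<Suc r} - {j}. A $$ (i,k) * v $ k) = - (A $$ (i,j) * v $ j)"
        by (simp add: eq_neg_iff_add_eq_0 add.commute)
      hence "(\<Sum>k\<in>{..<Suc r} - {j}. A $$ (i,k) * v $ k) * (- 1 / v $ j) = A $$ (i,j)" using j(2) by simp
      thus ?thesis unfolding sum_distrib_right c_def using True by (simp add: mult.assoc)
    next
      case False
      have "(\<Sum>k\<in>{..<Suc r} - {j}. A $$ (i,k) * c l k) = (\<Sum>k\<in>{..<Suc r} - {j}. if l = k then A $$ (i,l) else 0)"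
        unfolding c_def using False by (intro sum.cong) auto
      thus ?thesis using l False by (simp del: lessThan_Suc sum.lessThan_Suc)
    qed
    finally show ?thesis by simp
  qed
  hence "A = A0 * B0" using A by (intro eq_matI) (auto simp: A0_def B0_def)
  thus thesis using that[of A0 B0] unfolding A0_def B0_def by simp
qed

lemma rank_one_product:
  fixes N R :: "complex mat"
  assumes "N \<in> carrier_mat n 1" "R \<in> carrier_mat 1 n"
  shows "N * R = outer n (col N 0) (row R 0)"
  using assms unfolding outer_def by (intro eq_matI) (auto simp: scalar_prod_def)

text \<open>
  A nonzero member of \<open>T\<close> of least rank \<open>r\<close>. Rank is expressed by the inner dimension of a factorization,
  which is the form in which it is used.
\<close>

locale minimal_factor =
  fixes n r :: nat and T :: "complex mat set" and L R :: "complex mat"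
  assumes closed_cone: "closed_cone_semigroup n T" and n_ge_2: "n \<ge> 2"
    and L_carrier: "L \<in> carrier_mat n r" and R_carrier: "R \<in> carrier_mat r n"
    and LR_in: "L * R \<in> T" and LR_nonzero: "L * R \<noteq> 0\<^sub>m n n"
    and minimal: "\<And>k L' R'. L' \<in> carrier_mat n k \<Longrightarrow> R' \<in> carrier_mat k n \<Longrightarrow> L' * R' \<in> T \<Longrightarrow> L' * R' \<noteq> 0\<^sub>m n n \<Longrightarrow> r \<le> k"
begin

lemmas T_cone = closed_cone_semigroupD[OF closed_cone]
lemmas T_rc = rc_semigroupD[OF T_cone(1)]

lemma r_pos: "r > 0"
proof (rule ccontr)
  assume "\<not> r > 0"
  hence "L * R = 0\<^sub>m n n" using L_carrier R_carrier by (intro eq_matI) (auto simp: scalar_prod_def)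
  thus False using LR_nonzero by simp
qed

text \<open>
  A singular \<open>M\<close> factors through a smaller dimension, and so does \<open>L * M * R\<close>.
\<close>

lemma singular_member_zero:
  assumes M: "M \<in> carrier_mat r r" and in_T: "L * (M * R) \<in> T" and v: "v \<in> carrier_vec r" "v \<noteq> 0\<^sub>v r" "M *\<^sub>v v = 0\<^sub>v r"
  shows "L * (M * R) = 0\<^sub>m n n"
proof (rule ccontr)
  assume ne: "L * (M * R) \<noteq> 0\<^sub>m n n"
  obtain s where s: "r = Suc s" using r_pos by (cases r) auto
  obtain A0 B0 where AB: "A0 \<in> carrier_mat r s" "B0 \<in> carrier_mat s r" "M = A0 * B0"
    using factor_through_smaller[of M r s v] M v unfolding s by blast
  have B0R: "B0 * R \<in> carrier_mat s n" using AB(2) R_carrier by (rule mult_carrier_mat)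
  have LA0: "L * A0 \<in> carrier_mat n s" using L_carrier AB(1) by (rule mult_carrier_mat)
  have "L * (M * R) = L * (A0 * (B0 * R))" unfolding AB(3) by (subst assoc_mult_mat[OF AB(1,2) R_carrier]) (rule refl)
  also have "\<dots> = (L * A0) * (B0 * R)" by (rule assoc_mult_mat[OF L_carrier AB(1) B0R, symmetric])
  finally have "L * (M * R) = (L * A0) * (B0 * R)" .
  thus False using minimal[OF LA0 B0R] in_T ne s by simp
qed

lemma L_injective:
  assumes v: "v \<in> carrier_vec r" "L *\<^sub>v v = 0\<^sub>v n"
  shows "v = 0\<^sub>v r"
proof (rule ccontr)
  assume ne: "v \<noteq> 0\<^sub>v r"
  obtain s where s: "r = Suc s" using r_pos by (cases r) auto
  obtain A0 B0 where AB: "A0 \<in> carrier_mat n s" "B0 \<in> carrier_mat s r" "L = A0 * B0"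
    using factor_through_smaller[of L n s v] L_carrier v ne unfolding s by blast
  have B0R: "B0 * R \<in> carrier_mat s n" using AB(2) R_carrier by (rule mult_carrier_mat)
  have "L * R = A0 * (B0 * R)" unfolding AB(3) by (rule assoc_mult_mat[OF AB(1,2) R_carrier])
  thus False using minimal[OF AB(1) B0R] LR_in LR_nonzero s by simp
qed

lemma R_transpose_injective:
  assumes v: "v \<in> carrier_vec r" "transpose_mat R *\<^sub>v v = 0\<^sub>v n"
  shows "v = 0\<^sub>v r"
proof (rule ccontr)
  assume ne: "v \<noteq> 0\<^sub>v r"
  obtain s where s: "r = Suc s" using r_pos by (cases r) auto
  obtain A0 B0 where AB: "A0 \<in> carrier_mat n s" "B0 \<in> carrier_mat s r" "transpose_mat R = A0 * B0"
    using factor_through_smaller[of "transpose_mat R" n s v] R_carrier v ne unfolding s by auto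
  have t: "transpose_mat B0 \<in> carrier_mat r s" "transpose_mat A0 \<in> carrier_mat s n" using AB by auto
  have "R = transpose_mat (transpose_mat R)" by simp
  also have "\<dots> = transpose_mat B0 * transpose_mat A0" unfolding AB(3) by (rule transpose_mult[OF AB(1,2)])
  finally have "L * R = (L * transpose_mat B0) * transpose_mat A0" using assoc_mult_mat[OF L_carrier t] by simp
  thus False using minimal[OF mult_carrier_mat[OF L_carrier t(1)] t(2)] LR_in LR_nonzero s by simp
qed

lemma sandwich_injective:
  assumes M: "M \<in> carrier_mat r r" and z: "L * (M * R) = 0\<^sub>m n n"
  shows "M = 0\<^sub>m r r"
proof -
  have MR: "M * R \<in> carrier_mat r n" using M R_carrier by (rule mult_carrier_mat)
  have "M * R = 0\<^sub>m r n"
  proof (rule eq_zero_mat_by_mult_vec[OF MR])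
    fix v :: "complex vec" assume v: "v \<in> carrier_vec n"
    have "L *\<^sub>v ((M * R) *\<^sub>v v) = 0\<^sub>v n"
      unfolding assoc_mult_mat_vec[OF L_carrier MR v, symmetric] z by (rule zero_mat_mult_vec[OF v])
    thus "(M * R) *\<^sub>v v = 0\<^sub>v r" by (rule L_injective[OF mult_mat_vec_carrier[OF MR v]])
  qed
  hence z2: "transpose_mat R * transpose_mat M = 0\<^sub>m n r" using transpose_mult[OF M R_carrier] by simp
  have t: "transpose_mat M \<in> carrier_mat r r" "transpose_mat R \<in> carrier_mat n r" using M R_carrier by auto
  have "transpose_mat M = 0\<^sub>m r r"
  proof (rule eq_zero_mat_by_mult_vec[OF t(1)])
    fix v :: "complex vec" assume v: "v \<in> carrier_vec r"
    have "transpose_mat R *\<^sub>v (transpose_mat M *\<^sub>v v) = 0\<^sub>v n"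
      unfolding assoc_mult_mat_vec[OF t(2,1) v, symmetric] z2 by (rule zero_mat_mult_vec[OF v])
    thus "transpose_mat M *\<^sub>v v = 0\<^sub>v r" by (rule R_transpose_injective[OF mult_mat_vec_carrier[OF t(1) v]])
  qed
  hence "transpose_mat (transpose_mat M) = 0\<^sub>m r r" by simp
  thus ?thesis by simp
qed

definition compress :: "complex mat \<Rightarrow> complex mat" where
  "compress B = R * (B * L)"

lemma compress_carrier: "B \<in> carrier_mat n n \<Longrightarrow> compress B \<in> carrier_mat r r"
  unfolding compress_def using L_carrier R_carrier by (intro mult_carrier_mat[of _ r n] mult_carrier_mat[of _ n n])

lemma compress_mult_vec:
  assumes "B \<in> carrier_mat n n" "v \<in> carrier_vec r"
  shows "compress B *\<^sub>v v = R *\<^sub>v (B *\<^sub>v (L *\<^sub>v v))"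
proof -
  have BL: "B * L \<in> carrier_mat n r" using assms(1) L_carrier by (rule mult_carrier_mat)
  show ?thesis unfolding compress_def assoc_mult_mat_vec[OF R_carrier BL assms(2)] assoc_mult_mat_vec[OF assms(1) L_carrier assms(2)] ..
qed

lemma LR_carrier: "L * R \<in> carrier_mat n n" using L_carrier R_carrier by (rule mult_carrier_mat)

lemma LR_mult_vec:
  assumes "v \<in> carrier_vec n"
  shows "(L * R) *\<^sub>v v = L *\<^sub>v (R *\<^sub>v v)"
  by (rule assoc_mult_mat_vec[OF L_carrier R_carrier assms])

lemmas vec_carrier = mult_mat_vec_carrier[OF L_carrier] mult_mat_vec_carrier[OF R_carrier]

text \<open>
  Compressions multiply like elements of \<open>T\<close> with \<open>L * R\<close> inserted in between, so they form a semigroup.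
\<close>

lemma compress_mult:
  assumes B: "B \<in> carrier_mat n n" and C: "C \<in> carrier_mat n n"
  shows "compress B * compress C = compress (B * ((L * R) * C))"
proof (rule eq_mat_by_mult_vec[of _ r r])
  have ARC: "(L * R) * C \<in> carrier_mat n n" using LR_carrier C by (rule mult_carrier_mat)
  have BARC: "B * ((L * R) * C) \<in> carrier_mat n n" using B ARC by (rule mult_carrier_mat)
  show "compress B * compress C \<in> carrier_mat r r" using compress_carrier[OF B] compress_carrier[OF C] by (rule mult_carrier_mat)
  show "compress (B * ((L * R) * C)) \<in> carrier_mat r r" by (rule compress_carrier[OF BARC])
  fix v :: "complex vec" assume v: "v \<in> carrier_vec r"
  have CLv: "C *\<^sub>v (L *\<^sub>v v) \<in> carrier_vec n" using mult_mat_vec_carrier[OF C vec_carrier(1)[OF v]] .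
  have "(compress B * compress C) *\<^sub>v v = R *\<^sub>v (B *\<^sub>v (L *\<^sub>v (R *\<^sub>v (C *\<^sub>v (L *\<^sub>v v)))))"
    unfolding assoc_mult_mat_vec[OF compress_carrier[OF B] compress_carrier[OF C] v] compress_mult_vec[OF C v]
    by (rule compress_mult_vec[OF B vec_carrier(2)[OF CLv]])
  also have "\<dots> = compress (B * ((L * R) * C)) *\<^sub>v v"
    unfolding compress_mult_vec[OF BARC v] assoc_mult_mat_vec[OF B ARC vec_carrier(1)[OF v]]
      assoc_mult_mat_vec[OF LR_carrier C vec_carrier(1)[OF v]] LR_mult_vec[OF CLv] ..
  finally show "(compress B * compress C) *\<^sub>v v = compress (B * ((L * R) * C)) *\<^sub>v v" .
qed

lemma compress_diff:
  assumes "B \<in> carrier_mat n n" "C \<in> carrier_mat n n"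
  shows "compress B - compress C = R * ((B - C) * L)"
proof -
  have BL: "B * L \<in> carrier_mat n r" "C * L \<in> carrier_mat n r" using assms L_carrier by (auto intro: mult_carrier_mat)
  show ?thesis
    unfolding compress_def minus_mult_distrib_mat[OF assms L_carrier] mult_minus_distrib_mat[OF R_carrier BL] ..
qed

text \<open>
  The commutator is \<open>R * D * L\<close> with \<open>D = B * L * R * C - C * L * R * B\<close>. Its nonzero eigenvalues are those
  of \<open>D * L * R\<close>, the commutator of \<open>B * L * R\<close> and \<open>C * L * R\<close>.
\<close>

lemma compress_commutator_real:
  assumes B: "B \<in> T" and C: "C \<in> T"
  shows "has_real_spectrum (compress B * compress C - compress C * compress B)"
proof -
  note Bc = T_rc(5)[OF B] and Cc = T_rc(5)[OF C] and A = LR_carrier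
  have AB: "(L * R) * B \<in> carrier_mat n n" and AC: "(L * R) * C \<in> carrier_mat n n"
    using A Bc Cc by (auto intro: mult_carrier_mat)
  have BAC: "B * ((L * R) * C) \<in> carrier_mat n n" and CAB: "C * ((L * R) * B) \<in> carrier_mat n n"
    using AB AC Bc Cc by (auto intro: mult_carrier_mat)
  define D where "D = B * ((L * R) * C) - C * ((L * R) * B)"
  have D: "D \<in> carrier_mat n n" unfolding D_def using BAC CAB by (auto intro: minus_carrier_mat)
  have BA: "B * (L * R) \<in> carrier_mat n n" and CA: "C * (L * R) \<in> carrier_mat n n"
    using A Bc Cc by (auto intro: mult_carrier_mat)
  have s: "(P * ((L * R) * Q)) * (L * R) = (P * (L * R)) * (Q * (L * R))"
    if P: "P \<in> carrier_mat n n" and Q: "Q \<in> carrier_mat n n" for P Q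
  proof -
    have "(P * ((L * R) * Q)) * (L * R) = ((P * (L * R)) * Q) * (L * R)" by (subst assoc_mult_mat[OF P A Q]) (rule refl)
    also have "\<dots> = (P * (L * R)) * (Q * (L * R))" by (rule assoc_mult_mat[OF mult_carrier_mat[OF P A] Q A])
    finally show ?thesis .
  qed
  have "has_real_spectrum ((B * (L * R)) * (C * (L * R)) - (C * (L * R)) * (B * (L * R)))"
    by (rule T_rc(4)[OF T_rc(2)[OF B LR_in] T_rc(2)[OF C LR_in]])
  also have "(B * (L * R)) * (C * (L * R)) - (C * (L * R)) * (B * (L * R)) = D * (L * R)"
    unfolding D_def minus_mult_distrib_mat[OF BAC CAB A] s[OF Bc Cc] s[OF Cc Bc] ..
  also have "\<dots> = (D * L) * R" by (rule assoc_mult_mat[OF D L_carrier R_carrier, symmetric])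
  finally have "has_real_spectrum (R * (D * L))"
    by (intro real_spectrum_swap[OF R_carrier mult_carrier_mat[OF D L_carrier]])
  thus ?thesis unfolding compress_mult[OF Bc Cc] compress_mult[OF Cc Bc] compress_diff[OF BAC CAB] D_def .
qed

text \<open>
  If \<open>M\<close> is a limit of compressions \<open>R * B * L\<close>, then \<open>L * M * R\<close> is a limit of \<open>L * R * B * L * R\<close> and
  belongs to \<open>T\<close>; minimality of the rank applies to it.
\<close>

lemma closure_member_zero:
  assumes M: "M \<in> mclosure r (compress ` T)" and v: "v \<in> carrier_vec r" "v \<noteq> 0\<^sub>v r" "M *\<^sub>v v = 0\<^sub>v r"
  shows "M = 0\<^sub>m r r"
proof -
  have sub: "compress ` T \<subseteq> carrier_mat r r" using compress_carrier T_rc(5) by auto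
  have Mc: "M \<in> carrier_mat r r" using M unfolding mclosure_def by simp
  obtain P where P: "\<And>k. P k \<in> compress ` T" "mat_lim r r P M" using mclosure_sequence[OF sub M] by blast
  have in_T: "L * (P k * R) \<in> T" for k
  proof -
    obtain B where B: "B \<in> T" "P k = compress B" using P(1)[of k] by blast
    note Bc = T_rc(5)[OF B(1)]
    have Pc: "P k \<in> carrier_mat r r" using compress_carrier[OF Bc] B(2) by simp
    have BA: "B * (L * R) \<in> carrier_mat n n" using Bc LR_carrier by (rule mult_carrier_mat)
    have "L * (P k * R) = (L * R) * (B * (L * R))"
    proof (rule eq_mat_by_mult_vec[of _ n n])
      show "L * (P k * R) \<in> carrier_mat n n" by (rule mult_carrier_mat[OF L_carrier mult_carrier_mat[OF Pc R_carrier]])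
      show "(L * R) * (B * (L * R)) \<in> carrier_mat n n" by (rule mult_carrier_mat[OF LR_carrier BA])
      fix u :: "complex vec" assume u: "u \<in> carrier_vec n"
      have "(L * (P k * R)) *\<^sub>v u = L *\<^sub>v (R *\<^sub>v (B *\<^sub>v (L *\<^sub>v (R *\<^sub>v u))))"
        unfolding B(2) assoc_mult_mat_vec[OF L_carrier mult_carrier_mat[OF compress_carrier[OF Bc] R_carrier] u]
          assoc_mult_mat_vec[OF compress_carrier[OF Bc] R_carrier u] compress_mult_vec[OF Bc vec_carrier(2)[OF u]] ..
      also have "\<dots> = ((L * R) * (B * (L * R))) *\<^sub>v u"
        unfolding assoc_mult_mat_vec[OF LR_carrier BA u] assoc_mult_mat_vec[OF Bc LR_carrier u] LR_mult_vec[OF u]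
          LR_mult_vec[OF mult_mat_vec_carrier[OF Bc vec_carrier(1)[OF vec_carrier(2)[OF u]]]] ..
      finally show "(L * (P k * R)) *\<^sub>v u = ((L * R) * (B * (L * R))) *\<^sub>v u" .
    qed
    thus ?thesis using T_rc(2)[OF LR_in T_rc(2)[OF B(1) LR_in]] by simp
  qed
  have lim: "mat_lim n n (\<lambda>k. L * (P k * R)) (L * (M * R))"
    by (intro mat_lim_mult[OF mat_lim_const[OF L_carrier] mat_lim_mult[OF P(2) mat_lim_const[OF R_carrier]]])
  have "L * (M * R) \<in> T" by (rule T_cone(3)[OF in_T lim])
  from singular_member_zero[OF Mc this v] show ?thesis by (rule sandwich_injective[OF Mc])
qed

lemma nonzero_member_injective:
  assumes M: "M \<in> compress ` T" and ne: "M \<noteq> 0\<^sub>m r r" and v: "v \<in> carrier_vec r" "M *\<^sub>v v = 0\<^sub>v r"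
  shows "v = 0\<^sub>v r"
proof (rule ccontr)
  assume "v \<noteq> 0\<^sub>v r"
  moreover have "M \<in> mclosure r (compress ` T)" using mclosure_subset[of "compress ` T" r] M compress_carrier T_rc(5) by blast
  ultimately show False using closure_member_zero[of M v] v ne by blast
qed

lemma R_nonzero: "R \<noteq> 0\<^sub>m r n"
  using LR_nonzero L_carrier by auto

lemma compress_annihilator:
  assumes W: "0\<^sub>v r \<in> W" "\<And>x y. x \<in> W \<Longrightarrow> y \<in> W \<Longrightarrow> x + y \<in> W" "\<And>c x. x \<in> W \<Longrightarrow> c \<cdot>\<^sub>v x \<in> W"
    and w: "w \<in> carrier_vec r" "w \<noteq> 0\<^sub>v r" "\<And>B. B \<in> T \<Longrightarrow> compress B *\<^sub>v w \<in> W" and z: "z \<in> carrier_vec n"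
  shows "R *\<^sub>v z \<in> W"
proof (rule irreducible_annihilator[OF T_rc(3,1) n_ge_2 T_rc(2) R_carrier W, of "L *\<^sub>v w"])
  show "L *\<^sub>v w \<in> carrier_vec n" by (rule vec_carrier(1)[OF w(1)])
  show "L *\<^sub>v w \<noteq> 0\<^sub>v n" using L_injective[OF w(1)] w(2) by blast
  show "R *\<^sub>v (U *\<^sub>v (L *\<^sub>v w)) \<in> W" if "U \<in> T" for U
    using w(3)[OF that] compress_mult_vec[OF T_rc(5)[OF that] w(1)] by simp
qed (use z in auto)

lemma nonzero_compression: "\<exists>B\<in>T. compress B \<noteq> 0\<^sub>m r r"
proof (rule ccontr)
  assume "\<not> ?thesis"
  hence z: "compress B = 0\<^sub>m r r" if "B \<in> T" for B using that by blast
  have w: "unit_vec r 0 \<in> carrier_vec r" "unit_vec r 0 \<noteq> (0\<^sub>v r :: complex vec)" using r_pos by auto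
  have "R = 0\<^sub>m r n"
  proof (rule eq_zero_mat_by_mult_vec[OF R_carrier])
    fix v :: "complex vec" assume v: "v \<in> carrier_vec n"
    have "R *\<^sub>v v \<in> {0\<^sub>v r}"
      by (rule compress_annihilator[OF _ _ _ w _ v]) (auto simp: z zero_mat_mult_vec[OF w(1)])
    thus "R *\<^sub>v v = 0\<^sub>v r" by simp
  qed
  thus False using R_nonzero by simp
qed

text \<open>
  Some compression is nonzero, hence invertible, and the compressions factor through \<open>R\<close>.
\<close>

lemma R_surjective:
  assumes y: "y \<in> carrier_vec r"
  obtains z where "z \<in> carrier_vec n" "R *\<^sub>v z = y"
proof -
  obtain B where B: "B \<in> T" "compress B \<noteq> 0\<^sub>m r r" using nonzero_compression by blast
  note Bc = T_rc(5)[OF B(1)]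
  obtain N where N: "N \<in> carrier_mat r r" "compress B * N = 1\<^sub>m r"
    using injective_square_inverse[OF compress_carrier[OF Bc]] nonzero_member_injective[OF imageI[OF B(1)] B(2)] by metis
  have Ny: "N *\<^sub>v y \<in> carrier_vec r" by (rule mult_mat_vec_carrier[OF N(1) y])
  have "R *\<^sub>v (B *\<^sub>v (L *\<^sub>v (N *\<^sub>v y))) = (compress B * N) *\<^sub>v y"
    unfolding assoc_mult_mat_vec[OF compress_carrier[OF Bc] N(1) y] compress_mult_vec[OF Bc Ny] ..
  also have "\<dots> = y" unfolding N(2) using y by simp
  finally show thesis by (rule that[OF mult_mat_vec_carrier[OF Bc vec_carrier(1)[OF Ny]]])
qed

lemma compression_rc_semigroup: "rc_semigroup r (compress ` T)"
  unfolding rc_semigroup_def matrix_semigroup_def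
proof (intro conjI ballI)
  show "compress ` T \<subseteq> carrier_mat r r" using compress_carrier T_rc(5) by auto
  fix M N assume "M \<in> compress ` T" "N \<in> compress ` T"
  then obtain B C where B: "B \<in> T" "M = compress B" and C: "C \<in> T" "N = compress C" by blast
  show "M * N \<in> compress ` T"
    unfolding B(2) C(2) compress_mult[OF T_rc(5)[OF B(1)] T_rc(5)[OF C(1)]]
    by (intro imageI T_rc(2) LR_in B(1) C(1))
  show "has_real_spectrum (M * N - N * M)" unfolding B(2) C(2) by (rule compress_commutator_real[OF B(1) C(1)])
next
  show "irreducible_matrices r (compress ` T)"
    unfolding irreducible_matrices_def
  proof (intro allI impI)
    fix W assume inv: "invariant_subspace r (compress ` T) W"
    note W = inv[unfolded invariant_subspace_iff]
    show "W = {0\<^sub>v r} \<or> W = carrier_vec r"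
    proof (rule disjCI)
      assume ne: "W \<noteq> carrier_vec r"
      have "w = 0\<^sub>v r" if w: "w \<in> W" for w
      proof (rule ccontr)
        assume w0: "w \<noteq> 0\<^sub>v r"
        have wc: "w \<in> carrier_vec r" using W w by blast
        have RW: "R *\<^sub>v z \<in> W" if z: "z \<in> carrier_vec n" for z
          by (rule compress_annihilator[OF _ _ _ wc w0 _ z]) (use W w in blast)+
        have "y \<in> W" if y: "y \<in> carrier_vec r" for y
          using R_surjective[OF y] RW by metis
        hence "W = carrier_vec r" using W by blast
        thus False using ne by simp
      qed
      thus "W = {0\<^sub>v r}" using W by blast
    qed
  qed
qed

lemma compress_smult:
  assumes "B \<in> carrier_mat n n"
  shows "c \<cdot>\<^sub>m compress B = compress (c \<cdot>\<^sub>m B)"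
  unfolding compress_def
  using assms L_carrier R_carrier by (simp add: mult_smult_distrib[of _ r n _ r] mult_smult_assoc_mat[of _ n n _ r] mult_carrier_mat[of _ n n])

lemma compression_closure: "closed_cone_semigroup r (mclosure r (compress ` T))"
proof (rule closure_of_cone_semigroup[OF compression_rc_semigroup])
  fix c :: real and M assume c: "c \<ge> 0" and "M \<in> compress ` T"
  then obtain B where B: "B \<in> T" "M = compress B" by blast
  show "complex_of_real c \<cdot>\<^sub>m M \<in> compress ` T"
    unfolding B(2) compress_smult[OF T_rc(5)[OF B(1)]] by (intro imageI T_cone(2) c B(1))
qed

text \<open>
  In dimension one the compressions are the traces of the rank one matrices \<open>B * L * R\<close>, which are real. In
  higher dimension the nonzero members of the closure of the compressions are invertible by minimality of the rank.
\<close>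

lemma compression_real_form:
  obtains W where "real_form r W" "\<And>B w. B \<in> T \<Longrightarrow> w \<in> W \<Longrightarrow> compress B *\<^sub>v w \<in> W"
proof (cases "r = 1")
  case False
  hence r: "r \<ge> 2" using r_pos by simp
  have inv: "det M \<noteq> 0" if M: "M \<in> mclosure r (compress ` T)" "M \<noteq> 0\<^sub>m r r" for M
  proof
    assume "det M = 0"
    moreover have "M \<in> carrier_mat r r" using M(1) unfolding mclosure_def by simp
    ultimately obtain v where "v \<in> carrier_vec r" "v \<noteq> 0\<^sub>v r" "M *\<^sub>v v = 0\<^sub>v r" using det_0_iff_vec_prod_zero by blast
    thus False using closure_member_zero[OF M(1)] M(2) by blast
  qed
  obtain W where W: "real_form r W" "\<And>M w. M \<in> mclosure r (compress ` T) \<Longrightarrow> w \<in> W \<Longrightarrow> M *\<^sub>v w \<in> W"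
    using invertible_semigroup_real_form[OF compression_closure r inv] by blast
  have "compress ` T \<subseteq> mclosure r (compress ` T)" using compress_carrier T_rc(5) by (intro mclosure_subset) auto
  thus thesis using that[OF W(1)] W(2) by blast
next
  case True
  define W :: "complex vec set" where "W = {x \<in> carrier_vec 1. x $ 0 \<in> \<real>}"
  have "real_form r W"
    unfolding real_form_def True
  proof (intro conjI ballI allI impI)
    show "x = 0\<^sub>v 1" if "x \<in> W" "\<i> \<cdot>\<^sub>v x \<in> W" for x
    proof (rule eq_vecI)
      fix i assume "i < dim_vec (0\<^sub>v 1 :: complex vec)"
      hence i: "i = 0" by simp
      have "x $ 0 \<in> \<real>" using that(1) unfolding W_def by simp
      then obtain t where t: "x $ 0 = complex_of_real t" by (rule Reals_cases)
      have "\<i> * complex_of_real t \<in> \<real>" using that t unfolding W_def by simp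
      hence "t = 0" by (simp add: complex_is_Real_iff)
      thus "x $ i = 0\<^sub>v 1 $ i" unfolding i using t by simp
    qed (use that in \<open>simp add: W_def\<close>)
    show "\<exists>x\<in>W. x \<noteq> 0\<^sub>v 1" by (rule bexI[of _ "unit_vec 1 0"]) (auto simp: W_def)
  qed (auto simp: W_def)
  moreover have "compress B *\<^sub>v w \<in> W" if B: "B \<in> T" and w: "w \<in> W" for B w
  proof -
    note Bc = T_rc(5)[OF B]
    define N where "N = B * L"
    have N: "N \<in> carrier_mat n 1" unfolding N_def using mult_carrier_mat[OF Bc L_carrier] True by simp
    have R1: "R \<in> carrier_mat 1 n" using R_carrier True by simp
    have "N * R \<in> T" unfolding N_def assoc_mult_mat[OF Bc L_carrier R_carrier] by (rule T_rc(2)[OF B LR_in])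
    hence "outer n (col N 0) (row R 0) \<in> T" unfolding rank_one_product[OF N R1] .
    moreover have "matrix_semigroup n T" using T_cone(1) unfolding rc_semigroup_def by blast
    moreover have "col N 0 \<in> carrier_vec n" "row R 0 \<in> carrier_vec n" using N R1 by auto
    ultimately have "row R 0 \<bullet> col N 0 \<in> \<real>" by (intro real_rank_one_corner[OF T_rc(3) _ n_ge_2 T_rc(4)])
    hence "compress B $$ (0,0) \<in> \<real>" unfolding compress_def N_def[symmetric] using N R1 by simp
    moreover have K: "compress B \<in> carrier_mat 1 1" using compress_carrier[OF Bc] True by simp
    moreover have wW: "w \<in> carrier_vec 1" "w $ 0 \<in> \<real>" using w unfolding W_def by auto
    moreover have "(compress B *\<^sub>v w) $ 0 = compress B $$ (0,0) * w $ 0"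
      using carrier_matD[OF K] carrier_vecD[OF wW(1)] by (simp add: scalar_prod_def)
    ultimately show ?thesis unfolding W_def by (simp add: Reals_mult)
  qed
  ultimately show thesis by (rule that)
qed

text \<open>
  The real form is pulled back along all maps \<open>R * B\<close>. It contains \<open>L * V\<close> because \<open>V\<close> is invariant under
  compressions, and it contains no complex line because a vector killed by all \<open>R * B\<close> is zero.
\<close>

lemma invariant_real_form:
  obtains W where "real_form n W" "\<And>B w. B \<in> T \<Longrightarrow> w \<in> W \<Longrightarrow> B *\<^sub>v w \<in> W"
proof -
  obtain V where V: "real_form r V" "\<And>B w. B \<in> T \<Longrightarrow> w \<in> V \<Longrightarrow> compress B *\<^sub>v w \<in> V" using compression_real_form by blast
  note V' = V(1)[unfolded real_form_def]
  define W where "W = {y \<in> carrier_vec n. \<forall>B\<in>T. R *\<^sub>v (B *\<^sub>v y) \<in> V}"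
  have "real_form n W"
    unfolding real_form_def
  proof (intro conjI ballI allI impI)
    show "x + y \<in> W" if "x \<in> W" "y \<in> W" for x y
    proof -
      have "R *\<^sub>v (B *\<^sub>v (x + y)) = R *\<^sub>v (B *\<^sub>v x) + R *\<^sub>v (B *\<^sub>v y)" if B: "B \<in> T" for B
        using \<open>x \<in> W\<close> \<open>y \<in> W\<close> T_rc(5)[OF B] R_carrier unfolding W_def
        by (simp add: mult_add_distrib_mat_vec[of _ n n] mult_add_distrib_mat_vec[of _ r n])
      thus ?thesis using that V' unfolding W_def by auto
    qed
    have smult: "R *\<^sub>v (B *\<^sub>v (c \<cdot>\<^sub>v x)) = c \<cdot>\<^sub>v (R *\<^sub>v (B *\<^sub>v x))" if "x \<in> W" "B \<in> T" for x B c
      using that(1) T_rc(5)[OF that(2)] R_carrier unfolding W_def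
      by (simp add: mult_mat_vec[of _ n n] mult_mat_vec[of _ r n])
    show "complex_of_real c \<cdot>\<^sub>v x \<in> W" if "x \<in> W" for x c
      using that smult[OF that] V' unfolding W_def by auto
    show "x = 0\<^sub>v n" if x: "x \<in> W" "\<i> \<cdot>\<^sub>v x \<in> W" for x
    proof (rule ccontr)
      assume x0: "x \<noteq> 0\<^sub>v n"
      have xc: "x \<in> carrier_vec n" using x(1) unfolding W_def by simp
      have z: "R *\<^sub>v (B *\<^sub>v x) = 0\<^sub>v r" if B: "B \<in> T" for B
      proof -
        have "R *\<^sub>v (B *\<^sub>v x) \<in> V" "\<i> \<cdot>\<^sub>v (R *\<^sub>v (B *\<^sub>v x)) \<in> V"
          using x B smult[OF x(1) B, of \<i>] unfolding W_def by auto
        thus ?thesis using V' by blast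
      qed
      have "R = 0\<^sub>m r n"
      proof (rule eq_zero_mat_by_mult_vec[OF R_carrier])
        fix v :: "complex vec" assume v: "v \<in> carrier_vec n"
        have "R *\<^sub>v v \<in> {0\<^sub>v r}"
          by (rule irreducible_annihilator[OF T_rc(3,1) n_ge_2 T_rc(2) R_carrier _ _ _ xc x0 _ v]) (auto simp: z)
        thus "R *\<^sub>v v = 0\<^sub>v r" by simp
      qed
      thus False using R_nonzero by simp
    qed
    obtain v where v: "v \<in> V" "v \<noteq> 0\<^sub>v r" using V' by blast
    have vc: "v \<in> carrier_vec r" using v(1) V' by blast
    have "L *\<^sub>v v \<in> W" unfolding W_def using vec_carrier(1)[OF vc] V(2)[OF _ v(1)] compress_mult_vec[OF T_rc(5) vc] by auto
    moreover have "L *\<^sub>v v \<noteq> 0\<^sub>v n" using L_injective[OF vc] v(2) by blast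
    ultimately show "\<exists>x\<in>W. x \<noteq> 0\<^sub>v n" by blast
  qed (auto simp: W_def)
  moreover have "B *\<^sub>v w \<in> W" if B: "B \<in> T" and w: "w \<in> W" for B w
  proof -
    have wc: "w \<in> carrier_vec n" using w unfolding W_def by simp
    have "R *\<^sub>v (C *\<^sub>v (B *\<^sub>v w)) \<in> V" if C: "C \<in> T" for C
      using w T_rc(2)[OF C B] assoc_mult_mat_vec[OF T_rc(5)[OF C] T_rc(5)[OF B] wc] unfolding W_def by auto
    thus ?thesis unfolding W_def using mult_mat_vec_carrier[OF T_rc(5)[OF B] wc] by simp
  qed
  ultimately show thesis by (rule that)
qed

end

text \<open>
  The closed cone generated by \<open>S\<close> satisfies the same hypotheses, and in it a member of least rank exists.
\<close>

lemma rc_semigroup_real_form: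
  assumes S: "rc_semigroup n S" and n: "n \<ge> 2"
  obtains W where "real_form n W" "\<And>B w. B \<in> S \<Longrightarrow> w \<in> W \<Longrightarrow> B *\<^sub>v w \<in> W"
proof -
  define T where "T = mclosure n (nonneg_cone S)"
  have cone_in: "complex_of_real c \<cdot>\<^sub>m M \<in> nonneg_cone S" if c: "c \<ge> 0" and M: "M \<in> nonneg_cone S" for c M
  proof -
    obtain d N where N: "N \<in> S" "d \<ge> 0" "M = complex_of_real d \<cdot>\<^sub>m N" using M unfolding nonneg_cone_def by blast
    have "complex_of_real c \<cdot>\<^sub>m M = complex_of_real (c * d) \<cdot>\<^sub>m N" unfolding N(3) by (intro eq_matI) auto
    thus ?thesis unfolding nonneg_cone_def using N c mult_nonneg_nonneg[OF c N(2)] by blast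
  qed
  note cone = rc_semigroup_cone[OF S]
  have T: "closed_cone_semigroup n T" unfolding T_def by (rule closure_of_cone_semigroup[OF cone cone_in])
  note D = rc_semigroupD[OF closed_cone_semigroupD(1)[OF T]]
  have ST: "S \<subseteq> T"
  proof
    fix M assume M: "M \<in> S"
    have "M = complex_of_real 1 \<cdot>\<^sub>m M" by (intro eq_matI) auto
    hence "M \<in> nonneg_cone S" unfolding nonneg_cone_def using M zero_le_one by blast
    thus "M \<in> T" unfolding T_def using mclosure_subset[OF rc_semigroupD(1)[OF cone]] by blast
  qed
  define Q where "Q k \<longleftrightarrow> (\<exists>L\<in>carrier_mat n k. \<exists>R\<in>carrier_mat k n. L * R \<in> T \<and> L * R \<noteq> 0\<^sub>m n n)" for k
  obtain M where M: "M \<in> T" "M \<noteq> 0\<^sub>m n n" by (rule irreducible_nonzero_member[OF D(3,1) n])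
  have "Q n" unfolding Q_def using M D(5)[OF M(1)] square_mult_one(1)[OF D(5)[OF M(1)]] by (metis one_carrier_mat)
  hence "Q (LEAST k. Q k)" by (rule LeastI)
  then obtain L R where LR: "L \<in> carrier_mat n (LEAST k. Q k)" "R \<in> carrier_mat (LEAST k. Q k) n" "L * R \<in> T" "L * R \<noteq> 0\<^sub>m n n"
    unfolding Q_def by blast
  interpret minimal_factor n "LEAST k. Q k" T L R
  proof (rule minimal_factor.intro)
    fix k L' R' assume "L' \<in> carrier_mat n k" "R' \<in> carrier_mat k n" "L' * R' \<in> T" "L' * R' \<noteq> 0\<^sub>m n n"
    hence "Q k" unfolding Q_def by blast
    thus "(LEAST k. Q k) \<le> k" by (rule Least_le)
  qed (fact T n LR)+
  obtain W where "real_form n W" "\<And>B w. B \<in> T \<Longrightarrow> w \<in> W \<Longrightarrow> B *\<^sub>v w \<in> W" using invariant_real_form by blast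
  thus thesis using that ST by blast
qed

section \<open>Realization from an invariant real form\<close>

text \<open>
  By irreducibility \<open>W + \<i>W\<close> is the whole space, so the unit vectors can be written as \<open>a j + \<i> b j\<close> with
  \<open>a j\<close> and \<open>b j\<close> in \<open>W\<close>. The determinant of the matrix with columns \<open>a j + t b j\<close> is a polynomial in
  \<open>t\<close> that is nonzero at \<open>\<i>\<close>, hence at some real \<open>t\<close>; for this \<open>t\<close> the columns lie in \<open>W\<close> and form a basis
  of \<open>\<complex>\<^sup>n\<close>. A vector of \<open>W\<close> has real coordinates in it, because the imaginary parts of the coordinates
  describe a vector of \<open>W \<inter> \<i>W\<close>.
\<close>

lemma real_form_realizable:
  assumes irr: "irreducible_matrices n S" and S: "S \<subseteq> carrier_mat n n"
    and form: "real_form n W" and inv: "\<And>M w. M \<in> S \<Longrightarrow> w \<in> W \<Longrightarrow> M *\<^sub>v w \<in> W"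
  shows "realizable n S"
proof -
  have Wc: "w \<in> carrier_vec n" if "w \<in> W" for w using form that unfolding real_form_def by blast
  have Wadd: "x + y \<in> W" if "x \<in> W" "y \<in> W" for x y using form that unfolding real_form_def by blast
  have Wsm: "complex_of_real c \<cdot>\<^sub>v x \<in> W" if "x \<in> W" for c x using form that unfolding real_form_def by blast
  have Wi: "x = 0\<^sub>v n" if "x \<in> W" "\<i> \<cdot>\<^sub>v x \<in> W" for x using form that unfolding real_form_def by blast
  obtain w0 where w0: "w0 \<in> W" "w0 \<noteq> 0\<^sub>v n" using form unfolding real_form_def by blast
  have W0: "0\<^sub>v n \<in> W"
  proof -
    have "0\<^sub>v n = complex_of_real 0 \<cdot>\<^sub>v w0" using Wc[OF w0(1)] by auto
    thus ?thesis using Wsm[OF w0(1)] by metis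
  qed
  define V where "V = {v. \<exists>x\<in>W. \<exists>y\<in>W. v = x + \<i> \<cdot>\<^sub>v y}"
  have V: "V = carrier_vec n"
  proof (rule irreducible_matricesD[OF irr, of _ w0])
    show "V \<subseteq> carrier_vec n" using Wc unfolding V_def by auto
    show "u + v \<in> V" if uv: "u \<in> V" "v \<in> V" for u v
    proof -
      obtain x y where x: "x \<in> W" "y \<in> W" "u = x + \<i> \<cdot>\<^sub>v y" using uv(1) unfolding V_def by blast
      obtain x' y' where x': "x' \<in> W" "y' \<in> W" "v = x' + \<i> \<cdot>\<^sub>v y'" using uv(2) unfolding V_def by blast
      have "u + v = (x + x') + \<i> \<cdot>\<^sub>v (y + y')"
        unfolding x(3) x'(3) using Wc[OF x(1)] Wc[OF x(2)] Wc[OF x'(1)] Wc[OF x'(2)] by (intro eq_vecI) (auto simp: algebra_simps)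
      thus ?thesis using Wadd[OF x(1) x'(1)] Wadd[OF x(2) x'(2)] unfolding V_def by blast
    qed
    show "c \<cdot>\<^sub>v u \<in> V" if u: "u \<in> V" for c u
    proof -
      obtain x y where x: "x \<in> W" "y \<in> W" "u = x + \<i> \<cdot>\<^sub>v y" using u unfolding V_def by blast
      have "c \<cdot>\<^sub>v u = (complex_of_real (Re c) \<cdot>\<^sub>v x + complex_of_real (- Im c) \<cdot>\<^sub>v y)
          + \<i> \<cdot>\<^sub>v (complex_of_real (Im c) \<cdot>\<^sub>v x + complex_of_real (Re c) \<cdot>\<^sub>v y)"
        unfolding x(3) using Wc[OF x(1)] Wc[OF x(2)]
        by (intro eq_vecI) (auto simp: complex_eq_iff algebra_simps)
      thus ?thesis using Wadd[OF Wsm[OF x(1)] Wsm[OF x(2)]] unfolding V_def by blast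
    qed
    show "M *\<^sub>v u \<in> V" if M: "M \<in> S" and u: "u \<in> V" for M u
    proof -
      obtain x y where x: "x \<in> W" "y \<in> W" "u = x + \<i> \<cdot>\<^sub>v y" using u unfolding V_def by blast
      have Mc: "M \<in> carrier_mat n n" using M S by blast
      have "M *\<^sub>v u = M *\<^sub>v x + \<i> \<cdot>\<^sub>v (M *\<^sub>v y)"
        unfolding x(3) using Wc[OF x(1)] Wc[OF x(2)] Mc by (simp add: mult_add_distrib_mat_vec[of _ n n] mult_mat_vec[of _ n n])
      thus ?thesis using inv[OF M x(1)] inv[OF M x(2)] unfolding V_def by blast
    qed
    have "w0 = w0 + \<i> \<cdot>\<^sub>v 0\<^sub>v n" using Wc[OF w0(1)] by (intro eq_vecI) auto
    thus "w0 \<in> V" unfolding V_def using w0(1) W0 by blast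
  qed (rule w0(2))
  have "\<exists>x y. x \<in> W \<and> y \<in> W \<and> unit_vec n j = x + \<i> \<cdot>\<^sub>v y" for j
  proof -
    have "unit_vec n j \<in> V" unfolding V by simp
    thus ?thesis unfolding V_def by blast
  qed
  then obtain a b where ab: "\<And>j. a j \<in> W" "\<And>j. b j \<in> W" "\<And>j. unit_vec n j = a j + \<i> \<cdot>\<^sub>v b j" by metis
  have dim_ab: "dim_vec (a j) = n" "dim_vec (b j) = n" for j using Wc[OF ab(1)[of j]] Wc[OF ab(2)[of j]] by auto
  \<comment> \<open>\<open>P\<close> is the matrix pencil with columns \<open>a j + t b j\<close> over polynomials in
    \<open>t\<close>, and \<open>Q c\<close> its value at \<open>c\<close>.\<close>
  define P where "P = mat n n (\<lambda>(i,j). [:a j $ i, b j $ i:])"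
  define Q where "Q c = mat n n (\<lambda>(i,j). a j $ i + c * b j $ i)" for c
  have PQ: "poly (det P) c = det (Q c)" for c
    by (rule poly_det_cong[of _ n]) (auto simp: P_def Q_def)
  have "Q \<i> = 1\<^sub>m n"
  proof (rule eq_matI)
    fix i j assume "i < dim_row (1\<^sub>m n :: complex mat)" "j < dim_col (1\<^sub>m n :: complex mat)"
    hence ij: "i < n" "j < n" by auto
    have "(1\<^sub>m n :: complex mat) $$ (i,j) = unit_vec n j $ i" using ij by auto
    also have "\<dots> = a j $ i + \<i> * b j $ i" unfolding ab(3) using ij dim_ab by simp
    finally show "Q \<i> $$ (i,j) = 1\<^sub>m n $$ (i,j)" unfolding Q_def using ij by simp
  qed (auto simp: Q_def)
  hence "poly (det P) \<i> \<noteq> 0" unfolding PQ by simp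
  hence "det P \<noteq> 0" by auto
  hence "finite {c. poly (det P) c = 0}" by (rule poly_roots_finite)
  moreover have "infinite (range complex_of_real)"
    using finite_imageD[of complex_of_real UNIV] infinite_UNIV_char_0 by (auto simp: inj_on_def)
  ultimately obtain t where t: "poly (det P) (complex_of_real t) \<noteq> 0"
    using finite_subset[of "range complex_of_real" "{c. poly (det P) c = 0}"] by blast
  define Z where "Z = Q (complex_of_real t)"
  have Z: "Z \<in> carrier_mat n n" unfolding Z_def Q_def by simp
  have "det Z \<noteq> 0" using t unfolding PQ Z_def .
  hence inj: "v = 0\<^sub>v n" if "v \<in> carrier_vec n" "Z *\<^sub>v v = 0\<^sub>v n" for v
    using that det_0_iff_vec_prod_zero[OF Z] by blast
  obtain Y where Y: "Y \<in> carrier_mat n n" "Z * Y = 1\<^sub>m n" "Y * Z = 1\<^sub>m n"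
    using injective_square_inverse[OF Z inj] by blast
  have colX: "col Z j \<in> W" if j: "j < n" for j
  proof -
    have "col Z j = a j + complex_of_real t \<cdot>\<^sub>v b j"
      unfolding Z_def Q_def using j by (intro eq_vecI) (auto simp: dim_ab)
    thus ?thesis using Wadd[OF ab(1) Wsm[OF ab(2)]] by simp
  qed
  have real_comb: "Z *\<^sub>v vec n (\<lambda>j. complex_of_real (f j)) \<in> W" for f
  proof -
    have "vec n (\<lambda>i. \<Sum>j<m. Z $$ (i,j) * complex_of_real (f j)) \<in> W" if "m \<le> n" for m
      using that
    proof (induction m)
      case 0
      have "vec n (\<lambda>i. \<Sum>j<0. Z $$ (i,j) * complex_of_real (f j)) = 0\<^sub>v n" by (intro eq_vecI) auto
      thus ?case using W0 by simp
    next
      case (Suc m)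
      define h where "h = vec n (\<lambda>i. \<Sum>j<m. Z $$ (i,j) * complex_of_real (f j))"
      have "vec n (\<lambda>i. \<Sum>j<Suc m. Z $$ (i,j) * complex_of_real (f j)) = h + complex_of_real (f m) \<cdot>\<^sub>v col Z m"
        using carrier_matD[OF Z] Suc.prems unfolding h_def by (intro eq_vecI) (auto simp: mult.commute)
      moreover have "h \<in> W" unfolding h_def using Suc.IH[OF Suc_leD[OF Suc.prems]] .
      moreover have "complex_of_real (f m) \<cdot>\<^sub>v col Z m \<in> W" using Wsm[OF colX] Suc.prems by simp
      ultimately show ?case using Wadd by simp
    qed
    from this[of n] have "vec n (\<lambda>i. \<Sum>j<n. Z $$ (i,j) * complex_of_real (f j)) \<in> W" by simp
    moreover have "Z *\<^sub>v vec n (\<lambda>j. complex_of_real (f j)) = vec n (\<lambda>i. \<Sum>j<n. Z $$ (i,j) * complex_of_real (f j))"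
      using Z by (intro eq_vecI) (auto simp: scalar_prod_def atLeast0LessThan)
    ultimately show ?thesis by simp
  qed
  have real_coords: "(Y *\<^sub>v w) $ i \<in> \<real>" if w: "w \<in> W" and i: "i < n" for w i
  proof -
    define u where "u = Y *\<^sub>v w"
    have u: "u \<in> carrier_vec n" unfolding u_def by (rule mult_mat_vec_carrier[OF Y(1) Wc[OF w]])
    define p q where "p = vec n (\<lambda>j. complex_of_real (Re (u $ j)))" and "q = vec n (\<lambda>j. complex_of_real (Im (u $ j)))"
    have pq: "p \<in> carrier_vec n" "q \<in> carrier_vec n" unfolding p_def q_def by auto
    have Xpq: "Z *\<^sub>v p \<in> W" "Z *\<^sub>v q \<in> W" unfolding p_def q_def by (rule real_comb)+
    have Xc: "Z *\<^sub>v p \<in> carrier_vec n" "Z *\<^sub>v q \<in> carrier_vec n" using Xpq Wc by auto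
    have "u = p + \<i> \<cdot>\<^sub>v q" using u unfolding p_def q_def by (intro eq_vecI) (auto simp: complex_eq_iff)
    hence "Z *\<^sub>v u = Z *\<^sub>v p + \<i> \<cdot>\<^sub>v (Z *\<^sub>v q)"
      using pq Z by (simp add: mult_add_distrib_mat_vec[of _ n n] mult_mat_vec[of _ n n])
    moreover have "Z *\<^sub>v u = w"
      unfolding u_def assoc_mult_mat_vec[OF Z Y(1) Wc[OF w], symmetric] Y(2) using Wc[OF w] by simp
    ultimately have "w = Z *\<^sub>v p + \<i> \<cdot>\<^sub>v (Z *\<^sub>v q)" by simp
    hence "\<i> \<cdot>\<^sub>v (Z *\<^sub>v q) = w + complex_of_real (- 1) \<cdot>\<^sub>v (Z *\<^sub>v p)"
      using Xc by (intro eq_vecI) auto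
    \<comment> \<open>The vector \<open>Z q\<close> lies in \<open>W\<close> together with its multiple by
      \<open>\<i>\<close>, hence it is zero.\<close>
    hence "\<i> \<cdot>\<^sub>v (Z *\<^sub>v q) \<in> W" using Wadd[OF w Wsm[OF Xpq(1)]] by metis
    hence "Z *\<^sub>v q = 0\<^sub>v n" by (rule Wi[OF Xpq(2)])
    hence "q = 0\<^sub>v n" by (rule inj[OF pq(2)])
    moreover have "q $ i = complex_of_real (Im (u $ i))" unfolding q_def using i by simp
    ultimately have "Im (u $ i) = 0" using i by simp
    thus ?thesis unfolding u_def by (simp add: complex_is_Real_iff)
  qed
  have "elements_mat (Y * M * Z) \<subseteq> \<real>" if M: "M \<in> S" for M
  proof
    fix e assume "e \<in> elements_mat (Y * M * Z)"
    have Mc: "M \<in> carrier_mat n n" using M S by blast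
    have YM: "Y * M \<in> carrier_mat n n" using Y(1) Mc by (rule mult_carrier_mat)
    obtain i j where ij: "i < n" "j < n" "e = (Y * M * Z) $$ (i,j)"
      using \<open>e \<in> elements_mat (Y * M * Z)\<close> Y(1) Z unfolding elements_mat_def by auto
    have cX: "col Z j \<in> carrier_vec n" using Z by auto
    have "(K * Z) $$ (i,j) = (K *\<^sub>v col Z j) $ i" if "K \<in> carrier_mat n n" for K
      using that carrier_matD[OF Z] ij(1,2) by simp
    from this[OF YM] have "e = ((Y * M) *\<^sub>v col Z j) $ i" unfolding ij(3) .
    also have "\<dots> = (Y *\<^sub>v (M *\<^sub>v col Z j)) $ i" unfolding assoc_mult_mat_vec[OF Y(1) Mc cX] ..
    finally show "e \<in> \<real>" using real_coords[OF inv[OF M colX[OF ij(2)]] ij(1)] by simp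
  qed
  thus ?thesis unfolding realizable_def inverts_mat_def using Z Y by (intro bexI[of _ Z] bexI[of _ Y]) auto
qed

theorem theorem5p2:
  fixes n :: nat and \<S> :: "complex mat set"
  assumes "n \<ge> 2"
    and "matrix_semigroup n \<S>"
    and "irreducible_matrices n \<S>"
    and "\<And>S T. S \<in> \<S> \<Longrightarrow> T \<in> \<S> \<Longrightarrow> has_real_spectrum (S * T - T * S)"
  shows "realizable n \<S>"
proof -
  have S: "rc_semigroup n \<S>" unfolding rc_semigroup_def using assms by blast
  obtain W where W: "real_form n W" "\<And>M w. M \<in> \<S> \<Longrightarrow> w \<in> W \<Longrightarrow> M *\<^sub>v w \<in> W"
    using rc_semigroup_real_form[OF S assms(1)] by blast
  show ?thesis by (rule real_form_realizable[OF assms(3) rc_semigroupD(1)[OF S] W])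
qed

end
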